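(* Let $k$ be an algebraically closed field, let $A$ be an associative $k$-algebra with identity, and let $G$ be a finite abelian group with $\operatorname{char}(k)\nmid|G|$ acting on $A$ by $k$-algebra automorphisms, with a fixed isomorphism $G\to G^\vee$, $g\mapsto\chi_g$. Let $\mu$ be a normalised 2-cocycle of $G$ with values in $k^\times$. Then the twisted group algebra $AG_\mu$ decomposes as an $(A^{G,\mu},A^{G,\mu})$-bimodule as $$AG_\mu\cong\bigoplus_{g\in G}{}^{\mathrm{id}}(A^{G,\mu})^{\phi_g},$$ where each $\phi_g$ is some $k$-algebra automorphism of $A^{G,\mu}$ and $\phi_e=\mathrm{id}$. Each summand is free as a left and as a right $A^{G,\mu}$-module. Consequently $AG_\mu$ is a faithfully flat extension of $A^{G,\mu}$ on both the left and the right. Furthermore, $AG_\mu$ is a faithfully flat extension of $A$ on both the left and the right.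
   Context: A normalised 2-cocycle is a function $\mu:G\times G\to k^\times$ with $\mu(g,h)\mu(gh,l)=\mu(g,hl)\mu(h,l)$ and $\mu(e,g)=\mu(g,e)=1$ for all $g,h,l\in G$. The action of $g$ is written $a\mapsto a^g$ and induces a $G$-grading $A_g=\{a\in A: a^h=\chi_{g^{-1}}(h)a\ \forall h\in G\}$. The cocycle twist $A^{G,\mu}$ is the vector space $A$ with multiplication $a\ast_\mu b=\mu(g,h)ab$ for $a\in A_g,b\in A_h$. $AG_\mu$ is the vector space $A\otimes_k kG$ with multiplication $(a\otimes g)(b\otimes h)=\mu(g,h)ab\otimes gh$; $G$ acts on it by $(a\otimes g)^h=\chi_g(h)(a^h\otimes g)$. The algebra $A^{G,\mu}$ is identified with the invariant subring $(AG_\mu)^G\subset AG_\mu$ by sending $a\in A_g$ to $a\otimes g$, and $A$ is embedded in $AG_\mu$ by $a\mapsto a\otimes e$. For a ring $R$ and an automorphism $\phi$ of $R$, ${}^{\mathrm{id}}R^{\phi}$ denotes the $(R,R)$-bimodule with underlying group $R$, left action by multiplication, and right action $m\cdot r=m\phi(r)$. *)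

theory Defs
  imports "HOL-Algebra.Algebra"
begin

section \<open>Algebras, characters, cocycles\<close>

text \<open>The library locale \<open>algebra\<close> is commutative; this is the noncommutative unital version.\<close>

locale assoc_algebra = module + ring M +
  assumes smult_mult_left:
      "\<lbrakk>a \<in> carrier R; x \<in> carrier M; y \<in> carrier M\<rbrakk> \<Longrightarrow>
      (a \<odot>\<^bsub>M\<^esub> x) \<otimes>\<^bsub>M\<^esub> y = a \<odot>\<^bsub>M\<^esub> (x \<otimes>\<^bsub>M\<^esub> y)"
    and smult_mult_right:
      "\<lbrakk>a \<in> carrier R; x \<in> carrier M; y \<in> carrier M\<rbrakk> \<Longrightarrow>
      x \<otimes>\<^bsub>M\<^esub> (a \<odot>\<^bsub>M\<^esub> y) = a \<odot>\<^bsub>M\<^esub> (x \<otimes>\<^bsub>M\<^esub> y)"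

definition alg_auts :: "('k, 'x) ring_scheme \<Rightarrow> ('k, 'a, 'y) module_scheme \<Rightarrow> ('a \<Rightarrow> 'a) set"
  where "alg_auts K A = {f \<in> ring_iso A A.
     \<forall>c\<in>carrier K. \<forall>a\<in>carrier A. f (c \<odot>\<^bsub>A\<^esub> a) = c \<odot>\<^bsub>A\<^esub> f a}"

definition acts_by_alg_auts ::
  "('k, 'x) ring_scheme \<Rightarrow> ('k, 'a, 'y) module_scheme \<Rightarrow> ('g, 'z) monoid_scheme \<Rightarrow> ('g \<Rightarrow> 'a \<Rightarrow> 'a) \<Rightarrow> bool"
  where "acts_by_alg_auts K A G act \<longleftrightarrow>
     group_action G (carrier A) act \<and> (\<forall>g\<in>carrier G. act g \<in> alg_auts K A)"

definition ring_characteristic :: "('k, 'x) ring_scheme \<Rightarrow> nat"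
  where "ring_characteristic K =
     (if \<exists>n::nat>0. add_pow K n \<one>\<^bsub>K\<^esub> = \<zero>\<^bsub>K\<^esub> then LEAST n::nat. 0 < n \<and> add_pow K n \<one>\<^bsub>K\<^esub> = \<zero>\<^bsub>K\<^esub> else 0)"

definition dual_group :: "('g, 'z) monoid_scheme \<Rightarrow> ('k, 'x) ring_scheme \<Rightarrow> ('g \<Rightarrow> 'k) monoid"
  where "dual_group G K =
     \<lparr>carrier = hom G (units_of K) \<inter> extensional (carrier G),
      monoid.mult = (\<lambda>\<alpha> \<beta>. \<lambda>g\<in>carrier G. \<alpha> g \<otimes>\<^bsub>K\<^esub> \<beta> g),
      one = (\<lambda>g\<in>carrier G. \<one>\<^bsub>K\<^esub>)\<rparr>"

definition normalised_2cocycle :: "('g, 'z) monoid_scheme \<Rightarrow> ('k, 'x) ring_scheme \<Rightarrow> ('g \<Rightarrow> 'g \<Rightarrow> 'k) \<Rightarrow> bool"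
  where "normalised_2cocycle G K \<mu> \<longleftrightarrow>
     (\<forall>g\<in>carrier G. \<forall>h\<in>carrier G. \<mu> g h \<in> Units K) \<and>
     (\<forall>g\<in>carrier G. \<forall>h\<in>carrier G. \<forall>l\<in>carrier G.
        \<mu> g h \<otimes>\<^bsub>K\<^esub> \<mu> (g \<otimes>\<^bsub>G\<^esub> h) l = \<mu> g (h \<otimes>\<^bsub>G\<^esub> l) \<otimes>\<^bsub>K\<^esub> \<mu> h l) \<and>
     (\<forall>g\<in>carrier G. \<mu> \<one>\<^bsub>G\<^esub> g = \<one>\<^bsub>K\<^esub> \<and> \<mu> g \<one>\<^bsub>G\<^esub> = \<one>\<^bsub>K\<^esub>)"


section \<open>The induced grading and the cocycle twist\<close>

definition graded_part ::
  "('k, 'a, 'y) module_scheme \<Rightarrow> ('g, 'z) monoid_scheme \<Rightarrow> ('g \<Rightarrow> 'a \<Rightarrow> 'a) \<Rightarrow> ('g \<Rightarrow> 'g \<Rightarrow> 'k) \<Rightarrow> 'g \<Rightarrow> 'a set"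
  where "graded_part A G act \<chi> g =
     {a \<in> carrier A. \<forall>h\<in>carrier G. act h a = \<chi> (inv\<^bsub>G\<^esub> g) h \<odot>\<^bsub>A\<^esub> a}"

text \<open>\<open>graded_comp A G act \<chi> a g\<close> is the component of \<open>a\<close> of degree \<open>g\<close>, read off from the
  decomposition of \<open>a\<close> as a sum of homogeneous elements.\<close>

definition graded_comp ::
  "('k, 'a, 'y) module_scheme \<Rightarrow> ('g, 'z) monoid_scheme \<Rightarrow> ('g \<Rightarrow> 'a \<Rightarrow> 'a) \<Rightarrow> ('g \<Rightarrow> 'g \<Rightarrow> 'k) \<Rightarrow> 'a \<Rightarrow> 'g \<Rightarrow> 'a"
  where "graded_comp A G act \<chi> a =
     (THE f. f \<in> (\<Pi>\<^sub>E g\<in>carrier G. graded_part A G act \<chi> g) \<and> (\<Oplus>\<^bsub>A\<^esub> g\<in>carrier G. f g) = a)"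

text \<open>The multiplication is the biadditive extension of \<open>a * b = \<mu>(g,h) ab\<close> for \<open>a\<close> of
  degree \<open>g\<close> and \<open>b\<close> of degree \<open>h\<close>.\<close>

definition cocycle_twist ::
  "('k, 'a, 'y) module_scheme \<Rightarrow> ('g, 'z) monoid_scheme \<Rightarrow> ('g \<Rightarrow> 'a \<Rightarrow> 'a) \<Rightarrow> ('g \<Rightarrow> 'g \<Rightarrow> 'k) \<Rightarrow>
   ('g \<Rightarrow> 'g \<Rightarrow> 'k) \<Rightarrow> ('k, 'a) module"
  where "cocycle_twist A G act \<chi> \<mu> =
     \<lparr>carrier = carrier A,
      monoid.mult = (\<lambda>a b. \<Oplus>\<^bsub>A\<^esub> p\<in>carrier G \<times> carrier G.
        \<mu> (fst p) (snd p) \<odot>\<^bsub>A\<^esub> (graded_comp A G act \<chi> a (fst p) \<otimes>\<^bsub>A\<^esub> graded_comp A G act \<chi> b (snd p))),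
      one = \<one>\<^bsub>A\<^esub>,
      ring.zero = \<zero>\<^bsub>A\<^esub>,
      ring.add = ring.add A,
      module.smult = module.smult A\<rparr>"


section \<open>The twisted group algebra\<close>

text \<open>As \<open>G\<close> is finite, the tensor product of \<open>A\<close> with the group algebra is represented by the
  functions from \<open>G\<close> to \<open>A\<close>: the function \<open>x\<close> stands for the sum of the \<open>x g \<otimes> g\<close>.\<close>

definition pure_tensor ::
  "('k, 'a, 'y) module_scheme \<Rightarrow> ('g, 'z) monoid_scheme \<Rightarrow> 'a \<Rightarrow> 'g \<Rightarrow> ('g \<Rightarrow> 'a)"
  where "pure_tensor A G a g = (\<lambda>h\<in>carrier G. if h = g then a else \<zero>\<^bsub>A\<^esub>)"

definition twisted_group_algebra ::
  "('k, 'a, 'y) module_scheme \<Rightarrow> ('g, 'z) monoid_scheme \<Rightarrow> ('g \<Rightarrow> 'g \<Rightarrow> 'k) \<Rightarrow> ('k, 'g \<Rightarrow> 'a) module"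
  where "twisted_group_algebra A G \<mu> =
     \<lparr>carrier = (\<Pi>\<^sub>E g\<in>carrier G. carrier A),
      monoid.mult = (\<lambda>x y. \<lambda>l\<in>carrier G.
        \<Oplus>\<^bsub>A\<^esub> p\<in>{p \<in> carrier G \<times> carrier G. fst p \<otimes>\<^bsub>G\<^esub> snd p = l}.
          \<mu> (fst p) (snd p) \<odot>\<^bsub>A\<^esub> (x (fst p) \<otimes>\<^bsub>A\<^esub> y (snd p))),
      one = pure_tensor A G \<one>\<^bsub>A\<^esub> \<one>\<^bsub>G\<^esub>,
      ring.zero = (\<lambda>g\<in>carrier G. \<zero>\<^bsub>A\<^esub>),
      ring.add = (\<lambda>x y. \<lambda>g\<in>carrier G. x g \<oplus>\<^bsub>A\<^esub> y g),
      module.smult = (\<lambda>c x. \<lambda>g\<in>carrier G. c \<odot>\<^bsub>A\<^esub> x g)\<rparr>"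

lemma twisted_group_algebra_mult_pure_tensor:
  assumes "assoc_algebra K A" "group G" "finite (carrier G)" "normalised_2cocycle G K \<mu>"
    and ab: "a \<in> carrier A" "b \<in> carrier A" and gh: "g \<in> carrier G" "h \<in> carrier G"
  shows "pure_tensor A G a g \<otimes>\<^bsub>twisted_group_algebra A G \<mu>\<^esub> pure_tensor A G b h =
    pure_tensor A G (\<mu> g h \<odot>\<^bsub>A\<^esub> (a \<otimes>\<^bsub>A\<^esub> b)) (g \<otimes>\<^bsub>G\<^esub> h)"
proof -
  interpret A: assoc_algebra K A by fact
  interpret G: group G by fact
  have \<mu>: "\<mu> u v \<in> carrier K" if "u \<in> carrier G" "v \<in> carrier G" for u v
    using assms(4) that by (auto simp: normalised_2cocycle_def Units_def)
  have smult_zero: "c \<odot>\<^bsub>A\<^esub> \<zero>\<^bsub>A\<^esub> = \<zero>\<^bsub>A\<^esub>" if "c \<in> carrier K" for c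
    using that A.smult_r_null by blast
  show ?thesis
    unfolding twisted_group_algebra_def pure_tensor_def
  proof (simp, rule restrict_ext)
    fix l assume l: "l \<in> carrier G"
    let ?S = "{p \<in> carrier G \<times> carrier G. fst p \<otimes>\<^bsub>G\<^esub> snd p = l}"
    let ?f = "\<lambda>p. \<mu> (fst p) (snd p) \<odot>\<^bsub>A\<^esub>
        ((if fst p \<in> carrier G then if fst p = g then a else \<zero>\<^bsub>A\<^esub> else undefined) \<otimes>\<^bsub>A\<^esub>
         (if snd p \<in> carrier G then if snd p = h then b else \<zero>\<^bsub>A\<^esub> else undefined))"
    have fin: "finite ?S" using assms(3) by (auto intro: finite_subset[of _ "carrier G \<times> carrier G"])
    have f: "?f p = (if (g, h) = p then \<mu> g h \<odot>\<^bsub>A\<^esub> (a \<otimes>\<^bsub>A\<^esub> b) else \<zero>\<^bsub>A\<^esub>)" if "p \<in> ?S" for p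
      using that ab \<mu> smult_zero by (cases p) auto
    have "finsum A ?f ?S = finsum A (\<lambda>p. if (g, h) = p then \<mu> g h \<odot>\<^bsub>A\<^esub> (a \<otimes>\<^bsub>A\<^esub> b) else \<zero>\<^bsub>A\<^esub>) ?S"
      using f ab gh \<mu> by (intro A.finsum_cong') auto
    also have "\<dots> = (if l = g \<otimes>\<^bsub>G\<^esub> h then \<mu> g h \<odot>\<^bsub>A\<^esub> (a \<otimes>\<^bsub>A\<^esub> b) else \<zero>\<^bsub>A\<^esub>)"
    proof (cases "l = g \<otimes>\<^bsub>G\<^esub> h")
      case True
      then have "(g, h) \<in> ?S" using gh by auto
      then show ?thesis
        using A.finsum_singleton[OF _ fin, of "(g,h)" "\<lambda>_. \<mu> g h \<odot>\<^bsub>A\<^esub> (a \<otimes>\<^bsub>A\<^esub> b)"] ab gh \<mu> True by auto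
    next
      case False
      then have "finsum A (\<lambda>p. if (g, h) = p then \<mu> g h \<odot>\<^bsub>A\<^esub> (a \<otimes>\<^bsub>A\<^esub> b) else \<zero>\<^bsub>A\<^esub>) ?S = finsum A (\<lambda>_. \<zero>\<^bsub>A\<^esub>) ?S"
        by (intro A.finsum_cong') auto
      then show ?thesis using False by simp
    qed
    finally show "finsum A ?f ?S = (if l = g \<otimes>\<^bsub>G\<^esub> h then \<mu> g h \<odot>\<^bsub>A\<^esub> (a \<otimes>\<^bsub>A\<^esub> b) else \<zero>\<^bsub>A\<^esub>)" .
  qed
qed

definition base_embedding ::
  "('k, 'a, 'y) module_scheme \<Rightarrow> ('g, 'z) monoid_scheme \<Rightarrow> 'a \<Rightarrow> ('g \<Rightarrow> 'a)"
  where "base_embedding A G a = pure_tensor A G a \<one>\<^bsub>G\<^esub>"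

text \<open>The additive extension of \<open>a \<mapsto> a \<otimes> g\<close> for \<open>a\<close> homogeneous of degree \<open>g\<close>.\<close>

definition twist_embedding ::
  "('k, 'a, 'y) module_scheme \<Rightarrow> ('g, 'z) monoid_scheme \<Rightarrow> ('g \<Rightarrow> 'a \<Rightarrow> 'a) \<Rightarrow> ('g \<Rightarrow> 'g \<Rightarrow> 'k) \<Rightarrow> 'a \<Rightarrow> ('g \<Rightarrow> 'a)"
  where "twist_embedding A G act \<chi> a = (\<lambda>g\<in>carrier G. graded_comp A G act \<chi> a g)"


section \<open>Modules and bimodules over noncommutative rings\<close>

text \<open>Modules are carried by ring records, of which only the additive part is used.\<close>

locale left_module = R: ring R + M: abelian_group M
  for R :: "('r, 'x) ring_scheme" and M :: "('m, 'y) ring_scheme" and l :: "'r \<Rightarrow> 'm \<Rightarrow> 'm" +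
  assumes "\<lbrakk>r \<in> carrier R; x \<in> carrier M\<rbrakk> \<Longrightarrow> l r x \<in> carrier M"
    and "\<lbrakk>r \<in> carrier R; s \<in> carrier R; x \<in> carrier M\<rbrakk> \<Longrightarrow> l (r \<oplus>\<^bsub>R\<^esub> s) x = l r x \<oplus>\<^bsub>M\<^esub> l s x"
    and "\<lbrakk>r \<in> carrier R; x \<in> carrier M; y \<in> carrier M\<rbrakk> \<Longrightarrow> l r (x \<oplus>\<^bsub>M\<^esub> y) = l r x \<oplus>\<^bsub>M\<^esub> l r y"
    and "\<lbrakk>r \<in> carrier R; s \<in> carrier R; x \<in> carrier M\<rbrakk> \<Longrightarrow> l (r \<otimes>\<^bsub>R\<^esub> s) x = l r (l s x)"
    and "x \<in> carrier M \<Longrightarrow> l \<one>\<^bsub>R\<^esub> x = x"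

locale right_module = R: ring R + M: abelian_group M
  for R :: "('r, 'x) ring_scheme" and M :: "('m, 'y) ring_scheme" and r :: "'m \<Rightarrow> 'r \<Rightarrow> 'm" +
  assumes "\<lbrakk>s \<in> carrier R; x \<in> carrier M\<rbrakk> \<Longrightarrow> r x s \<in> carrier M"
    and "\<lbrakk>s \<in> carrier R; t \<in> carrier R; x \<in> carrier M\<rbrakk> \<Longrightarrow> r x (s \<oplus>\<^bsub>R\<^esub> t) = r x s \<oplus>\<^bsub>M\<^esub> r x t"
    and "\<lbrakk>s \<in> carrier R; x \<in> carrier M; y \<in> carrier M\<rbrakk> \<Longrightarrow> r (x \<oplus>\<^bsub>M\<^esub> y) s = r x s \<oplus>\<^bsub>M\<^esub> r y s"
    and "\<lbrakk>s \<in> carrier R; t \<in> carrier R; x \<in> carrier M\<rbrakk> \<Longrightarrow> r x (s \<otimes>\<^bsub>R\<^esub> t) = r (r x s) t"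
    and "x \<in> carrier M \<Longrightarrow> r x \<one>\<^bsub>R\<^esub> = x"

definition left_module_hom ::
  "('r, 'x) ring_scheme \<Rightarrow> ('m, 'y) ring_scheme \<Rightarrow> ('r \<Rightarrow> 'm \<Rightarrow> 'm) \<Rightarrow>
   ('n, 'z) ring_scheme \<Rightarrow> ('r \<Rightarrow> 'n \<Rightarrow> 'n) \<Rightarrow> ('m \<Rightarrow> 'n) set"
  where "left_module_hom R M l N l' = {f \<in> hom (add_monoid M) (add_monoid N).
     \<forall>r\<in>carrier R. \<forall>x\<in>carrier M. f (l r x) = l' r (f x)}"

definition right_module_hom ::
  "('r, 'x) ring_scheme \<Rightarrow> ('m, 'y) ring_scheme \<Rightarrow> ('m \<Rightarrow> 'r \<Rightarrow> 'm) \<Rightarrow>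
   ('n, 'z) ring_scheme \<Rightarrow> ('n \<Rightarrow> 'r \<Rightarrow> 'n) \<Rightarrow> ('m \<Rightarrow> 'n) set"
  where "right_module_hom R M r N r' = {f \<in> hom (add_monoid M) (add_monoid N).
     \<forall>s\<in>carrier R. \<forall>x\<in>carrier M. f (r x s) = r' (f x) s}"

text \<open>A module is free if it has a basis: a subset such that every element is in exactly one way
  a linear combination, with finitely many nonzero coefficients, of its elements.\<close>

definition free_left_module ::
  "('r, 'x) ring_scheme \<Rightarrow> ('m, 'y) ring_scheme \<Rightarrow> ('r \<Rightarrow> 'm \<Rightarrow> 'm) \<Rightarrow> bool"
  where "free_left_module R M l \<longleftrightarrow> left_module R M l \<and>
     (\<exists>B\<subseteq>carrier M. \<forall>x\<in>carrier M. \<exists>!c. c \<in> B \<rightarrow>\<^sub>E carrier R \<and> finite {b \<in> B. c b \<noteq> \<zero>\<^bsub>R\<^esub>} \<and>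
        x = (\<Oplus>\<^bsub>M\<^esub> b\<in>{b \<in> B. c b \<noteq> \<zero>\<^bsub>R\<^esub>}. l (c b) b))"

definition free_right_module ::
  "('r, 'x) ring_scheme \<Rightarrow> ('m, 'y) ring_scheme \<Rightarrow> ('m \<Rightarrow> 'r \<Rightarrow> 'm) \<Rightarrow> bool"
  where "free_right_module R M r \<longleftrightarrow> right_module R M r \<and>
     (\<exists>B\<subseteq>carrier M. \<forall>x\<in>carrier M. \<exists>!c. c \<in> B \<rightarrow>\<^sub>E carrier R \<and> finite {b \<in> B. c b \<noteq> \<zero>\<^bsub>R\<^esub>} \<and>
        x = (\<Oplus>\<^bsub>M\<^esub> b\<in>{b \<in> B. c b \<noteq> \<zero>\<^bsub>R\<^esub>}. r b (c b)))"

record ('r, 's, 'm) bimod = "'m ring" +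
  lact :: "'r \<Rightarrow> 'm \<Rightarrow> 'm"
  ract :: "'m \<Rightarrow> 's \<Rightarrow> 'm"

definition bimodule :: "('r, 'x) ring_scheme \<Rightarrow> ('s, 'y) ring_scheme \<Rightarrow> ('r, 's, 'm, 'z) bimod_scheme \<Rightarrow> bool"
  where "bimodule R S M \<longleftrightarrow> left_module R M (lact M) \<and> right_module S M (ract M) \<and>
     (\<forall>r\<in>carrier R. \<forall>s\<in>carrier S. \<forall>x\<in>carrier M. ract M (lact M r x) s = lact M r (ract M x s))"

definition bimodule_isomorphic ::
  "('r, 'x) ring_scheme \<Rightarrow> ('s, 'y) ring_scheme \<Rightarrow> ('r, 's, 'm, 'z) bimod_scheme \<Rightarrow> ('r, 's, 'n, 'w) bimod_scheme \<Rightarrow> bool"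
  where "bimodule_isomorphic R S M N \<longleftrightarrow> bimodule R S M \<and> bimodule R S N \<and>
     (\<exists>f. f \<in> left_module_hom R M (lact M) N (lact N) \<and> f \<in> right_module_hom S M (ract M) N (ract N) \<and>
          bij_betw f (carrier M) (carrier N))"

definition direct_sum_bimod :: "'i set \<Rightarrow> ('i \<Rightarrow> ('r, 's, 'm, 'z) bimod_scheme) \<Rightarrow> ('r, 's, 'i \<Rightarrow> 'm) bimod"
  where "direct_sum_bimod I M =
     \<lparr>carrier = carrier (sum_group I (\<lambda>i. add_monoid (M i))),
      monoid.mult = undefined,
      one = undefined,
      ring.zero = \<one>\<^bsub>sum_group I (\<lambda>i. add_monoid (M i))\<^esub>,
      ring.add = monoid.mult (sum_group I (\<lambda>i. add_monoid (M i))),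
      lact = (\<lambda>r x. \<lambda>i\<in>I. lact (M i) r (x i)),
      ract = (\<lambda>x s. \<lambda>i\<in>I. ract (M i) (x i) s)\<rparr>"

text \<open>The \<open>(R,R)\<close>-bimodule \<open>R\<close> with left multiplication, and with right action twisted by \<open>\<phi>\<close>.\<close>

definition id_twist_bimod :: "('r, 'x) ring_scheme \<Rightarrow> ('r \<Rightarrow> 'r) \<Rightarrow> ('r, 'r, 'r) bimod"
  where "id_twist_bimod R \<phi> =
     \<lparr>carrier = carrier R, monoid.mult = undefined, one = undefined, ring.zero = \<zero>\<^bsub>R\<^esub>, ring.add = ring.add R,
      lact = (\<lambda>r m. r \<otimes>\<^bsub>R\<^esub> m), ract = (\<lambda>m r. m \<otimes>\<^bsub>R\<^esub> \<phi> r)\<rparr>"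

definition extension_bimod :: "('s, 'y) ring_scheme \<Rightarrow> ('r \<Rightarrow> 's) \<Rightarrow> ('r, 'r, 's) bimod"
  where "extension_bimod S \<iota> =
     \<lparr>carrier = carrier S, monoid.mult = undefined, one = undefined, ring.zero = \<zero>\<^bsub>S\<^esub>, ring.add = ring.add S,
      lact = (\<lambda>r x. \<iota> r \<otimes>\<^bsub>S\<^esub> x), ract = (\<lambda>x r. x \<otimes>\<^bsub>S\<^esub> \<iota> r)\<rparr>"


section \<open>Tensor products and faithful flatness\<close>

text \<open>The tensor product over \<open>R\<close> of a right module \<open>M\<close> and a left module \<open>N\<close>, as an abelian
  group (written multiplicatively by the library): the free abelian group on \<open>M \<times> N\<close> modulo
  the subgroup generated by the usual relations.\<close>

definition tensor_relations ::
  "('r, 'x) ring_scheme \<Rightarrow> ('m, 'y) ring_scheme \<Rightarrow> ('m \<Rightarrow> 'r \<Rightarrow> 'm) \<Rightarrow>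
   ('n, 'z) ring_scheme \<Rightarrow> ('r \<Rightarrow> 'n \<Rightarrow> 'n) \<Rightarrow> ('m \<times> 'n \<Rightarrow>\<^sub>0 int) set"
  where "tensor_relations R M r N l =
     {frag_of (x \<oplus>\<^bsub>M\<^esub> x', y) - frag_of (x, y) - frag_of (x', y) | x x' y.
        x \<in> carrier M \<and> x' \<in> carrier M \<and> y \<in> carrier N} \<union>
     {frag_of (x, y \<oplus>\<^bsub>N\<^esub> y') - frag_of (x, y) - frag_of (x, y') | x y y'.
        x \<in> carrier M \<and> y \<in> carrier N \<and> y' \<in> carrier N} \<union>
     {frag_of (r x s, y) - frag_of (x, l s y) | x s y.
        x \<in> carrier M \<and> s \<in> carrier R \<and> y \<in> carrier N}"

definition tensor_kernel ::
  "('r, 'x) ring_scheme \<Rightarrow> ('m, 'y) ring_scheme \<Rightarrow> ('m \<Rightarrow> 'r \<Rightarrow> 'm) \<Rightarrow>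
   ('n, 'z) ring_scheme \<Rightarrow> ('r \<Rightarrow> 'n \<Rightarrow> 'n) \<Rightarrow> ('m \<times> 'n \<Rightarrow>\<^sub>0 int) set"
  where "tensor_kernel R M r N l =
     generate (free_Abelian_group (carrier M \<times> carrier N)) (tensor_relations R M r N l)"

definition tensor_product ::
  "('r, 'x) ring_scheme \<Rightarrow> ('m, 'y) ring_scheme \<Rightarrow> ('m \<Rightarrow> 'r \<Rightarrow> 'm) \<Rightarrow>
   ('n, 'z) ring_scheme \<Rightarrow> ('r \<Rightarrow> 'n \<Rightarrow> 'n) \<Rightarrow> ('m \<times> 'n \<Rightarrow>\<^sub>0 int) set monoid"
  where "tensor_product R M r N l =
     free_Abelian_group (carrier M \<times> carrier N) Mod tensor_kernel R M r N l"

text \<open>The map induced by \<open>f\<close> and \<open>g\<close> on a tensor product, with values in the tensor product of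
  \<open>M'\<close> and \<open>N'\<close>; it sends the class of \<open>(x, y)\<close> to the class of \<open>(f x, g y)\<close>.\<close>

definition tensor_map ::
  "('r, 'x) ring_scheme \<Rightarrow> ('m1, 'y) ring_scheme \<Rightarrow> ('m1 \<Rightarrow> 'r \<Rightarrow> 'm1) \<Rightarrow>
   ('n1, 'z) ring_scheme \<Rightarrow> ('r \<Rightarrow> 'n1 \<Rightarrow> 'n1) \<Rightarrow> ('m \<Rightarrow> 'm1) \<Rightarrow> ('n \<Rightarrow> 'n1) \<Rightarrow>
   ('m \<times> 'n \<Rightarrow>\<^sub>0 int) set \<Rightarrow> ('m1 \<times> 'n1 \<Rightarrow>\<^sub>0 int) set"
  where "tensor_map R M' r' N' l' f g C =
     the_elem ((\<lambda>c. tensor_kernel R M' r' N' l' #>\<^bsub>free_Abelian_group (carrier M' \<times> carrier N')\<^esub>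
                     frag_extend (\<lambda>(x, y). frag_of (f x, g y)) c) ` C)"

text \<open>A module is faithfully flat if a sequence of modules is exact precisely when the tensored
  sequence is. HOL cannot quantify over types inside a formula, so the modules tested are those
  with elements in a type \<open>'t\<close>, given as an argument; a theorem that leaves this type
  variable free speaks about all modules.\<close>

definition faithfully_flat_left ::
  "'t itself \<Rightarrow> ('r, 'x) ring_scheme \<Rightarrow> ('s, 'y) ring_scheme \<Rightarrow> ('r \<Rightarrow> 's \<Rightarrow> 's) \<Rightarrow> bool"
  where "faithfully_flat_left T R S l \<longleftrightarrow> left_module R S l \<and>
     (\<forall>(N1 :: 't ring) (N2 :: 't ring) (N3 :: 't ring) r1 r2 r3 u v.
        right_module R N1 r1 \<and> right_module R N2 r2 \<and> right_module R N3 r3 \<and>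
        u \<in> right_module_hom R N1 r1 N2 r2 \<and> v \<in> right_module_hom R N2 r2 N3 r3 \<longrightarrow>
        (exact_seq ([add_monoid N3, add_monoid N2, add_monoid N1], [v, u]) \<longleftrightarrow>
         image (tensor_map R N2 r2 S l u id) (carrier (tensor_product R N1 r1 S l)) =
           kernel (tensor_product R N2 r2 S l) (tensor_product R N3 r3 S l) (tensor_map R N3 r3 S l v id)))"

definition faithfully_flat_right ::
  "'t itself \<Rightarrow> ('r, 'x) ring_scheme \<Rightarrow> ('s, 'y) ring_scheme \<Rightarrow> ('s \<Rightarrow> 'r \<Rightarrow> 's) \<Rightarrow> bool"
  where "faithfully_flat_right T R S r \<longleftrightarrow> right_module R S r \<and>
     (\<forall>(N1 :: 't ring) (N2 :: 't ring) (N3 :: 't ring) l1 l2 l3 u v.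
        left_module R N1 l1 \<and> left_module R N2 l2 \<and> left_module R N3 l3 \<and>
        u \<in> left_module_hom R N1 l1 N2 l2 \<and> v \<in> left_module_hom R N2 l2 N3 l3 \<longrightarrow>
        (exact_seq ([add_monoid N3, add_monoid N2, add_monoid N1], [v, u]) \<longleftrightarrow>
         image (tensor_map R S r N2 l2 id u) (carrier (tensor_product R S r N1 l1)) =
           kernel (tensor_product R S r N2 l2) (tensor_product R S r N3 l3) (tensor_map R S r N3 l3 id v)))"

definition ring_extension :: "('r, 'x) ring_scheme \<Rightarrow> ('s, 'y) ring_scheme \<Rightarrow> ('r \<Rightarrow> 's) \<Rightarrow> bool"
  where "ring_extension R S \<iota> \<longleftrightarrow>
     ring R \<and> ring S \<and> \<iota> \<in> ring_hom R S \<and> inj_on \<iota> (carrier R)"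

definition faithfully_flat_extension ::
  "'t itself \<Rightarrow> ('r, 'x) ring_scheme \<Rightarrow> ('s, 'y) ring_scheme \<Rightarrow> ('r \<Rightarrow> 's) \<Rightarrow> bool"
  where "faithfully_flat_extension T R S \<iota> \<longleftrightarrow> ring_extension R S \<iota> \<and>
     faithfully_flat_left T R S (\<lambda>r x. \<iota> r \<otimes>\<^bsub>S\<^esub> x) \<and>
     faithfully_flat_right T R S (\<lambda>x r. x \<otimes>\<^bsub>S\<^esub> \<iota> r)"

end

theory Submission
  imports Defs
begin

text \<open>Orthogonality of the characters \<open>\<chi>\<^sub>g\<close>, in rows and in columns, makes
  \<open>p\<^sub>g(a) = |G|\<^sup>-\<^sup>1 \<Sum>\<^sub>h \<chi>\<^sub>g(h) a\<^sup>h\<close> the projections of a grading, so \<open>a \<mapsto> \<Sum>\<^sub>g p\<^sub>g(a) \<otimes> g\<close> identifies the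
  twist with a subring of \<open>AG\<^sub>\<mu>\<close>. The elements \<open>u\<^sub>g = 1 \<otimes> g\<close> are units of \<open>AG\<^sub>\<mu>\<close>. For \<open>a\<close> of degree \<open>l\<close>
  one has \<open>(a \<otimes> l) u\<^sub>g = \<mu>(l,g) a \<otimes> lg\<close>, so the \<open>u\<^sub>g\<close> form a left basis of \<open>AG\<^sub>\<mu>\<close> over the twist, and
  \<open>u\<^sub>g (a \<otimes> l) = (\<mu>(g,l) / \<mu>(l,g)) (a \<otimes> l) u\<^sub>g\<close> as \<open>G\<close> is abelian. So conjugation by \<open>u\<^sub>g\<close> is the automorphism
  \<open>\<phi>\<^sub>g\<close>. Since \<open>(a \<otimes> e) u\<^sub>g = a \<otimes> g = u\<^sub>g (a \<otimes> e)\<close>, the \<open>u\<^sub>g\<close> are also a basis over \<open>A\<close> on both sides.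
  Faithful flatness follows because tensoring with a module that has a finite nonempty basis
  indexed by \<open>I\<close> is, naturally, taking the \<open>I\<close>-fold power.\<close>

section \<open>Tensoring with a module that has a finite basis\<close>

text \<open>The tensor product is a concrete quotient of a free abelian group, so naturality is
  carried out on representatives: the coordinates are homomorphisms on the free group whose common
  kernel is the subgroup of relations, and images and kernels are compared through them. Faithful
  flatness is an equivalence of two exactness statements; a nonempty basis is what recovers the
  original sequence from the tensored one.

  Row orthogonality rests on injectivity of \<open>\<chi>\<close> and makes the projections
  orthogonal to each other. Column orthogonality makes them sum to the identity; it rests on
  characters separating elements, which is extracted from row orthogonality by counting equations.

  Associativity is computed in the twisted group algebra alone; the twist inherits its ring laws
  through the embedding. Each \<open>u g\<close> commutes with \<open>A\<close>, so over
  \<open>A\<close> the same coefficients serve both sides. Over the twist the right coefficients are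
  the left ones transported by the inverse of \<open>\<phi> g\<close>.\<close>

lemma (in abelian_group) minus_eq_zero_iff:
  assumes "x \<in> carrier G" "y \<in> carrier G"
  shows "x \<ominus> y = \<zero> \<longleftrightarrow> x = y"
proof
  assume "x \<ominus> y = \<zero>"
  then have "x \<oplus> \<ominus> y \<oplus> y = y" using assms by (simp add: a_minus_def)
  then show "x = y" using assms by (simp add: a_assoc l_neg)
qed (use assms in \<open>simp add: a_minus_def r_neg\<close>)

text \<open>An abelian group presented as \<open>\<int>P / L\<close> is identified with \<open>N\<^sup>I\<close> by the coordinates \<open>\<theta>\<close>.\<close>

locale frag_coords = N: abelian_group N
  for N :: "('n, 'z) ring_scheme" +
  fixes P :: "'p set" and L :: "('p \<Rightarrow>\<^sub>0 int) set" and I :: "'i set"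
    and \<theta> :: "'i \<Rightarrow> ('p \<Rightarrow>\<^sub>0 int) \<Rightarrow> 'n"
  assumes L: "subgroup L (free_Abelian_group P)"
    and \<theta>: "i \<in> I \<Longrightarrow> \<theta> i \<in> hom (free_Abelian_group P) (add_monoid N)"
    and L_iff: "c \<in> carrier (free_Abelian_group P) \<Longrightarrow> c \<in> L \<longleftrightarrow> (\<forall>i\<in>I. \<theta> i c = \<zero>\<^bsub>N\<^esub>)"
    and surj: "n \<in> I \<rightarrow> carrier N \<Longrightarrow> \<exists>c\<in>carrier (free_Abelian_group P). \<forall>i\<in>I. \<theta> i c = n i"
begin

abbreviation "F \<equiv> free_Abelian_group P"

lemma \<theta>_closed: "i \<in> I \<Longrightarrow> c \<in> carrier F \<Longrightarrow> \<theta> i c \<in> carrier N"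
  using \<theta> unfolding hom_def by (auto simp del: carrier_free_Abelian_group_iff)

lemma \<theta>_diff:
  assumes "i \<in> I" "c \<in> carrier F" "d \<in> carrier F"
  shows "\<theta> i (c - d) = \<theta> i c \<ominus>\<^bsub>N\<^esub> \<theta> i d"
proof -
  interpret h: group_hom F "add_monoid N" "\<theta> i"
    using \<theta>[OF assms(1)] N.a_group by (simp add: group_hom_def group_hom_axioms_def)
  have "c - d = c \<otimes>\<^bsub>F\<^esub> inv\<^bsub>F\<^esub> d" using assms(3) by simp
  have "\<theta> i (c - d) = \<theta> i c \<oplus>\<^bsub>N\<^esub> \<theta> i (inv\<^bsub>F\<^esub> d)"
    unfolding \<open>c - d = _\<close> using h.hom_mult[OF assms(2) group.inv_closed[OF group_free_Abelian_group assms(3)]] by simp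
  also have "\<theta> i (inv\<^bsub>F\<^esub> d) = \<ominus>\<^bsub>N\<^esub> \<theta> i d"
    using h.hom_inv[OF assms(3)] by (simp add: a_inv_def)
  finally show ?thesis by (simp add: a_minus_def)
qed

text \<open>Two elements share a coset exactly if their difference lies in \<open>L\<close>, the
  common kernel of the additive maps \<open>\<theta> i\<close>. So the coordinates are well defined
  and injective on the quotient, and no map out of the quotient has to be introduced.\<close>

lemma coset_eq_iff:
  assumes "c \<in> carrier F" "d \<in> carrier F"
  shows "L #>\<^bsub>F\<^esub> c = L #>\<^bsub>F\<^esub> d \<longleftrightarrow> (\<forall>i\<in>I. \<theta> i c = \<theta> i d)"
proof -
  interpret F: comm_group F by (rule abelian_free_Abelian_group)
  interpret L: subgroup L F by (rule L)
  have cd: "c - d = c \<otimes>\<^bsub>F\<^esub> inv\<^bsub>F\<^esub> d" using assms(2) by simp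
  then have cd': "c - d \<in> carrier F" using assms by (metis F.inv_closed F.m_closed)
  have "L #>\<^bsub>F\<^esub> c = L #>\<^bsub>F\<^esub> d \<longleftrightarrow> c \<in> L #>\<^bsub>F\<^esub> d"
    using F.repr_independence[OF _ assms(2) L] F.rcos_self[OF assms(1) L] by blast
  also have "\<dots> \<longleftrightarrow> c - d \<in> L"
  proof
    assume "c \<in> L #>\<^bsub>F\<^esub> d" then show "c - d \<in> L" by (auto simp: r_coset_def)
  next
    assume "c - d \<in> L"
    moreover have "c = (c - d) \<otimes>\<^bsub>F\<^esub> d" by simp
    ultimately show "c \<in> L #>\<^bsub>F\<^esub> d" unfolding r_coset_def by blast
  qed
  also have "\<dots> \<longleftrightarrow> (\<forall>i\<in>I. \<theta> i c \<ominus>\<^bsub>N\<^esub> \<theta> i d = \<zero>\<^bsub>N\<^esub>)"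
    using L_iff[OF cd'] \<theta>_diff assms by simp
  also have "\<dots> \<longleftrightarrow> (\<forall>i\<in>I. \<theta> i c = \<theta> i d)"
  proof (rule ball_cong[OF refl])
    fix i assume "i \<in> I"
    then have "\<theta> i c \<in> carrier N" "\<theta> i d \<in> carrier N" using \<theta>_closed assms by auto
    then show "\<theta> i c \<ominus>\<^bsub>N\<^esub> \<theta> i d = \<zero>\<^bsub>N\<^esub> \<longleftrightarrow> \<theta> i c = \<theta> i d"
      by (rule N.minus_eq_zero_iff)
  qed
  finally show ?thesis .
qed

lemma mem_coset:
  assumes "c \<in> carrier F" "d \<in> L #>\<^bsub>F\<^esub> c"
  shows "d \<in> carrier F" "L #>\<^bsub>F\<^esub> d = L #>\<^bsub>F\<^esub> c"
proof -
  interpret F: comm_group F by (rule abelian_free_Abelian_group)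
  show "d \<in> carrier F" using F.r_coset_subset_G[OF subgroup.subset[OF L] assms(1)] assms(2) by blast
  show "L #>\<^bsub>F\<^esub> d = L #>\<^bsub>F\<^esub> c" using F.repr_independence[OF assms(2,1) L] by simp
qed

lemma carrier_quot: "carrier (F Mod L) = (\<lambda>c. L #>\<^bsub>F\<^esub> c) ` carrier F"
  by (auto simp: FactGroup_def RCOSETS_def)

lemma one_quot: "\<one>\<^bsub>F Mod L\<^esub> = L #>\<^bsub>F\<^esub> 0"
  using group.coset_mult_one[OF group_free_Abelian_group subgroup.subset[OF L]] by (simp add: FactGroup_def)

end

text \<open>\<open>tensor_map\<close> takes \<open>the_elem\<close> of the cosets obtained from all
  representatives. They form a singleton because the coordinates of \<open>w d\<close> are
  determined by those of \<open>d\<close>, which are constant on a coset.\<close>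

lemma induced_on_cosets:
  assumes "frag_coords N P L I \<theta>" "frag_coords N' P' L' I \<theta>'"
    and w: "w \<in> carrier (free_Abelian_group P) \<rightarrow> carrier (free_Abelian_group P')"
    and \<theta>w: "\<And>i c. \<lbrakk>i \<in> I; c \<in> carrier (free_Abelian_group P)\<rbrakk> \<Longrightarrow> \<theta>' i (w c) = u (\<theta> i c)"
    and c: "c \<in> carrier (free_Abelian_group P)"
  shows "the_elem ((\<lambda>c. L' #>\<^bsub>free_Abelian_group P'\<^esub> w c) ` (L #>\<^bsub>free_Abelian_group P\<^esub> c)) =
    L' #>\<^bsub>free_Abelian_group P'\<^esub> w c"
proof -
  interpret A: frag_coords N P L I \<theta> by fact
  interpret B: frag_coords N' P' L' I \<theta>' by fact
  have "L' #>\<^bsub>B.F\<^esub> w d = L' #>\<^bsub>B.F\<^esub> w c" if "d \<in> L #>\<^bsub>A.F\<^esub> c" for d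
  proof -
    have "d \<in> carrier A.F" "\<forall>i\<in>I. \<theta> i d = \<theta> i c"
      using A.mem_coset[OF c that] A.coset_eq_iff c by blast+
    then show ?thesis using B.coset_eq_iff w c \<theta>w
      by (auto simp del: carrier_free_Abelian_group_iff simp: Pi_iff)
  qed
  moreover have "c \<in> L #>\<^bsub>A.F\<^esub> c"
    using group.rcos_self[OF group_free_Abelian_group c A.L] .
  ultimately have "(\<lambda>c. L' #>\<^bsub>B.F\<^esub> w c) ` (L #>\<^bsub>A.F\<^esub> c) = {L' #>\<^bsub>B.F\<^esub> w c}" by blast
  then show ?thesis by simp
qed

text \<open>In coordinates the sequence of quotients consists of copies, indexed by
  \<open>I\<close>, of the sequence \<open>u\<close>, \<open>v\<close>. A power of an exact sequence
  is exact, and a single coordinate suffices to recover exactness of the original.\<close>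

lemma exact_quotients_iff:
  assumes "frag_coords N1 P1 L1 I \<theta>1" "frag_coords N2 P2 L2 I \<theta>2" "frag_coords N3 P3 L3 I \<theta>3"
    and "I \<noteq> {}"
    and u: "u \<in> hom (add_monoid N1) (add_monoid N2)" and v: "v \<in> hom (add_monoid N2) (add_monoid N3)"
    and U: "U \<in> carrier (free_Abelian_group P1) \<rightarrow> carrier (free_Abelian_group P2)"
    and V: "V \<in> carrier (free_Abelian_group P2) \<rightarrow> carrier (free_Abelian_group P3)"
    and \<theta>U: "\<And>i c. \<lbrakk>i \<in> I; c \<in> carrier (free_Abelian_group P1)\<rbrakk> \<Longrightarrow> \<theta>2 i (U c) = u (\<theta>1 i c)"
    and \<theta>V: "\<And>i c. \<lbrakk>i \<in> I; c \<in> carrier (free_Abelian_group P2)\<rbrakk> \<Longrightarrow> \<theta>3 i (V c) = v (\<theta>2 i c)"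
  shows "exact_seq ([add_monoid N3, add_monoid N2, add_monoid N1], [v, u]) \<longleftrightarrow>
    (\<lambda>C. the_elem ((\<lambda>c. L2 #>\<^bsub>free_Abelian_group P2\<^esub> U c) ` C)) ` carrier (free_Abelian_group P1 Mod L1) =
    kernel (free_Abelian_group P2 Mod L2) (free_Abelian_group P3 Mod L3)
      (\<lambda>C. the_elem ((\<lambda>c. L3 #>\<^bsub>free_Abelian_group P3\<^esub> V c) ` C))"
    (is "_ \<longleftrightarrow> ?im = ?ker")
proof -
  interpret N1: frag_coords N1 P1 L1 I \<theta>1 by fact
  interpret N2: frag_coords N2 P2 L2 I \<theta>2 by fact
  interpret N3: frag_coords N3 P3 L3 I \<theta>3 by fact
  note [simp del] = carrier_free_Abelian_group_iff
  have U': "U c \<in> carrier N2.F" if "c \<in> carrier N1.F" for c using U that by auto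
  have V': "V c \<in> carrier N3.F" if "c \<in> carrier N2.F" for c using V that by auto
  have im: "?im = (\<lambda>c. L2 #>\<^bsub>N2.F\<^esub> U c) ` carrier N1.F"
    unfolding N1.carrier_quot image_image
    using induced_on_cosets[OF assms(1,2) U \<theta>U] by (intro image_cong) auto
  have zero: "0 \<in> carrier N3.F" by (simp add: carrier_free_Abelian_group_iff)
  have \<theta>zero: "\<theta>3 i 0 = \<zero>\<^bsub>N3\<^esub>" if "i \<in> I" for i
    using N3.L_iff[OF zero] subgroup.one_closed[OF N3.L] that by simp
  have ker: "?ker = {L2 #>\<^bsub>N2.F\<^esub> d | d. d \<in> carrier N2.F \<and> (\<forall>i\<in>I. v (\<theta>2 i d) = \<zero>\<^bsub>N3\<^esub>)}"
  proof -
    have "the_elem ((\<lambda>c. L3 #>\<^bsub>N3.F\<^esub> V c) ` (L2 #>\<^bsub>N2.F\<^esub> d)) = \<one>\<^bsub>N3.F Mod L3\<^esub>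
        \<longleftrightarrow> (\<forall>i\<in>I. v (\<theta>2 i d) = \<zero>\<^bsub>N3\<^esub>)" if d: "d \<in> carrier N2.F" for d
      using induced_on_cosets[OF assms(2,3) V \<theta>V d] N3.coset_eq_iff[OF V'[OF d] zero] \<theta>V[OF _ d] \<theta>zero
      unfolding N3.one_quot by simp
    then show ?thesis unfolding kernel_def N2.carrier_quot by blast
  qed
  have ex: "exact_seq ([add_monoid N3, add_monoid N2, add_monoid N1], [v, u]) \<longleftrightarrow>
      {n \<in> carrier N2. v n = \<zero>\<^bsub>N3\<^esub>} = u ` carrier N1"
    using u v N1.N.a_group N2.N.a_group N3.N.a_group
    by (auto simp: group_hom_def group_hom_axioms_def kernel_def)
  show ?thesis unfolding ex
  proof
    assume eq: "{n \<in> carrier N2. v n = \<zero>\<^bsub>N3\<^esub>} = u ` carrier N1"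
    show "?im = ?ker" unfolding im ker
    proof (intro equalityI subsetI)
      fix C assume "C \<in> (\<lambda>c. L2 #>\<^bsub>N2.F\<^esub> U c) ` carrier N1.F"
      then obtain c where c: "c \<in> carrier N1.F" "C = L2 #>\<^bsub>N2.F\<^esub> U c" by blast
      have "v (\<theta>2 i (U c)) = \<zero>\<^bsub>N3\<^esub>" if "i \<in> I" for i
        using eq N1.\<theta>_closed[OF that c(1)] \<theta>U[OF that c(1)] by auto
      then show "C \<in> {L2 #>\<^bsub>N2.F\<^esub> d | d. d \<in> carrier N2.F \<and> (\<forall>i\<in>I. v (\<theta>2 i d) = \<zero>\<^bsub>N3\<^esub>)}"
        using c(2) U'[OF c(1)] by (intro CollectI exI[of _ "U c"] conjI ballI)
    next
      fix C assume "C \<in> {L2 #>\<^bsub>N2.F\<^esub> d | d. d \<in> carrier N2.F \<and> (\<forall>i\<in>I. v (\<theta>2 i d) = \<zero>\<^bsub>N3\<^esub>)}"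
      then obtain d where d: "d \<in> carrier N2.F" "C = L2 #>\<^bsub>N2.F\<^esub> d" "\<forall>i\<in>I. v (\<theta>2 i d) = \<zero>\<^bsub>N3\<^esub>"
        by blast
      \<comment> \<open>Exactness is used in each coordinate separately; surjectivity of the
        coordinates then assembles the chosen preimages into one element \<open>c\<close>.\<close>
      have "\<exists>n. n \<in> carrier N1 \<and> u n = \<theta>2 i d" if "i \<in> I" for i
      proof -
        have "\<theta>2 i d \<in> u ` carrier N1"
          unfolding eq[symmetric] using d(3) N2.\<theta>_closed[OF that d(1)] that by simp
        then show ?thesis by auto
      qed
      then obtain n where n: "\<And>i. i \<in> I \<Longrightarrow> n i \<in> carrier N1" "\<And>i. i \<in> I \<Longrightarrow> u (n i) = \<theta>2 i d"
        by metis
      obtain c where c: "c \<in> carrier N1.F" "\<forall>i\<in>I. \<theta>1 i c = n i"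
        using N1.surj[of n] n by auto
      then have "L2 #>\<^bsub>N2.F\<^esub> U c = L2 #>\<^bsub>N2.F\<^esub> d"
        using N2.coset_eq_iff[OF U'[OF c(1)] d(1)] \<theta>U n by simp
      then show "C \<in> (\<lambda>c. L2 #>\<^bsub>N2.F\<^esub> U c) ` carrier N1.F" using c d by blast
    qed
  next
    assume eq: "?im = ?ker"
    obtain i where i: "i \<in> I" using \<open>I \<noteq> {}\<close> by blast
    show "{n \<in> carrier N2. v n = \<zero>\<^bsub>N3\<^esub>} = u ` carrier N1"
    proof (intro equalityI subsetI)
      fix n assume "n \<in> {n \<in> carrier N2. v n = \<zero>\<^bsub>N3\<^esub>}"
      then have n: "n \<in> carrier N2" "v n = \<zero>\<^bsub>N3\<^esub>" by auto
      \<comment> \<open>The element is put into every coordinate at once, so that \<open>d\<close>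
        represents an element of the kernel; its preimage is read off at the fixed
        \<open>i\<close>.\<close>
      obtain d where d: "d \<in> carrier N2.F" "\<forall>i\<in>I. \<theta>2 i d = n"
        using N2.surj[of "\<lambda>_. n"] n by auto
      then have "L2 #>\<^bsub>N2.F\<^esub> d \<in> (\<lambda>c. L2 #>\<^bsub>N2.F\<^esub> U c) ` carrier N1.F"
        unfolding eq[unfolded im ker] using d n(2) by (intro CollectI exI[of _ d]) simp
      then obtain c where c: "c \<in> carrier N1.F" "L2 #>\<^bsub>N2.F\<^esub> d = L2 #>\<^bsub>N2.F\<^esub> U c" by blast
      then have "u (\<theta>1 i c) = n"
        using N2.coset_eq_iff[OF d(1) U'[OF c(1)]] \<theta>U[OF i c(1)] d i by simp
      then show "n \<in> u ` carrier N1" using N1.\<theta>_closed[OF i c(1)] by blast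
    next
      fix m assume "m \<in> u ` carrier N1"
      then obtain n where n: "n \<in> carrier N1" "m = u n" by blast
      obtain c where c: "c \<in> carrier N1.F" "\<forall>i\<in>I. \<theta>1 i c = n"
        using N1.surj[of "\<lambda>_. n"] n by auto
      from c(1) have "L2 #>\<^bsub>N2.F\<^esub> U c \<in> ?ker" unfolding eq[symmetric] im by (rule imageI)
      then obtain d where d: "d \<in> carrier N2.F" "\<forall>i\<in>I. v (\<theta>2 i d) = \<zero>\<^bsub>N3\<^esub>"
          "L2 #>\<^bsub>N2.F\<^esub> U c = L2 #>\<^bsub>N2.F\<^esub> d" unfolding ker by blast
      then have "\<theta>2 i d = u n"
        using N2.coset_eq_iff[OF U'[OF c(1)] d(1)] \<theta>U[OF i c(1)] c i by simp
      then show "m \<in> {n \<in> carrier N2. v n = \<zero>\<^bsub>N3\<^esub>}" using d(2) i n u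
        by (auto simp: hom_def)
    qed
  qed
qed

text \<open>The side conventions are abstracted away so that left and right modules are treated at once:
  \<open>t x s\<close> is the generator \<open>x \<otimes> s\<close> or \<open>s \<otimes> x\<close>, and both actions are written with the scalar first.
  Linearity of \<open>\<kappa>\<close> is only required after acting on \<open>N\<close>, so that no ring structure
  on \<open>R\<close> (which would be the opposite one on one side) occurs.\<close>

locale coordinate_tensor = N: abelian_group N + S: abelian_group S
  for N :: "('n, 'z) ring_scheme" and S :: "('s, 'w) ring_scheme" +
  fixes R :: "'r set" and nact :: "'r \<Rightarrow> 'n \<Rightarrow> 'n" and sact :: "'r \<Rightarrow> 's \<Rightarrow> 's"
    and I :: "'i set" and e :: "'i \<Rightarrow> 's" and \<kappa> :: "'i \<Rightarrow> 's \<Rightarrow> 'r"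
    and t :: "'n \<Rightarrow> 's \<Rightarrow> 'p" and pn :: "'p \<Rightarrow> 'n" and ps :: "'p \<Rightarrow> 's"
    and P :: "'p set" and L :: "('p \<Rightarrow>\<^sub>0 int) set"
  assumes fin: "finite I"
    and e: "i \<in> I \<Longrightarrow> e i \<in> carrier S"
    and \<kappa>: "\<lbrakk>i \<in> I; s \<in> carrier S\<rbrakk> \<Longrightarrow> \<kappa> i s \<in> R"
    and sact: "\<lbrakk>r \<in> R; s \<in> carrier S\<rbrakk> \<Longrightarrow> sact r s \<in> carrier S"
    and nact: "\<lbrakk>r \<in> R; x \<in> carrier N\<rbrakk> \<Longrightarrow> nact r x \<in> carrier N"
    and nact_add: "\<lbrakk>r \<in> R; x \<in> carrier N; y \<in> carrier N\<rbrakk> \<Longrightarrow> nact r (x \<oplus>\<^bsub>N\<^esub> y) = nact r x \<oplus>\<^bsub>N\<^esub> nact r y"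
    and expand: "s \<in> carrier S \<Longrightarrow> s = (\<Oplus>\<^bsub>S\<^esub>i\<in>I. sact (\<kappa> i s) (e i))"
    and \<kappa>_add: "\<lbrakk>i \<in> I; s \<in> carrier S; s' \<in> carrier S; x \<in> carrier N\<rbrakk> \<Longrightarrow>
      nact (\<kappa> i (s \<oplus>\<^bsub>S\<^esub> s')) x = nact (\<kappa> i s) x \<oplus>\<^bsub>N\<^esub> nact (\<kappa> i s') x"
    and \<kappa>_sact: "\<lbrakk>i \<in> I; r \<in> R; s \<in> carrier S; x \<in> carrier N\<rbrakk> \<Longrightarrow>
      nact (\<kappa> i (sact r s)) x = nact (\<kappa> i s) (nact r x)"
    and \<kappa>_e: "\<lbrakk>i \<in> I; j \<in> I; x \<in> carrier N\<rbrakk> \<Longrightarrow> nact (\<kappa> i (e j)) x = (if i = j then x else \<zero>\<^bsub>N\<^esub>)"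
    and P: "P = (\<lambda>(x, s). t x s) ` (carrier N \<times> carrier S)"
    and pn: "pn (t x s) = x" and ps: "ps (t x s) = s"
    and L: "subgroup L (free_Abelian_group P)"
    and rel_add_n: "\<lbrakk>x \<in> carrier N; y \<in> carrier N; s \<in> carrier S\<rbrakk> \<Longrightarrow>
      frag_of (t (x \<oplus>\<^bsub>N\<^esub> y) s) - frag_of (t x s) - frag_of (t y s) \<in> L"
    and rel_add_s: "\<lbrakk>x \<in> carrier N; s \<in> carrier S; s' \<in> carrier S\<rbrakk> \<Longrightarrow>
      frag_of (t x (s \<oplus>\<^bsub>S\<^esub> s')) - frag_of (t x s) - frag_of (t x s') \<in> L"
    and rel_balanced: "\<lbrakk>r \<in> R; x \<in> carrier N; s \<in> carrier S\<rbrakk> \<Longrightarrow>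
      frag_of (t (nact r x) s) - frag_of (t x (sact r s)) \<in> L"
    and L_minimal: "\<lbrakk>group_hom (free_Abelian_group P) (add_monoid N) h;
      \<And>x y s. \<lbrakk>x \<in> carrier N; y \<in> carrier N; s \<in> carrier S\<rbrakk> \<Longrightarrow>
        h (frag_of (t (x \<oplus>\<^bsub>N\<^esub> y) s)) = h (frag_of (t x s)) \<oplus>\<^bsub>N\<^esub> h (frag_of (t y s));
      \<And>x s s'. \<lbrakk>x \<in> carrier N; s \<in> carrier S; s' \<in> carrier S\<rbrakk> \<Longrightarrow>
        h (frag_of (t x (s \<oplus>\<^bsub>S\<^esub> s'))) = h (frag_of (t x s)) \<oplus>\<^bsub>N\<^esub> h (frag_of (t x s'));
      \<And>r x s. \<lbrakk>r \<in> R; x \<in> carrier N; s \<in> carrier S\<rbrakk> \<Longrightarrow>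
        h (frag_of (t (nact r x) s)) = h (frag_of (t x (sact r s)));
      c \<in> L\<rbrakk> \<Longrightarrow> h c = \<zero>\<^bsub>N\<^esub>"
begin

abbreviation "F \<equiv> free_Abelian_group P"

text \<open>In the tensor product the class of \<open>t x s\<close> is the sum over \<open>i\<close>
  of the classes of \<open>t (nact (\<kappa> i s) x) (e i)\<close>, hence the prescribed value. The
  universal property of the free abelian group asserts that an extension from the generators exists,
  and one is chosen.\<close>

definition \<theta> :: "'i \<Rightarrow> ('p \<Rightarrow>\<^sub>0 int) \<Rightarrow> 'n" where
  "\<theta> i = (SOME h. h \<in> hom F (add_monoid N) \<and> (\<forall>p\<in>P. h (frag_of p) = nact (\<kappa> i (ps p)) (pn p)))"

lemma t_P: "x \<in> carrier N \<Longrightarrow> s \<in> carrier S \<Longrightarrow> t x s \<in> P"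
  unfolding P by force

lemma frag_t: "x \<in> carrier N \<Longrightarrow> s \<in> carrier S \<Longrightarrow> frag_of (t x s) \<in> carrier F"
  using t_P by simp

lemma \<theta>_spec:
  assumes "i \<in> I"
  shows "\<theta> i \<in> hom F (add_monoid N) \<and> (\<forall>p\<in>P. \<theta> i (frag_of p) = nact (\<kappa> i (ps p)) (pn p))"
proof -
  have *: "(\<lambda>p. nact (\<kappa> i (ps p)) (pn p)) ` P \<subseteq> carrier (add_monoid N)"
    using assms by (auto simp: P pn ps intro!: nact \<kappa>)
  obtain h where "h \<in> hom F (add_monoid N)" "\<And>p. p \<in> P \<Longrightarrow> h (frag_of p) = nact (\<kappa> i (ps p)) (pn p)"
    using comm_group.free_Abelian_group_universal[OF N.a_comm_group *] by blast
  then have "\<exists>h. h \<in> hom F (add_monoid N) \<and> (\<forall>p\<in>P. h (frag_of p) = nact (\<kappa> i (ps p)) (pn p))" by blast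
  then show ?thesis unfolding \<theta>_def by (rule someI_ex)
qed

lemma \<theta>_hom: "i \<in> I \<Longrightarrow> \<theta> i \<in> hom F (add_monoid N)"
  using \<theta>_spec by blast

lemma \<theta>_group_hom: "i \<in> I \<Longrightarrow> group_hom F (add_monoid N) (\<theta> i)"
  using \<theta>_hom N.a_group by (simp add: group_hom_def group_hom_axioms_def)

lemma \<theta>_t: "\<lbrakk>i \<in> I; x \<in> carrier N; s \<in> carrier S\<rbrakk> \<Longrightarrow> \<theta> i (frag_of (t x s)) = nact (\<kappa> i s) x"
  using \<theta>_spec t_P by (simp add: pn ps)

lemma \<theta>_add: "\<lbrakk>i \<in> I; c \<in> carrier F; d \<in> carrier F\<rbrakk> \<Longrightarrow> \<theta> i (c + d) = \<theta> i c \<oplus>\<^bsub>N\<^esub> \<theta> i d"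
  using \<theta>_hom by (auto simp: hom_def simp del: carrier_free_Abelian_group_iff)

lemma \<theta>_closed: "\<lbrakk>i \<in> I; c \<in> carrier F\<rbrakk> \<Longrightarrow> \<theta> i c \<in> carrier N"
  using \<theta>_hom by (auto simp: hom_def simp del: carrier_free_Abelian_group_iff)

text \<open>The value on generators is biadditive and balanced in \<open>x\<close> and
  \<open>s\<close>, so \<open>\<theta> i\<close> respects the defining relations;
  \<open>L_minimal\<close> passes from them to all of \<open>L\<close>.\<close>

lemma \<theta>_L: "\<lbrakk>i \<in> I; c \<in> L\<rbrakk> \<Longrightarrow> \<theta> i c = \<zero>\<^bsub>N\<^esub>"
  by (rule L_minimal[OF \<theta>_group_hom])
    (simp_all add: \<theta>_t nact_add nact \<kappa> \<kappa>_add \<kappa>_sact sact)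

lemma L_plus: "c \<in> L \<Longrightarrow> d \<in> L \<Longrightarrow> c + d \<in> L"
  using subgroup.m_closed[OF L] by simp

lemma L_minus: "c \<in> L \<Longrightarrow> - c \<in> L"
  using subgroup.m_inv_closed[OF L] subgroup.mem_carrier[OF L]
  by (metis carrier_free_Abelian_group_iff inv_free_Abelian_group)

lemma L_diff: "c \<in> L \<Longrightarrow> d \<in> L \<Longrightarrow> c - d \<in> L"
  using L_plus[OF _ L_minus] by (metis diff_conv_add_uminus)

lemma L_zero: "0 \<in> L"
  using subgroup.one_closed[OF L] by simp

lemma L_sum: "(\<And>i. i \<in> J \<Longrightarrow> f i \<in> L) \<Longrightarrow> sum f J \<in> L"
  by (induction J rule: infinite_finite_induct) (auto simp: L_zero L_plus)

text \<open>For two zero summands the additivity relation collapses to minus the generator.\<close>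

lemma t_zero_n: "s \<in> carrier S \<Longrightarrow> frag_of (t \<zero>\<^bsub>N\<^esub> s) \<in> L"
  using L_minus[OF rel_add_n[of "\<zero>\<^bsub>N\<^esub>" "\<zero>\<^bsub>N\<^esub>" s]] by simp

lemma t_zero_s: "x \<in> carrier N \<Longrightarrow> frag_of (t x \<zero>\<^bsub>S\<^esub>) \<in> L"
  using L_minus[OF rel_add_s[of x "\<zero>\<^bsub>S\<^esub>" "\<zero>\<^bsub>S\<^esub>"]] by simp

lemma t_finsum:
  assumes x: "x \<in> carrier N" and J: "finite J" and f: "f \<in> J \<rightarrow> carrier S"
  shows "frag_of (t x (\<Oplus>\<^bsub>S\<^esub>j\<in>J. f j)) - (\<Sum>j\<in>J. frag_of (t x (f j))) \<in> L"
  using J f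
proof induction
  case empty then show ?case using t_zero_s x by simp
next
  case (insert j J)
  have fj: "f j \<in> carrier S" and fJ: "f \<in> J \<rightarrow> carrier S" using insert.prems by auto
  have "frag_of (t x (f j \<oplus>\<^bsub>S\<^esub> (\<Oplus>\<^bsub>S\<^esub>j\<in>J. f j))) - frag_of (t x (f j)) - frag_of (t x (\<Oplus>\<^bsub>S\<^esub>j\<in>J. f j)) \<in> L"
    using rel_add_s x fj S.finsum_closed[OF fJ] by blast
  from L_plus[OF this insert.IH[OF fJ]] show ?case
    using insert.hyps fj fJ by (simp add: S.finsum_insert algebra_simps)
qed

text \<open>Modulo \<open>L\<close>, expanding \<open>s\<close> in the \<open>e i\<close> turns the
  generator into a sum, and balancing moves each coefficient \<open>\<kappa> i s\<close> over to
  \<open>x\<close>.\<close>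

lemma reduce_t:
  assumes x: "x \<in> carrier N" and s: "s \<in> carrier S"
  shows "frag_of (t x s) - (\<Sum>i\<in>I. frag_of (t (nact (\<kappa> i s) x) (e i))) \<in> L"
proof -
  have "frag_of (t x s) - (\<Sum>i\<in>I. frag_of (t x (sact (\<kappa> i s) (e i)))) \<in> L"
    using t_finsum[OF x fin, of "\<lambda>i. sact (\<kappa> i s) (e i)"] expand[OF s] sact \<kappa> e s by auto
  moreover have "(\<Sum>i\<in>I. frag_of (t (nact (\<kappa> i s) x) (e i)) - frag_of (t x (sact (\<kappa> i s) (e i)))) \<in> L"
    using x s \<kappa> e by (intro L_sum rel_balanced) auto
  ultimately have "(frag_of (t x s) - (\<Sum>i\<in>I. frag_of (t x (sact (\<kappa> i s) (e i))))) -
      (\<Sum>i\<in>I. frag_of (t (nact (\<kappa> i s) x) (e i)) - frag_of (t x (sact (\<kappa> i s) (e i)))) \<in> L"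
    by (rule L_diff)
  then show ?thesis by (simp add: sum_subtractf)
qed

lemma t_minus:
  assumes "x \<in> carrier N" "y \<in> carrier N" "s \<in> carrier S"
  shows "frag_of (t x s) - frag_of (t y s) - frag_of (t (x \<ominus>\<^bsub>N\<^esub> y) s) \<in> L"
proof -
  have "x = (x \<ominus>\<^bsub>N\<^esub> y) \<oplus>\<^bsub>N\<^esub> y" using assms by (simp add: a_minus_def N.a_assoc N.l_neg)
  then have "frag_of (t x s) - frag_of (t (x \<ominus>\<^bsub>N\<^esub> y) s) - frag_of (t y s) \<in> L"
    using rel_add_n[of "x \<ominus>\<^bsub>N\<^esub> y" y s] assms by simp
  then show ?thesis
    unfolding cancel_ab_semigroup_add_class.diff_right_commute[of "frag_of (t x s)" "frag_of (t y s)"] .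
qed

lemma \<theta>_diff:
  assumes "i \<in> I" "c \<in> carrier F" "d \<in> carrier F" "c - d \<in> carrier F"
  shows "\<theta> i (c - d) = \<theta> i c \<ominus>\<^bsub>N\<^esub> \<theta> i d"
proof -
  have eq: "\<theta> i c = \<theta> i (c - d) \<oplus>\<^bsub>N\<^esub> \<theta> i d" using \<theta>_add[OF assms(1,4,3)] by simp
  show ?thesis unfolding eq a_minus_def
    using \<theta>_closed[OF assms(1,3)] \<theta>_closed[OF assms(1,4)] by (simp add: N.a_assoc N.r_neg)
qed

text \<open>A normal form modulo \<open>L\<close> that depends only on the coordinates: an element
  whose coordinates all vanish must lie in \<open>L\<close>. The induction passes through generators
  and differences, which is why additivity is prepared in the form of \<open>t_minus\<close> and
  \<open>\<theta>_diff\<close>.\<close>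

lemma reduce:
  assumes "c \<in> carrier F"
  shows "c - (\<Sum>i\<in>I. frag_of (t (\<theta> i c) (e i))) \<in> L"
proof -
  have "Poly_Mapping.keys c \<subseteq> P" using assms by simp
  \<comment> \<open>Membership in \<open>F\<close> is carried along because additivity of
    \<open>\<theta> i\<close> at a difference requires it.\<close>
  then have "c \<in> carrier F \<and> c - (\<Sum>i\<in>I. frag_of (t (\<theta> i c) (e i))) \<in> L"
  proof (induction rule: frag_induction)
    case zero
    have "\<theta> i 0 = \<zero>\<^bsub>N\<^esub>" if "i \<in> I" for i using \<theta>_L[OF that L_zero] .
    then have "(\<Sum>i\<in>I. frag_of (t (\<theta> i 0) (e i))) \<in> L"
      using t_zero_n e by (intro L_sum) simp
    from L_minus[OF this] show ?case by simp
  next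
    case (one p)
    then obtain x s where p: "p = t x s" "x \<in> carrier N" "s \<in> carrier S" unfolding P by auto
    then show ?case using reduce_t[of x s] \<theta>_t one by simp
  next
    case (diff a b)
    let ?s = "\<lambda>c. \<Sum>i\<in>I. frag_of (t (\<theta> i c) (e i))"
    have ab: "a \<in> carrier F" "b \<in> carrier F" using diff by auto
    then have ab': "a - b \<in> carrier F" using keys_diff[of a b] by auto
    have "(\<Sum>i\<in>I. frag_of (t (\<theta> i a) (e i)) - frag_of (t (\<theta> i b) (e i)) - frag_of (t (\<theta> i (a - b)) (e i))) \<in> L"
      using t_minus \<theta>_diff[OF _ ab ab'] \<theta>_closed[OF _ ab(1)] \<theta>_closed[OF _ ab(2)] e
      by (intro L_sum) simp
    then have "?s a - ?s b - ?s (a - b) \<in> L" by (simp add: sum_subtractf)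
    from L_plus[OF L_diff[OF conjunct2[OF diff.IH(1)] conjunct2[OF diff.IH(2)]] this]
    have "(a - ?s a) - (b - ?s b) + (?s a - ?s b - ?s (a - b)) \<in> L" .
    then show ?case using ab' by (simp add: algebra_simps)
  qed
  then show ?thesis ..
qed

lemma \<theta>_sum:
  assumes "i \<in> I" "finite J" "\<And>j. j \<in> J \<Longrightarrow> f j \<in> carrier F"
  shows "\<theta> i (sum f J) = (\<Oplus>\<^bsub>N\<^esub>j\<in>J. \<theta> i (f j))"
  using assms(2,3)
proof induction
  case empty then show ?case using \<theta>_L[OF assms(1) L_zero] by simp
next
  case (insert j J)
  have "sum f J \<in> carrier F" using insert.prems by (intro sum_closed_free_Abelian_group) auto
  then show ?case using insert assms(1) \<theta>_closed by (simp add: \<theta>_add N.finsum_insert Pi_iff del: carrier_free_Abelian_group_iff)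
qed

lemma \<theta>_sum_t:
  assumes "i \<in> I" "n \<in> I \<rightarrow> carrier N"
  shows "\<theta> i (\<Sum>j\<in>I. frag_of (t (n j) (e j))) = n i"
proof -
  have n: "n j \<in> carrier N" if "j \<in> I" for j using assms(2) that by auto
  have "\<theta> i (\<Sum>j\<in>I. frag_of (t (n j) (e j))) = (\<Oplus>\<^bsub>N\<^esub>j\<in>I. \<theta> i (frag_of (t (n j) (e j))))"
    using n e frag_t by (intro \<theta>_sum assms(1) fin) auto
  also have "\<dots> = (\<Oplus>\<^bsub>N\<^esub>j\<in>I. if i = j then n j else \<zero>\<^bsub>N\<^esub>)"
    using n e assms(1) by (intro N.finsum_cong') (auto simp: \<theta>_t \<kappa>_e)
  also have "\<dots> = n i" using N.finsum_singleton[OF assms(1) fin assms(2)] .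
  finally show ?thesis .
qed

text \<open>The normal form \<open>reduce\<close> makes the coordinates injective modulo
  \<open>L\<close>; the duality of \<open>\<kappa>\<close> with \<open>e\<close>, used in
  \<open>\<theta>_sum_t\<close>, makes them surjective.\<close>

lemma frag_coords: "frag_coords N P L I \<theta>"
proof (intro frag_coords.intro frag_coords_axioms.intro)
  show "abelian_group N" by (rule N.abelian_group_axioms)
  show "subgroup L F" by (rule L)
  show "\<theta> i \<in> hom F (add_monoid N)" if "i \<in> I" for i using \<theta>_hom that by blast
  show "c \<in> L \<longleftrightarrow> (\<forall>i\<in>I. \<theta> i c = \<zero>\<^bsub>N\<^esub>)" if c: "c \<in> carrier F" for c
  proof
    assume "\<forall>i\<in>I. \<theta> i c = \<zero>\<^bsub>N\<^esub>"
    then have "(\<Sum>i\<in>I. frag_of (t (\<theta> i c) (e i))) \<in> L"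
      using t_zero_n e by (intro L_sum) simp
    from L_plus[OF reduce[OF c] this] show "c \<in> L" by simp
  qed (use \<theta>_L in blast)
  show "\<exists>c\<in>carrier F. \<forall>i\<in>I. \<theta> i c = n i" if n: "n \<in> I \<rightarrow> carrier N" for n
  proof (rule bexI)
    show "\<forall>i\<in>I. \<theta> i (\<Sum>j\<in>I. frag_of (t (n j) (e j))) = n i" using \<theta>_sum_t n by blast
    show "(\<Sum>j\<in>I. frag_of (t (n j) (e j))) \<in> carrier F"
      using n e t_P by (intro sum_closed_free_Abelian_group) (auto simp: Pi_iff)
  qed
qed

end

text \<open>Naturality: the coefficients \<open>\<kappa> i s\<close> come from \<open>S\<close>
  alone and \<open>u\<close> commutes with the scalars, so applying \<open>u\<close> to the factor
  from \<open>N\<close> applies it to every coordinate.\<close>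

lemma tensor_map_coordinates:
  assumes "coordinate_tensor N S R nact sact I e \<kappa> t pn ps P L"
    and "coordinate_tensor N' S R nact' sact I e \<kappa> t pn ps P' L'"
    and u: "u \<in> hom (add_monoid N) (add_monoid N')"
    and u_act: "\<And>r x. \<lbrakk>r \<in> R; x \<in> carrier N\<rbrakk> \<Longrightarrow> u (nact r x) = nact' r (u x)"
    and w: "\<And>x s. \<lbrakk>x \<in> carrier N; s \<in> carrier S\<rbrakk> \<Longrightarrow> w (t x s) = frag_of (t (u x) s)"
    and c: "c \<in> carrier (free_Abelian_group P)"
  shows "frag_extend w c \<in> carrier (free_Abelian_group P')"
    and "i \<in> I \<Longrightarrow> coordinate_tensor.\<theta> N' nact' \<kappa> pn ps P' i (frag_extend w c) =
      u (coordinate_tensor.\<theta> N nact \<kappa> pn ps P i c)"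
proof -
  interpret A: coordinate_tensor N S R nact sact I e \<kappa> t pn ps P L by fact
  interpret B: coordinate_tensor N' S R nact' sact I e \<kappa> t pn ps P' L' by fact
  have u_closed: "u x \<in> carrier N'" if "x \<in> carrier N" for x using u that by (auto simp: hom_def)
  interpret u: group_hom "add_monoid N" "add_monoid N'" u
    using u A.N.a_group B.N.a_group by (simp add: group_hom_def group_hom_axioms_def)
  have "Poly_Mapping.keys c \<subseteq> P" using c by simp
  then have "c \<in> carrier A.F \<and> frag_extend w c \<in> carrier B.F \<and>
      (\<forall>i\<in>I. B.\<theta> i (frag_extend w c) = u (A.\<theta> i c))"
  proof (induction rule: frag_induction)
    case zero
    show ?case using A.\<theta>_L[OF _ A.L_zero] B.\<theta>_L[OF _ B.L_zero] u.hom_one by simp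
  next
    case (one p)
    then obtain x s where p: "p = t x s" "x \<in> carrier N" "s \<in> carrier S" unfolding A.P by auto
    then show ?case using one u_closed B.t_P[of "u x" s]
      by (simp add: w A.\<theta>_t B.\<theta>_t u_act A.\<kappa>)
  next
    case (diff a b)
    then have ab: "a \<in> carrier A.F" "b \<in> carrier A.F"
      and wab: "frag_extend w a \<in> carrier B.F" "frag_extend w b \<in> carrier B.F" by blast+
    have ab': "a - b \<in> carrier A.F" using ab keys_diff[of a b] by auto
    have wab': "frag_extend w a - frag_extend w b \<in> carrier B.F"
      using wab keys_diff[of "frag_extend w a" "frag_extend w b"] by auto
    have "B.\<theta> i (frag_extend w a - frag_extend w b) = u (A.\<theta> i (a - b))" if i: "i \<in> I" for i
    proof -
      have "u (A.\<theta> i a \<ominus>\<^bsub>N\<^esub> A.\<theta> i b) = u (A.\<theta> i a) \<ominus>\<^bsub>N'\<^esub> u (A.\<theta> i b)"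
        using A.\<theta>_closed[OF i ab(1)] A.\<theta>_closed[OF i ab(2)] u.hom_mult u.hom_inv
        by (simp add: a_minus_def a_inv_def)
      then show ?thesis
        using diff i B.\<theta>_diff[OF i wab wab'] A.\<theta>_diff[OF i ab ab'] by simp
    qed
    then show ?case using ab' wab' by (simp add: frag_extend_diff)
  qed
  then show "frag_extend w c \<in> carrier B.F"
    and "i \<in> I \<Longrightarrow> B.\<theta> i (frag_extend w c) = u (A.\<theta> i c)" by auto
qed

text \<open>The assumptions of the locale \<open>left_module\<close> are anonymous; this makes them
  citable one by one.\<close>

lemma left_moduleD:
  assumes "left_module R M l"
  shows "\<And>r x. \<lbrakk>r \<in> carrier R; x \<in> carrier M\<rbrakk> \<Longrightarrow> l r x \<in> carrier M"
    and "\<And>r s x. \<lbrakk>r \<in> carrier R; s \<in> carrier R; x \<in> carrier M\<rbrakk> \<Longrightarrow> l (r \<oplus>\<^bsub>R\<^esub> s) x = l r x \<oplus>\<^bsub>M\<^esub> l s x"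
    and "\<And>r x y. \<lbrakk>r \<in> carrier R; x \<in> carrier M; y \<in> carrier M\<rbrakk> \<Longrightarrow> l r (x \<oplus>\<^bsub>M\<^esub> y) = l r x \<oplus>\<^bsub>M\<^esub> l r y"
    and "\<And>r s x. \<lbrakk>r \<in> carrier R; s \<in> carrier R; x \<in> carrier M\<rbrakk> \<Longrightarrow> l (r \<otimes>\<^bsub>R\<^esub> s) x = l r (l s x)"
    and "\<And>x. x \<in> carrier M \<Longrightarrow> l \<one>\<^bsub>R\<^esub> x = x"
    and "ring R" and "abelian_group M"
  using left_module.axioms[OF assms] by (simp_all add: left_module_axioms_def)

lemma right_moduleD:
  assumes "right_module R M r"
  shows "\<And>s x. \<lbrakk>s \<in> carrier R; x \<in> carrier M\<rbrakk> \<Longrightarrow> r x s \<in> carrier M"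
    and "\<And>s t x. \<lbrakk>s \<in> carrier R; t \<in> carrier R; x \<in> carrier M\<rbrakk> \<Longrightarrow> r x (s \<oplus>\<^bsub>R\<^esub> t) = r x s \<oplus>\<^bsub>M\<^esub> r x t"
    and "\<And>s x y. \<lbrakk>s \<in> carrier R; x \<in> carrier M; y \<in> carrier M\<rbrakk> \<Longrightarrow> r (x \<oplus>\<^bsub>M\<^esub> y) s = r x s \<oplus>\<^bsub>M\<^esub> r y s"
    and "\<And>s t x. \<lbrakk>s \<in> carrier R; t \<in> carrier R; x \<in> carrier M\<rbrakk> \<Longrightarrow> r x (s \<otimes>\<^bsub>R\<^esub> t) = r (r x s) t"
    and "\<And>x. x \<in> carrier M \<Longrightarrow> r x \<one>\<^bsub>R\<^esub> = x"
    and "ring R" and "abelian_group M"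
  using right_module.axioms[OF assms] by (simp_all add: right_module_axioms_def)

section \<open>Relations of the tensor product\<close>

lemma diff_closed_free_Abelian_group:
  "\<lbrakk>c \<in> carrier (free_Abelian_group P); d \<in> carrier (free_Abelian_group P)\<rbrakk> \<Longrightarrow>
    c - d \<in> carrier (free_Abelian_group P)"
  using keys_diff[of c d] by auto

lemma tensor_relations_subset:
  assumes "right_module R M r" "left_module R N l"
  shows "tensor_relations R M r N l \<subseteq> carrier (free_Abelian_group (carrier M \<times> carrier N))"
proof -
  interpret M: right_module R M r by fact
  interpret N: left_module R N l by fact
  have r: "r x s \<in> carrier M" if "x \<in> carrier M" "s \<in> carrier R" for x s
    using right_moduleD(1)[OF assms(1)] that by blast
  have l: "l s y \<in> carrier N" if "y \<in> carrier N" "s \<in> carrier R" for y s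
    using left_moduleD(1)[OF assms(2)] that by blast
  show ?thesis
    unfolding tensor_relations_def
    by (intro Un_least subsetI; elim CollectE exE conjE; hypsubst)
      (intro diff_closed_free_Abelian_group; simp add: r l)+
qed

lemma tensor_kernel_subgroup:
  assumes "right_module R M r" "left_module R N l"
  shows "subgroup (tensor_kernel R M r N l) (free_Abelian_group (carrier M \<times> carrier N))"
  unfolding tensor_kernel_def
  using group.generate_is_subgroup[OF group_free_Abelian_group tensor_relations_subset[OF assms]] .

lemma tensor_relation_in_kernel:
  "c \<in> tensor_relations R M r N l \<Longrightarrow> c \<in> tensor_kernel R M r N l"
  unfolding tensor_kernel_def by (rule generate.incl)

text \<open>A homomorphism that is biadditive and balanced on generators kills the relations. Its
  kernel is a subgroup, so it contains everything they generate.\<close>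

lemma tensor_kernel_minimal:
  assumes "right_module R M r" "left_module R N l"
    and h: "group_hom (free_Abelian_group (carrier M \<times> carrier N)) H h"
    and h_l: "\<And>x x' y. \<lbrakk>x \<in> carrier M; x' \<in> carrier M; y \<in> carrier N\<rbrakk> \<Longrightarrow>
      h (frag_of (x \<oplus>\<^bsub>M\<^esub> x', y)) = h (frag_of (x, y)) \<otimes>\<^bsub>H\<^esub> h (frag_of (x', y))"
    and h_r: "\<And>x y y'. \<lbrakk>x \<in> carrier M; y \<in> carrier N; y' \<in> carrier N\<rbrakk> \<Longrightarrow>
      h (frag_of (x, y \<oplus>\<^bsub>N\<^esub> y')) = h (frag_of (x, y)) \<otimes>\<^bsub>H\<^esub> h (frag_of (x, y'))"
    and h_b: "\<And>x s y. \<lbrakk>x \<in> carrier M; s \<in> carrier R; y \<in> carrier N\<rbrakk> \<Longrightarrow>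
      h (frag_of (r x s, y)) = h (frag_of (x, l s y))"
    and c: "c \<in> tensor_kernel R M r N l"
  shows "h c = \<one>\<^bsub>H\<^esub>"
proof -
  interpret h: group_hom "free_Abelian_group (carrier M \<times> carrier N)" H h by fact
  let ?F = "free_Abelian_group (carrier M \<times> carrier N)"
  note sub = tensor_relations_subset[OF assms(1,2)]
  interpret M: right_module R M r by fact
  interpret N: left_module R N l by fact
  have r: "r x s \<in> carrier M" if "x \<in> carrier M" "s \<in> carrier R" for x s
    using right_moduleD(1)[OF assms(1)] that by blast
  have l: "l s y \<in> carrier N" if "y \<in> carrier N" "s \<in> carrier R" for y s
    using left_moduleD(1)[OF assms(2)] that by blast
  note [simp del] = carrier_free_Abelian_group_iff
  have mult: "h (x + y) = h x \<otimes>\<^bsub>H\<^esub> h y" if "x \<in> carrier ?F" "y \<in> carrier ?F" for x y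
    using h.hom_mult[OF that] by simp
  have diff: "h (x - y) = \<one>\<^bsub>H\<^esub>" if x: "x \<in> carrier ?F" and y: "y \<in> carrier ?F" and eq: "h x = h y" for x y
  proof -
    have "h x = h (x - y) \<otimes>\<^bsub>H\<^esub> h y"
      using mult[OF diff_closed_free_Abelian_group[OF x y] y] by simp
    then show ?thesis using eq h.H.r_cancel_one h.hom_closed[OF y] h.hom_closed[OF diff_closed_free_Abelian_group[OF x y]]
      by metis
  qed
  have diff2: "h (x - y - z) = \<one>\<^bsub>H\<^esub>"
    if "x \<in> carrier ?F" "y \<in> carrier ?F" "z \<in> carrier ?F" "h x = h y \<otimes>\<^bsub>H\<^esub> h z" for x y z
  proof -
    have "y + z \<in> carrier ?F" using h.G.m_closed[OF that(2,3)] by simp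
    then show ?thesis using diff[of x "y + z"] mult that by (simp add: diff_diff_eq)
  qed
  have gen: "frag_of (x, y) \<in> carrier ?F" if "x \<in> carrier M" "y \<in> carrier N" for x y
    using that by (simp add: carrier_free_Abelian_group_iff)
  have "h d = \<one>\<^bsub>H\<^esub>" if "d \<in> tensor_relations R M r N l" for d
    using that unfolding tensor_relations_def
  proof (elim UnE CollectE exE conjE; hypsubst)
    fix x x' y assume "x \<in> carrier M" "x' \<in> carrier M" "y \<in> carrier N"
    then show "h (frag_of (x \<oplus>\<^bsub>M\<^esub> x', y) - frag_of (x, y) - frag_of (x', y)) = \<one>\<^bsub>H\<^esub>"
      by (intro diff2 gen h_l) simp_all
  next
    fix x y y' assume "x \<in> carrier M" "y \<in> carrier N" "y' \<in> carrier N"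
    then show "h (frag_of (x, y \<oplus>\<^bsub>N\<^esub> y') - frag_of (x, y) - frag_of (x, y')) = \<one>\<^bsub>H\<^esub>"
      by (intro diff2 gen h_r) simp_all
  next
    fix x s y assume "x \<in> carrier M" "s \<in> carrier R" "y \<in> carrier N"
    then show "h (frag_of (r x s, y) - frag_of (x, l s y)) = \<one>\<^bsub>H\<^esub>"
      by (intro diff gen h_b r l)
  qed
  then have "tensor_relations R M r N l \<subseteq> kernel ?F H h"
    using sub by (auto simp: kernel_def)
  then have "tensor_kernel R M r N l \<subseteq> kernel ?F H h"
    unfolding tensor_kernel_def
    by (rule h.G.generate_subgroup_incl) (rule h.subgroup_kernel)
  then show ?thesis using c by (auto simp: kernel_def)
qed

text \<open>Here \<open>e\<close> is a finite nonempty basis and \<open>\<kappa>\<close> its system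
  of linear coefficient functions. Freeness enters in this equational form because
  \<open>\<kappa>\<close> is then directly the coefficient map of \<open>coordinate_tensor\<close>.
  The modules tested are right modules, so the coefficients act on them from the right.\<close>

lemma faithfully_flat_leftI:
  fixes R :: "('r, 'x) ring_scheme" and S :: "('s, 'y) ring_scheme"
  assumes S: "left_module R S l"
    and fin: "finite I" and ne: "I \<noteq> {}"
    and e: "\<And>i. i \<in> I \<Longrightarrow> e i \<in> carrier S"
    and \<kappa>: "\<And>i s. \<lbrakk>i \<in> I; s \<in> carrier S\<rbrakk> \<Longrightarrow> \<kappa> i s \<in> carrier R"
    and expand: "\<And>s. s \<in> carrier S \<Longrightarrow> s = (\<Oplus>\<^bsub>S\<^esub>i\<in>I. l (\<kappa> i s) (e i))"
    and \<kappa>_add: "\<And>i s s'. \<lbrakk>i \<in> I; s \<in> carrier S; s' \<in> carrier S\<rbrakk> \<Longrightarrow> \<kappa> i (s \<oplus>\<^bsub>S\<^esub> s') = \<kappa> i s \<oplus>\<^bsub>R\<^esub> \<kappa> i s'"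
    and \<kappa>_act: "\<And>i r s. \<lbrakk>i \<in> I; r \<in> carrier R; s \<in> carrier S\<rbrakk> \<Longrightarrow> \<kappa> i (l r s) = r \<otimes>\<^bsub>R\<^esub> \<kappa> i s"
    and \<kappa>_e: "\<And>i j. \<lbrakk>i \<in> I; j \<in> I\<rbrakk> \<Longrightarrow> \<kappa> i (e j) = (if i = j then \<one>\<^bsub>R\<^esub> else \<zero>\<^bsub>R\<^esub>)"
  shows "faithfully_flat_left TYPE('t) R S l"
proof -
  have ct: "coordinate_tensor N S (carrier R) (\<lambda>s x. r x s) l I e \<kappa> Pair fst snd
      (carrier N \<times> carrier S) (tensor_kernel R N r S l)" if N: "right_module R N r"
    for N :: "'t ring" and r
  proof -
    note NM = right_moduleD[OF N] and SM = left_moduleD[OF S]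
    interpret R: ring R by (rule NM(6))
    interpret N: abelian_group N by (rule NM(7))
    have zero: "r x \<zero>\<^bsub>R\<^esub> = \<zero>\<^bsub>N\<^esub>" if "x \<in> carrier N" for x
      using NM(2)[OF R.zero_closed R.zero_closed that] NM(1)[OF R.zero_closed that] by simp
    show ?thesis
    proof (intro coordinate_tensor.intro coordinate_tensor_axioms.intro)
      fix h c
      assume "group_hom (free_Abelian_group (carrier N \<times> carrier S)) (add_monoid N) h"
        and "\<And>x y s. \<lbrakk>x \<in> carrier N; y \<in> carrier N; s \<in> carrier S\<rbrakk> \<Longrightarrow>
          h (frag_of (x \<oplus>\<^bsub>N\<^esub> y, s)) = h (frag_of (x, s)) \<oplus>\<^bsub>N\<^esub> h (frag_of (y, s))"
        and "\<And>x s s'. \<lbrakk>x \<in> carrier N; s \<in> carrier S; s' \<in> carrier S\<rbrakk> \<Longrightarrow>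
          h (frag_of (x, s \<oplus>\<^bsub>S\<^esub> s')) = h (frag_of (x, s)) \<oplus>\<^bsub>N\<^esub> h (frag_of (x, s'))"
        and "\<And>t x s. \<lbrakk>t \<in> carrier R; x \<in> carrier N; s \<in> carrier S\<rbrakk> \<Longrightarrow>
          h (frag_of (r x t, s)) = h (frag_of (x, l t s))"
        and "c \<in> tensor_kernel R N r S l"
      then show "h c = \<zero>\<^bsub>N\<^esub>"
        using tensor_kernel_minimal[OF N S, of "add_monoid N" h c] by simp
    next
      show "subgroup (tensor_kernel R N r S l) (free_Abelian_group (carrier N \<times> carrier S))"
        by (rule tensor_kernel_subgroup[OF N S])
      show "abelian_group N" "abelian_group S" "finite I" by fact+
      show "s = (\<Oplus>\<^bsub>S\<^esub>i\<in>I. l (\<kappa> i s) (e i))" if "s \<in> carrier S" for s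
        using expand that .
      show "r x (\<kappa> i (s \<oplus>\<^bsub>S\<^esub> s')) = r x (\<kappa> i s) \<oplus>\<^bsub>N\<^esub> r x (\<kappa> i s')"
        if "i \<in> I" "s \<in> carrier S" "s' \<in> carrier S" "x \<in> carrier N" for i s s' x
        using that by (simp add: \<kappa>_add NM(2) \<kappa>)
      show "r x (\<kappa> i (l t s)) = r (r x t) (\<kappa> i s)"
        if "i \<in> I" "t \<in> carrier R" "s \<in> carrier S" "x \<in> carrier N" for i t s x
        using that by (simp add: \<kappa>_act NM(4) \<kappa>)
      show "r x (\<kappa> i (e j)) = (if i = j then x else \<zero>\<^bsub>N\<^esub>)"
        if "i \<in> I" "j \<in> I" "x \<in> carrier N" for i j x
        using that by (simp add: \<kappa>_e NM(5) zero)
      show "frag_of (x \<oplus>\<^bsub>N\<^esub> y, s) - frag_of (x, s) - frag_of (y, s) \<in> tensor_kernel R N r S l"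
        if "x \<in> carrier N" "y \<in> carrier N" "s \<in> carrier S" for x y s
        using that by (intro tensor_relation_in_kernel) (unfold tensor_relations_def, blast)
      show "frag_of (x, s \<oplus>\<^bsub>S\<^esub> s') - frag_of (x, s) - frag_of (x, s') \<in> tensor_kernel R N r S l"
        if "x \<in> carrier N" "s \<in> carrier S" "s' \<in> carrier S" for x s s'
        using that by (intro tensor_relation_in_kernel) (unfold tensor_relations_def, blast)
      show "frag_of (r x t, s) - frag_of (x, l t s) \<in> tensor_kernel R N r S l"
        if "t \<in> carrier R" "x \<in> carrier N" "s \<in> carrier S" for t x s
        using that by (intro tensor_relation_in_kernel) (unfold tensor_relations_def, blast)
    qed (simp_all add: e \<kappa> NM(1,3) SM(1))
  qed
  show ?thesis
    unfolding faithfully_flat_left_def tensor_map_def tensor_product_def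
  proof (intro conjI allI impI S, elim conjE)
    fix N1 N2 N3 :: "'t ring" and r1 r2 r3 u v
    assume N: "right_module R N1 r1" "right_module R N2 r2" "right_module R N3 r3"
      and u: "u \<in> right_module_hom R N1 r1 N2 r2" and v: "v \<in> right_module_hom R N2 r2 N3 r3"
    have uh: "u \<in> hom (add_monoid N1) (add_monoid N2)" and vh: "v \<in> hom (add_monoid N2) (add_monoid N3)"
      and u': "\<And>r x. \<lbrakk>r \<in> carrier R; x \<in> carrier N1\<rbrakk> \<Longrightarrow> u (r1 x r) = r2 (u x) r"
      and v': "\<And>r x. \<lbrakk>r \<in> carrier R; x \<in> carrier N2\<rbrakk> \<Longrightarrow> v (r2 x r) = r3 (v x) r"
      using u v by (simp_all add: right_module_hom_def)
    note C1 = ct[OF N(1)] and C2 = ct[OF N(2)] and C3 = ct[OF N(3)]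
    have Uw: "(\<lambda>(x, y). frag_of (u x, id y)) (x, s) = frag_of (u x, s)" for x and s :: 's by simp
    note U = tensor_map_coordinates[OF C1 C2, OF uh, OF u' Uw]
    have Vw: "(\<lambda>(x, y). frag_of (v x, id y)) (x, s) = frag_of (v x, s)" for x and s :: 's by simp
    note V = tensor_map_coordinates[OF C2 C3, OF vh, OF v' Vw]
    show "exact_seq ([add_monoid N3, add_monoid N2, add_monoid N1], [v, u]) \<longleftrightarrow>
      (\<lambda>C. the_elem ((\<lambda>c. tensor_kernel R N2 r2 S l #>\<^bsub>free_Abelian_group (carrier N2 \<times> carrier S)\<^esub>
          frag_extend (\<lambda>(x, y). frag_of (u x, id y)) c) ` C)) `
        carrier (free_Abelian_group (carrier N1 \<times> carrier S) Mod tensor_kernel R N1 r1 S l) =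
      kernel (free_Abelian_group (carrier N2 \<times> carrier S) Mod tensor_kernel R N2 r2 S l)
        (free_Abelian_group (carrier N3 \<times> carrier S) Mod tensor_kernel R N3 r3 S l)
        (\<lambda>C. the_elem ((\<lambda>c. tensor_kernel R N3 r3 S l #>\<^bsub>free_Abelian_group (carrier N3 \<times> carrier S)\<^esub>
          frag_extend (\<lambda>(x, y). frag_of (v x, id y)) c) ` C))"
      by (rule exact_quotients_iff[OF coordinate_tensor.frag_coords[OF C1] coordinate_tensor.frag_coords[OF C2]
            coordinate_tensor.frag_coords[OF C3] ne uh vh])
        (intro funcsetI U(1) V(1) U(2) V(2); simp)+
  qed
qed

text \<open>The mirror image of the left case: the tested module is the second factor, so the
  generator of \<open>x\<close> and \<open>s\<close> is the pair \<open>(s, x)\<close>.\<close>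

lemma faithfully_flat_rightI:
  fixes R :: "('r, 'x) ring_scheme" and S :: "('s, 'y) ring_scheme"
  assumes S: "right_module R S r"
    and fin: "finite I" and ne: "I \<noteq> {}"
    and e: "\<And>i. i \<in> I \<Longrightarrow> e i \<in> carrier S"
    and \<kappa>: "\<And>i s. \<lbrakk>i \<in> I; s \<in> carrier S\<rbrakk> \<Longrightarrow> \<kappa> i s \<in> carrier R"
    and expand: "\<And>s. s \<in> carrier S \<Longrightarrow> s = (\<Oplus>\<^bsub>S\<^esub>i\<in>I. r (e i) (\<kappa> i s))"
    and \<kappa>_add: "\<And>i s s'. \<lbrakk>i \<in> I; s \<in> carrier S; s' \<in> carrier S\<rbrakk> \<Longrightarrow> \<kappa> i (s \<oplus>\<^bsub>S\<^esub> s') = \<kappa> i s \<oplus>\<^bsub>R\<^esub> \<kappa> i s'"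
    and \<kappa>_act: "\<And>i t s. \<lbrakk>i \<in> I; t \<in> carrier R; s \<in> carrier S\<rbrakk> \<Longrightarrow> \<kappa> i (r s t) = \<kappa> i s \<otimes>\<^bsub>R\<^esub> t"
    and \<kappa>_e: "\<And>i j. \<lbrakk>i \<in> I; j \<in> I\<rbrakk> \<Longrightarrow> \<kappa> i (e j) = (if i = j then \<one>\<^bsub>R\<^esub> else \<zero>\<^bsub>R\<^esub>)"
  shows "faithfully_flat_right TYPE('t) R S r"
proof -
  have ct: "coordinate_tensor N S (carrier R) l (\<lambda>t s. r s t) I e \<kappa> (\<lambda>x s. (s, x)) snd fst
      (carrier S \<times> carrier N) (tensor_kernel R S r N l)" if N: "left_module R N l"
    for N :: "'t ring" and l
  proof -
    note NM = left_moduleD[OF N] and SM = right_moduleD[OF S]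
    interpret R: ring R by (rule NM(6))
    interpret N: abelian_group N by (rule NM(7))
    have zero: "l \<zero>\<^bsub>R\<^esub> x = \<zero>\<^bsub>N\<^esub>" if "x \<in> carrier N" for x
      using NM(2)[OF R.zero_closed R.zero_closed that] NM(1)[OF R.zero_closed that] by simp
    note sub = tensor_kernel_subgroup[OF S N]
    show ?thesis
    proof (intro coordinate_tensor.intro coordinate_tensor_axioms.intro)
      fix h c
      assume "group_hom (free_Abelian_group (carrier S \<times> carrier N)) (add_monoid N) h"
        and "\<And>x y s. \<lbrakk>x \<in> carrier N; y \<in> carrier N; s \<in> carrier S\<rbrakk> \<Longrightarrow>
          h (frag_of (s, x \<oplus>\<^bsub>N\<^esub> y)) = h (frag_of (s, x)) \<oplus>\<^bsub>N\<^esub> h (frag_of (s, y))"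
        and "\<And>x s s'. \<lbrakk>x \<in> carrier N; s \<in> carrier S; s' \<in> carrier S\<rbrakk> \<Longrightarrow>
          h (frag_of (s \<oplus>\<^bsub>S\<^esub> s', x)) = h (frag_of (s, x)) \<oplus>\<^bsub>N\<^esub> h (frag_of (s', x))"
        and "\<And>t x s. \<lbrakk>t \<in> carrier R; x \<in> carrier N; s \<in> carrier S\<rbrakk> \<Longrightarrow>
          h (frag_of (s, l t x)) = h (frag_of (r s t, x))"
        and "c \<in> tensor_kernel R S r N l"
      then show "h c = \<zero>\<^bsub>N\<^esub>"
        using tensor_kernel_minimal[OF S N, of "add_monoid N" h c] by simp
    next
      show "subgroup (tensor_kernel R S r N l) (free_Abelian_group (carrier S \<times> carrier N))" by (rule sub)
      show "abelian_group N" "abelian_group S" "finite I" by fact+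
      show "s = (\<Oplus>\<^bsub>S\<^esub>i\<in>I. r (e i) (\<kappa> i s))" if "s \<in> carrier S" for s
        using expand that .
      show "l (\<kappa> i (s \<oplus>\<^bsub>S\<^esub> s')) x = l (\<kappa> i s) x \<oplus>\<^bsub>N\<^esub> l (\<kappa> i s') x"
        if "i \<in> I" "s \<in> carrier S" "s' \<in> carrier S" "x \<in> carrier N" for i s s' x
        using that by (simp add: \<kappa>_add NM(2) \<kappa>)
      show "l (\<kappa> i (r s t)) x = l (\<kappa> i s) (l t x)"
        if "i \<in> I" "t \<in> carrier R" "s \<in> carrier S" "x \<in> carrier N" for i t s x
        using that by (simp add: \<kappa>_act NM(4) \<kappa>)
      show "l (\<kappa> i (e j)) x = (if i = j then x else \<zero>\<^bsub>N\<^esub>)"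
        if "i \<in> I" "j \<in> I" "x \<in> carrier N" for i j x
        using that by (simp add: \<kappa>_e NM(5) zero)
      show "frag_of (s, x \<oplus>\<^bsub>N\<^esub> y) - frag_of (s, x) - frag_of (s, y) \<in> tensor_kernel R S r N l"
        if "x \<in> carrier N" "y \<in> carrier N" "s \<in> carrier S" for x y s
        using that by (intro tensor_relation_in_kernel) (unfold tensor_relations_def, blast)
      show "frag_of (s \<oplus>\<^bsub>S\<^esub> s', x) - frag_of (s, x) - frag_of (s', x) \<in> tensor_kernel R S r N l"
        if "x \<in> carrier N" "s \<in> carrier S" "s' \<in> carrier S" for x s s'
        using that by (intro tensor_relation_in_kernel) (unfold tensor_relations_def, blast)
      \<comment> \<open>With the factors exchanged, balancing appears with the opposite sign, so it
        comes from the negative of a defining relation.\<close>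
      show "frag_of (s, l t x) - frag_of (r s t, x) \<in> tensor_kernel R S r N l"
        if "t \<in> carrier R" "x \<in> carrier N" "s \<in> carrier S" for t x s
      proof -
        have "frag_of (r s t, x) - frag_of (s, l t x) \<in> tensor_kernel R S r N l"
          using that by (intro tensor_relation_in_kernel) (unfold tensor_relations_def, blast)
        then show ?thesis
          using subgroup.m_inv_closed[OF sub] subgroup.mem_carrier[OF sub]
          by (metis carrier_free_Abelian_group_iff inv_free_Abelian_group minus_diff_eq)
      qed
      show "carrier S \<times> carrier N = (\<lambda>(x, s). (s, x)) ` (carrier N \<times> carrier S)" by force
    qed (simp_all add: e \<kappa> NM(1,3) SM(1))
  qed
  show ?thesis
    unfolding faithfully_flat_right_def tensor_map_def tensor_product_def
  proof (intro conjI allI impI S, elim conjE)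
    fix N1 N2 N3 :: "'t ring" and l1 l2 l3 u v
    assume N: "left_module R N1 l1" "left_module R N2 l2" "left_module R N3 l3"
      and u: "u \<in> left_module_hom R N1 l1 N2 l2" and v: "v \<in> left_module_hom R N2 l2 N3 l3"
    have uh: "u \<in> hom (add_monoid N1) (add_monoid N2)" and vh: "v \<in> hom (add_monoid N2) (add_monoid N3)"
      and u': "\<And>r x. \<lbrakk>r \<in> carrier R; x \<in> carrier N1\<rbrakk> \<Longrightarrow> u (l1 r x) = l2 r (u x)"
      and v': "\<And>r x. \<lbrakk>r \<in> carrier R; x \<in> carrier N2\<rbrakk> \<Longrightarrow> v (l2 r x) = l3 r (v x)"
      using u v by (simp_all add: left_module_hom_def)
    note C1 = ct[OF N(1)] and C2 = ct[OF N(2)] and C3 = ct[OF N(3)]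
    have Uw: "(\<lambda>(x, y). frag_of (id x, u y)) (s, x) = frag_of (s, u x)" for x and s :: 's by simp
    note U = tensor_map_coordinates[OF C1 C2, OF uh, OF u' Uw]
    have Vw: "(\<lambda>(x, y). frag_of (id x, v y)) (s, x) = frag_of (s, v x)" for x and s :: 's by simp
    note V = tensor_map_coordinates[OF C2 C3, OF vh, OF v' Vw]
    show "exact_seq ([add_monoid N3, add_monoid N2, add_monoid N1], [v, u]) \<longleftrightarrow>
      (\<lambda>C. the_elem ((\<lambda>c. tensor_kernel R S r N2 l2 #>\<^bsub>free_Abelian_group (carrier S \<times> carrier N2)\<^esub>
          frag_extend (\<lambda>(x, y). frag_of (id x, u y)) c) ` C)) `
        carrier (free_Abelian_group (carrier S \<times> carrier N1) Mod tensor_kernel R S r N1 l1) =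
      kernel (free_Abelian_group (carrier S \<times> carrier N2) Mod tensor_kernel R S r N2 l2)
        (free_Abelian_group (carrier S \<times> carrier N3) Mod tensor_kernel R S r N3 l3)
        (\<lambda>C. the_elem ((\<lambda>c. tensor_kernel R S r N3 l3 #>\<^bsub>free_Abelian_group (carrier S \<times> carrier N3)\<^esub>
          frag_extend (\<lambda>(x, y). frag_of (id x, v y)) c) ` C))"
      by (rule exact_quotients_iff[OF coordinate_tensor.frag_coords[OF C1] coordinate_tensor.frag_coords[OF C2]
            coordinate_tensor.frag_coords[OF C3] ne uh vh])
        (intro funcsetI U(1) V(1) U(2) V(2); simp)+
  qed
qed

section \<open>Orthogonality of characters\<close>

lemma (in comm_monoid) finprod_swap:
  assumes "finite I" "finite J" "\<And>i j. i \<in> I \<Longrightarrow> j \<in> J \<Longrightarrow> f i j \<in> carrier G"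
  shows "(\<Otimes>i\<in>I. \<Otimes>j\<in>J. f i j) = (\<Otimes>j\<in>J. \<Otimes>i\<in>I. f i j)"
  using assms(1,3)
proof induction
  case empty then show ?case by simp
next
  case (insert i I)
  have "(\<Otimes>j\<in>J. f i j \<otimes> (\<Otimes>i\<in>I. f i j)) = (\<Otimes>j\<in>J. f i j) \<otimes> (\<Otimes>j\<in>J. \<Otimes>i\<in>I. f i j)"
    using insert.prems by (intro finprod_multf) auto
  moreover have "(\<Otimes>j\<in>J. \<Otimes>i\<in>insert i I. f i j) = (\<Otimes>j\<in>J. f i j \<otimes> (\<Otimes>i\<in>I. f i j))"
    using insert by (intro finprod_cong') (auto intro!: finprod_insert)
  ultimately show ?case using insert by (auto simp: finprod_insert Pi_iff)
qed

lemmas (in abelian_monoid) finsum_swap = add.finprod_swap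

text \<open>A homogeneous system in which \<open>m i j\<close> is the coefficient of the unknown
  \<open>i\<close> in the equation \<open>j\<close>. Gaussian elimination: an equation with a
  nonzero coefficient determines one unknown from the others, and substituting it leaves one
  equation and one unknown fewer.\<close>

lemma (in field) nontrivial_solution:
  assumes "finite J" "finite I" "card J < card I" "\<And>i j. \<lbrakk>i \<in> I; j \<in> J\<rbrakk> \<Longrightarrow> m i j \<in> carrier R"
  shows "\<exists>c. c \<in> I \<rightarrow> carrier R \<and> (\<exists>i\<in>I. c i \<noteq> \<zero>) \<and> (\<forall>j\<in>J. (\<Oplus>i\<in>I. c i \<otimes> m i j) = \<zero>)"
  using assms
proof (induction J arbitrary: I m rule: finite_induct)
  case empty
  then have "I \<noteq> {}" by auto
  then show ?case by (intro exI[of _ "\<lambda>_. \<one>"]) auto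
next
  case (insert j0 J)
  show ?case
  proof (cases "\<forall>i\<in>I. m i j0 = \<zero>")
    case True
    obtain c where c: "c \<in> I \<rightarrow> carrier R" "\<exists>i\<in>I. c i \<noteq> \<zero>" "\<forall>j\<in>J. (\<Oplus>i\<in>I. c i \<otimes> m i j) = \<zero>"
      using insert.IH[of I m] insert.prems insert.hyps by auto
    moreover have "(\<Oplus>i\<in>I. c i \<otimes> m i j0) = \<zero>"
      using c(1) True by (intro add.finprod_one_eqI) (auto simp: Pi_iff)
    ultimately show ?thesis by blast
  next
    case False
    then obtain i0 where i0: "i0 \<in> I" "m i0 j0 \<noteq> \<zero>" by blast
    define I' where "I' = I - {i0}"
    have I: "I = insert i0 I'" "i0 \<notin> I'" "finite I'" using i0 insert.prems by (auto simp: I'_def)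
    define w where "w = inv (m i0 j0)"
    have m: "m i j \<in> carrier R" if "i \<in> I" "j \<in> insert j0 J" for i j using insert.prems(3) that by blast
    have mu: "m i0 j0 \<in> Units R" using i0 m field_Units by auto
    have w: "w \<in> carrier R" "w \<otimes> m i0 j0 = \<one>" using mu by (auto simp: w_def)
    \<comment> \<open>The coefficients after substituting for the unknown \<open>i0\<close> the
      value that equation \<open>j0\<close> prescribes.\<close>
    define m' where "m' i j = m i j \<ominus> m i j0 \<otimes> w \<otimes> m i0 j" for i j
    obtain c' where c': "c' \<in> I' \<rightarrow> carrier R" "\<exists>i\<in>I'. c' i \<noteq> \<zero>" "\<forall>j\<in>J. (\<Oplus>i\<in>I'. c' i \<otimes> m' i j) = \<zero>"
      using insert.IH[of I' m'] insert.prems insert.hyps I i0 m w by (auto simp: m'_def)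
    define s where "s = (\<Oplus>i\<in>I'. c' i \<otimes> m i j0)"
    have s: "s \<in> carrier R" unfolding s_def using c'(1) m I by (intro finsum_closed) auto
    \<comment> \<open>The eliminated unknown is solved from equation \<open>j0\<close>, to which the
      other unknowns contribute \<open>s\<close>.\<close>
    define c where "c = c'(i0 := \<ominus> (s \<otimes> w))"
    have c'c: "c' i \<in> carrier R" if "i \<in> I'" for i using c'(1) that by auto
    have mI: "m i j \<in> carrier R" if "i \<in> I'" "j \<in> insert j0 J" for i j using m that I by auto
    have sum: "(\<Oplus>i\<in>I. c i \<otimes> m i j) = (\<Oplus>i\<in>I'. c' i \<otimes> m i j) \<ominus> s \<otimes> (w \<otimes> m i0 j)" if j: "j \<in> insert j0 J" for j
    proof -
      have "(\<Oplus>i\<in>I'. c i \<otimes> m i j) = (\<Oplus>i\<in>I'. c' i \<otimes> m i j)"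
        using I c'c mI j by (intro finsum_cong') (auto simp: c_def)
      moreover have "(\<Oplus>i\<in>I. c i \<otimes> m i j) = c i0 \<otimes> m i0 j \<oplus> (\<Oplus>i\<in>I'. c i \<otimes> m i j)"
        unfolding I(1) using I c'c mI m[OF i0(1) j] j s w by (intro finsum_insert) (auto simp: c_def)
      moreover have "(\<Oplus>i\<in>I'. c' i \<otimes> m i j) \<in> carrier R" using c'c mI j by (intro finsum_closed) auto
      ultimately show ?thesis using s w m[OF i0(1) j]
        by (simp add: c_def a_minus_def l_minus m_assoc a_comm)
    qed
    have "(\<Oplus>i\<in>I. c i \<otimes> m i j) = \<zero>" if j: "j \<in> insert j0 J" for j
    proof (cases "j = j0")
      case True
      then show ?thesis using sum[OF j] s w by (simp add: s_def[symmetric] a_minus_def r_neg)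
    next
      case False
      then have "j \<in> J" using j by auto
      have "(\<Oplus>i\<in>I'. c' i \<otimes> m' i j) = (\<Oplus>i\<in>I'. c' i \<otimes> m i j \<oplus> (c' i \<otimes> m i j0) \<otimes> (\<ominus> (w \<otimes> m i0 j)))"
        using c'c mI m[OF i0(1) j] j w
        by (intro finsum_cong') (auto simp: m'_def a_minus_def r_distr r_minus m_assoc)
      also have "\<dots> = (\<Oplus>i\<in>I'. c' i \<otimes> m i j) \<oplus> (\<Oplus>i\<in>I'. (c' i \<otimes> m i j0) \<otimes> (\<ominus> (w \<otimes> m i0 j)))"
        using c'c mI m[OF i0(1) j] j w by (intro finsum_addf) auto
      also have "(\<Oplus>i\<in>I'. (c' i \<otimes> m i j0) \<otimes> (\<ominus> (w \<otimes> m i0 j))) = s \<otimes> (\<ominus> (w \<otimes> m i0 j))"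
        unfolding s_def using c'c mI m[OF i0(1) j] j w I by (intro finsum_ldistr[symmetric]) auto
      finally show ?thesis
        using sum[OF j] c'(3) \<open>j \<in> J\<close> s w m[OF i0(1) j] by (simp add: a_minus_def r_minus)
    qed
    moreover have "c \<in> I \<rightarrow> carrier R" using c'c s w I by (auto simp: c_def)
    moreover have "\<exists>i\<in>I. c i \<noteq> \<zero>" using c'(2) I by (auto simp: c_def)
    ultimately show ?thesis by blast
  qed
qed

text \<open>Division with remainder by the least positive multiple of one that vanishes;
  characteristic zero fits in because zero divides only zero. For the order of the group this turns
  the divisibility hypothesis into invertibility in the field.\<close>

lemma (in ring) add_pow_one_eq_zero_iff:
  "add_pow R n \<one> = \<zero> \<longleftrightarrow> ring_characteristic R dvd n" for n :: nat
proof (cases "\<exists>n::nat>0. add_pow R n \<one> = \<zero>")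
  case False
  then have "ring_characteristic R = 0" unfolding ring_characteristic_def by (rule if_not_P)
  then show ?thesis using False by (metis add.nat_pow_0 dvd_0_left_iff dvd_0_right gr0I)
next
  case True
  define p where "p = (LEAST n::nat. 0 < n \<and> add_pow R n \<one> = \<zero>)"
  have p: "0 < p" "add_pow R p \<one> = \<zero>"
    using LeastI_ex[OF True] unfolding p_def by auto
  have "add_pow R (p * (n div p)) \<one> = \<zero>"
    using add.nat_pow_pow[of \<one> "n div p" p] add.nat_pow_pow[of \<one> p "n div p"] p by (simp add: mult.commute)
  then have "add_pow R n \<one> = add_pow R (n mod p) \<one>"
    using add.nat_pow_mult[of \<one> "p * (n div p)" "n mod p"] by simp
  moreover have "add_pow R (n mod p) \<one> = \<zero> \<longleftrightarrow> n mod p = 0"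
    using not_less_Least[of "n mod p" "\<lambda>n. 0 < n \<and> add_pow R n \<one> = \<zero>"] p
    unfolding p_def[symmetric] by (auto simp: add.nat_pow_0)
  ultimately show ?thesis using True by (simp add: ring_characteristic_def p_def[symmetric] dvd_eq_mod_eq_0)
qed

section \<open>Characters of a group identified with its dual\<close>

locale self_dual_group = K: field K + G: comm_group G
  for K :: "('k, 'x) ring_scheme" and G :: "('g, 'z) monoid_scheme" +
  fixes \<chi> :: "'g \<Rightarrow> 'g \<Rightarrow> 'k"
  assumes finite_G: "finite (carrier G)"
    and char: "\<not> ring_characteristic K dvd order G"
    and \<chi>: "\<chi> \<in> iso G (dual_group G K)"
begin

abbreviation ord_G :: 'k where "ord_G \<equiv> add_pow K (order G) \<one>\<^bsub>K\<^esub>"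

lemma ord_G_unit: "ord_G \<in> Units K"
  using char K.add_pow_one_eq_zero_iff[of "order G"] K.field_Units by simp

lemma \<chi>_dual: "g \<in> carrier G \<Longrightarrow> \<chi> g \<in> hom G (units_of K)" "g \<in> carrier G \<Longrightarrow> \<chi> g \<in> extensional (carrier G)"
  using \<chi> by (auto simp: iso_def hom_def dual_group_def)

lemma \<chi>_Units: "\<lbrakk>g \<in> carrier G; h \<in> carrier G\<rbrakk> \<Longrightarrow> \<chi> g h \<in> Units K"
  using \<chi>_dual(1) by (auto simp: hom_def units_of_carrier)

lemma \<chi>_closed [simp]: "\<lbrakk>g \<in> carrier G; h \<in> carrier G\<rbrakk> \<Longrightarrow> \<chi> g h \<in> carrier K"
  using \<chi>_Units by blast

lemma \<chi>_mult_right: "\<lbrakk>g \<in> carrier G; h \<in> carrier G; h' \<in> carrier G\<rbrakk> \<Longrightarrow> \<chi> g (h \<otimes>\<^bsub>G\<^esub> h') = \<chi> g h \<otimes>\<^bsub>K\<^esub> \<chi> g h'"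
  using \<chi>_dual(1)[of g] by (auto simp: hom_def units_of_mult)

lemma \<chi>_mult_left:
  assumes "g \<in> carrier G" "g' \<in> carrier G" "h \<in> carrier G"
  shows "\<chi> (g \<otimes>\<^bsub>G\<^esub> g') h = \<chi> g h \<otimes>\<^bsub>K\<^esub> \<chi> g' h"
proof -
  have "\<chi> (g \<otimes>\<^bsub>G\<^esub> g') = (\<lambda>h\<in>carrier G. \<chi> g h \<otimes>\<^bsub>K\<^esub> \<chi> g' h)"
    using \<chi> assms by (auto simp: iso_def hom_def dual_group_def)
  then show ?thesis using assms by simp
qed

lemma \<chi>_one_right: "g \<in> carrier G \<Longrightarrow> \<chi> g \<one>\<^bsub>G\<^esub> = \<one>\<^bsub>K\<^esub>"
  using \<chi>_mult_right[of g "\<one>\<^bsub>G\<^esub>" "\<one>\<^bsub>G\<^esub>"] \<chi>_Units[of g "\<one>\<^bsub>G\<^esub>"] K.Units_l_cancel[of "\<chi> g \<one>\<^bsub>G\<^esub>" "\<chi> g \<one>\<^bsub>G\<^esub>" "\<one>\<^bsub>K\<^esub>"] by simp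

lemma \<chi>_one_left: "h \<in> carrier G \<Longrightarrow> \<chi> \<one>\<^bsub>G\<^esub> h = \<one>\<^bsub>K\<^esub>"
  using \<chi>_mult_left[of "\<one>\<^bsub>G\<^esub>" "\<one>\<^bsub>G\<^esub>" h] \<chi>_Units[of "\<one>\<^bsub>G\<^esub>" h] K.Units_l_cancel[of "\<chi> \<one>\<^bsub>G\<^esub> h" "\<chi> \<one>\<^bsub>G\<^esub> h" "\<one>\<^bsub>K\<^esub>"] by simp

text \<open>Both sides are inverse to \<open>\<chi> g h\<close>, as \<open>\<chi>\<close> is
  multiplicative in either argument.\<close>

lemma \<chi>_inv:
  assumes "g \<in> carrier G" "h \<in> carrier G"
  shows "\<chi> g (inv\<^bsub>G\<^esub> h) = \<chi> (inv\<^bsub>G\<^esub> g) h"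
proof -
  have "\<chi> g h \<otimes>\<^bsub>K\<^esub> \<chi> g (inv\<^bsub>G\<^esub> h) = \<chi> g h \<otimes>\<^bsub>K\<^esub> \<chi> (inv\<^bsub>G\<^esub> g) h"
    using assms by (simp add: \<chi>_mult_right[symmetric] \<chi>_mult_left[symmetric] \<chi>_one_left \<chi>_one_right)
  then show ?thesis using K.Units_l_cancel[OF \<chi>_Units[OF assms]] assms by simp
qed

lemma \<chi>_inj: "\<lbrakk>g \<in> carrier G; g' \<in> carrier G; \<chi> g = \<chi> g'\<rbrakk> \<Longrightarrow> g = g'"
  using \<chi> by (auto simp: iso_def bij_betw_def inj_on_def)

lemma sum_one: "(\<Oplus>\<^bsub>K\<^esub>h\<in>carrier G. \<one>\<^bsub>K\<^esub>) = ord_G"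
  using K.add.finprod_const[of "\<one>\<^bsub>K\<^esub>" "carrier G"] by (simp add: order_def)

text \<open>Translation by \<open>x\<close> permutes the group, so the sum equals \<open>c\<close>
  times itself and vanishes as \<open>c\<close> is not one. With \<open>f\<close> arbitrary, it
  serves sums over group elements as well as sums over characters.\<close>

lemma sum_multiplicative_eq_zero:
  assumes f: "f \<in> carrier G \<rightarrow> carrier K" and mult: "\<And>h. h \<in> carrier G \<Longrightarrow> f (x \<otimes>\<^bsub>G\<^esub> h) = c \<otimes>\<^bsub>K\<^esub> f h"
    and x: "x \<in> carrier G" and c: "c \<in> carrier K" "c \<noteq> \<one>\<^bsub>K\<^esub>"
  shows "(\<Oplus>\<^bsub>K\<^esub>h\<in>carrier G. f h) = \<zero>\<^bsub>K\<^esub>"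
proof -
  let ?s = "\<Oplus>\<^bsub>K\<^esub>h\<in>carrier G. f h"
  have s: "?s \<in> carrier K" using f by (rule K.finsum_closed)
  have "?s = (\<Oplus>\<^bsub>K\<^esub>h\<in>(\<lambda>h. x \<otimes>\<^bsub>G\<^esub> h) ` carrier G. f h)"
    using G.surj_const_mult[OF x] by simp
  also have "\<dots> = (\<Oplus>\<^bsub>K\<^esub>h\<in>carrier G. f (x \<otimes>\<^bsub>G\<^esub> h))"
    using f x G.inj_on_cmult[OF x] by (intro K.finsum_reindex) auto
  also have "\<dots> = (\<Oplus>\<^bsub>K\<^esub>h\<in>carrier G. c \<otimes>\<^bsub>K\<^esub> f h)"
    using f c mult by (intro K.finsum_cong') auto
  also have "\<dots> = c \<otimes>\<^bsub>K\<^esub> ?s" using f c finite_G by (intro K.finsum_rdistr[symmetric]) auto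
  finally have "(\<one>\<^bsub>K\<^esub> \<ominus>\<^bsub>K\<^esub> c) \<otimes>\<^bsub>K\<^esub> ?s = \<zero>\<^bsub>K\<^esub>"
    using c s by (simp add: a_minus_def K.l_distr K.l_minus K.r_neg)
  then show ?thesis using K.integral[of "\<one>\<^bsub>K\<^esub> \<ominus>\<^bsub>K\<^esub> c" ?s] s c K.minus_eq_zero_iff[of "\<one>\<^bsub>K\<^esub>" c] by auto
qed

lemma row_orthogonality:
  assumes g: "g \<in> carrier G"
  shows "(\<Oplus>\<^bsub>K\<^esub>h\<in>carrier G. \<chi> g h) = (if g = \<one>\<^bsub>G\<^esub> then ord_G else \<zero>\<^bsub>K\<^esub>)"
proof (cases "g = \<one>\<^bsub>G\<^esub>")
  case True
  then have "(\<Oplus>\<^bsub>K\<^esub>h\<in>carrier G. \<chi> g h) = (\<Oplus>\<^bsub>K\<^esub>h\<in>carrier G. \<one>\<^bsub>K\<^esub>)"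
    using \<chi>_one_left by (intro K.finsum_cong') auto
  then show ?thesis using True sum_one by simp
next
  case False
  \<comment> \<open>Injectivity of \<open>\<chi>\<close> makes the character of \<open>g\<close>
    nontrivial: characters are extensional, so one that is trivial on the group would equal the
    character of the identity.\<close>
  have "\<exists>x\<in>carrier G. \<chi> g x \<noteq> \<one>\<^bsub>K\<^esub>"
  proof (rule ccontr)
    assume "\<not> ?thesis"
    then have "\<chi> g = \<chi> \<one>\<^bsub>G\<^esub>" using \<chi>_dual(2)[OF g] \<chi>_dual(2)[OF G.one_closed] \<chi>_one_left
      by (intro extensionalityI) auto
    then show False using \<chi>_inj g False by blast
  qed
  then obtain x where "x \<in> carrier G" "\<chi> g x \<noteq> \<one>\<^bsub>K\<^esub>" by blast
  then show ?thesis using False g sum_multiplicative_eq_zero[of "\<chi> g" x "\<chi> g x"] \<chi>_mult_right by simp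
qed

text \<open>If \<open>h \<noteq> 1\<close> were killed by all characters, the linear system \<open>\<Sum>\<^sub>g c\<^sub>g \<chi>\<^sub>g(x) = 0\<close> would have at
  most \<open>|G| - 1\<close> distinct equations, hence a nontrivial solution, against row orthogonality.\<close>

lemma characters_separate:
  assumes h: "h \<in> carrier G" "h \<noteq> \<one>\<^bsub>G\<^esub>"
  shows "\<exists>g\<in>carrier G. \<chi> g h \<noteq> \<one>\<^bsub>K\<^esub>"
proof (rule ccontr)
  assume "\<not> ?thesis"
  then have triv: "\<chi> g h = \<one>\<^bsub>K\<^esub>" if "g \<in> carrier G" for g using that by blast
  \<comment> \<open>The equation at \<open>h\<close> is dropped; it agrees with the one at the
    identity, which is kept.\<close>
  have "card (carrier G - {h}) < card (carrier G)" using h finite_G by (metis card_Diff1_less)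
  then obtain c where c: "c \<in> carrier G \<rightarrow> carrier K" "\<exists>g\<in>carrier G. c g \<noteq> \<zero>\<^bsub>K\<^esub>"
      "\<forall>x\<in>carrier G - {h}. (\<Oplus>\<^bsub>K\<^esub>g\<in>carrier G. c g \<otimes>\<^bsub>K\<^esub> \<chi> g x) = \<zero>\<^bsub>K\<^esub>"
    using K.nontrivial_solution[of "carrier G - {h}" "carrier G" \<chi>] finite_G by auto
  have c': "c g \<in> carrier K" if "g \<in> carrier G" for g using c(1) that by auto
  have "(\<Oplus>\<^bsub>K\<^esub>g\<in>carrier G. c g \<otimes>\<^bsub>K\<^esub> \<chi> g h) = (\<Oplus>\<^bsub>K\<^esub>g\<in>carrier G. c g \<otimes>\<^bsub>K\<^esub> \<chi> g \<one>\<^bsub>G\<^esub>)"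
    using c' triv h \<chi>_one_right by (intro K.finsum_cong') auto
  then have all: "(\<Oplus>\<^bsub>K\<^esub>g\<in>carrier G. c g \<otimes>\<^bsub>K\<^esub> \<chi> g x) = \<zero>\<^bsub>K\<^esub>" if "x \<in> carrier G" for x
    using c(3) that h by (cases "x = h") auto
  \<comment> \<open>Fourier inversion: multiplying the equations by the inverse of the character of
    \<open>g'\<close> and summing over the group leaves \<open>c g'\<close> times the order of the
    group.\<close>
  have "c g' = \<zero>\<^bsub>K\<^esub>" if g': "g' \<in> carrier G" for g'
  proof -
    have "\<zero>\<^bsub>K\<^esub> = (\<Oplus>\<^bsub>K\<^esub>x\<in>carrier G. (\<Oplus>\<^bsub>K\<^esub>g\<in>carrier G. c g \<otimes>\<^bsub>K\<^esub> \<chi> g x) \<otimes>\<^bsub>K\<^esub> \<chi> (inv\<^bsub>G\<^esub> g') x)"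
      using all g' by (intro K.add.finprod_one_eqI[symmetric]) auto
    also have "\<dots> = (\<Oplus>\<^bsub>K\<^esub>x\<in>carrier G. \<Oplus>\<^bsub>K\<^esub>g\<in>carrier G. c g \<otimes>\<^bsub>K\<^esub> \<chi> (g \<otimes>\<^bsub>G\<^esub> inv\<^bsub>G\<^esub> g') x)"
    proof (intro K.finsum_cong' refl)
      fix x assume x: "x \<in> carrier G"
      show "(\<Oplus>\<^bsub>K\<^esub>g\<in>carrier G. c g \<otimes>\<^bsub>K\<^esub> \<chi> g x) \<otimes>\<^bsub>K\<^esub> \<chi> (inv\<^bsub>G\<^esub> g') x =
          (\<Oplus>\<^bsub>K\<^esub>g\<in>carrier G. c g \<otimes>\<^bsub>K\<^esub> \<chi> (g \<otimes>\<^bsub>G\<^esub> inv\<^bsub>G\<^esub> g') x)"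
        using c' x g' finite_G
        by (subst K.finsum_ldistr) (auto intro!: K.finsum_cong' simp: \<chi>_mult_left K.m_assoc)
    qed (use c' g' in auto)
    also have "\<dots> = (\<Oplus>\<^bsub>K\<^esub>g\<in>carrier G. \<Oplus>\<^bsub>K\<^esub>x\<in>carrier G. c g \<otimes>\<^bsub>K\<^esub> \<chi> (g \<otimes>\<^bsub>G\<^esub> inv\<^bsub>G\<^esub> g') x)"
      using c' g' finite_G by (intro K.finsum_swap) auto
    also have "\<dots> = (\<Oplus>\<^bsub>K\<^esub>g\<in>carrier G. if g' = g then c g \<otimes>\<^bsub>K\<^esub> ord_G else \<zero>\<^bsub>K\<^esub>)"
    proof (intro K.finsum_cong' refl)
      fix g assume g: "g \<in> carrier G"
      have eq: "g \<otimes>\<^bsub>G\<^esub> inv\<^bsub>G\<^esub> g' = \<one>\<^bsub>G\<^esub> \<longleftrightarrow> g' = g"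
        using g g' by (metis G.inv_solve_right G.l_one G.one_closed)
      have "(\<Oplus>\<^bsub>K\<^esub>x\<in>carrier G. c g \<otimes>\<^bsub>K\<^esub> \<chi> (g \<otimes>\<^bsub>G\<^esub> inv\<^bsub>G\<^esub> g') x) =
          c g \<otimes>\<^bsub>K\<^esub> (\<Oplus>\<^bsub>K\<^esub>x\<in>carrier G. \<chi> (g \<otimes>\<^bsub>G\<^esub> inv\<^bsub>G\<^esub> g') x)"
        using c' g g' finite_G by (intro K.finsum_rdistr[symmetric]) auto
      then show "(\<Oplus>\<^bsub>K\<^esub>x\<in>carrier G. c g \<otimes>\<^bsub>K\<^esub> \<chi> (g \<otimes>\<^bsub>G\<^esub> inv\<^bsub>G\<^esub> g') x) = (if g' = g then c g \<otimes>\<^bsub>K\<^esub> ord_G else \<zero>\<^bsub>K\<^esub>)"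
        using row_orthogonality[of "g \<otimes>\<^bsub>G\<^esub> inv\<^bsub>G\<^esub> g'"] g g' eq c' by auto
    qed (use c' in auto)
    also have "\<dots> = c g' \<otimes>\<^bsub>K\<^esub> ord_G"
      using K.finsum_singleton[OF g' finite_G, of "\<lambda>g. c g \<otimes>\<^bsub>K\<^esub> ord_G"] c' by auto
    finally show ?thesis
      using K.integral[of "c g'" ord_G] c' g' ord_G_unit K.field_Units by auto
  qed
  then show False using c(2) by blast
qed

text \<open>A character that separates \<open>h\<close> from the identity allows translation in the
  index of the character, in place of translation of the group element used for rows.\<close>

lemma column_orthogonality:
  assumes h: "h \<in> carrier G"
  shows "(\<Oplus>\<^bsub>K\<^esub>g\<in>carrier G. \<chi> g h) = (if h = \<one>\<^bsub>G\<^esub> then ord_G else \<zero>\<^bsub>K\<^esub>)"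
proof (cases "h = \<one>\<^bsub>G\<^esub>")
  case True
  then have "(\<Oplus>\<^bsub>K\<^esub>g\<in>carrier G. \<chi> g h) = (\<Oplus>\<^bsub>K\<^esub>h\<in>carrier G. \<one>\<^bsub>K\<^esub>)"
    using \<chi>_one_right by (intro K.finsum_cong') auto
  then show ?thesis using True sum_one by simp
next
  case False
  then obtain x where "x \<in> carrier G" "\<chi> x h \<noteq> \<one>\<^bsub>K\<^esub>" using characters_separate h by blast
  then show ?thesis
    using False h sum_multiplicative_eq_zero[of "\<lambda>g. \<chi> g h" x "\<chi> x h"] \<chi>_mult_left by simp
qed

end

section \<open>The twisted group algebra\<close>

lemma PiE_eqI:
  assumes "x \<in> (\<Pi>\<^sub>E i\<in>I. A i)" "y \<in> (\<Pi>\<^sub>E i\<in>I. A i)" "\<And>i. i \<in> I \<Longrightarrow> x i = y i"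
  shows "x = y"
  using assms by (intro PiE_ext) auto

locale twisted_algebra = K: cring K + G: group G + AR: ring A + A: assoc_algebra K A
  for K :: "('k, 'x) ring_scheme" and G :: "('g, 'z) monoid_scheme"
    and A :: "('k, 'a, 'y) module_scheme" +
  fixes \<mu> :: "'g \<Rightarrow> 'g \<Rightarrow> 'k"
  assumes finite_G: "finite (carrier G)" and cocycle: "normalised_2cocycle G K \<mu>"
begin

lemma \<mu>_Units: "\<lbrakk>g \<in> carrier G; h \<in> carrier G\<rbrakk> \<Longrightarrow> \<mu> g h \<in> Units K"
  using cocycle by (simp add: normalised_2cocycle_def)

lemma \<mu>_closed [simp]: "\<lbrakk>g \<in> carrier G; h \<in> carrier G\<rbrakk> \<Longrightarrow> \<mu> g h \<in> carrier K"
  using \<mu>_Units by blast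

lemma \<mu>_assoc: "\<lbrakk>g \<in> carrier G; h \<in> carrier G; l \<in> carrier G\<rbrakk> \<Longrightarrow>
    \<mu> g h \<otimes>\<^bsub>K\<^esub> \<mu> (g \<otimes>\<^bsub>G\<^esub> h) l = \<mu> g (h \<otimes>\<^bsub>G\<^esub> l) \<otimes>\<^bsub>K\<^esub> \<mu> h l"
  using cocycle by (simp add: normalised_2cocycle_def)

lemma \<mu>_one [simp]: "g \<in> carrier G \<Longrightarrow> \<mu> \<one>\<^bsub>G\<^esub> g = \<one>\<^bsub>K\<^esub>" "g \<in> carrier G \<Longrightarrow> \<mu> g \<one>\<^bsub>G\<^esub> = \<one>\<^bsub>K\<^esub>"
  using cocycle by (auto simp: normalised_2cocycle_def)

abbreviation T :: "('k, 'g \<Rightarrow> 'a) module" where "T \<equiv> twisted_group_algebra A G \<mu>"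

lemma carrier_T: "carrier T = (\<Pi>\<^sub>E g\<in>carrier G. carrier A)"
  by (simp add: twisted_group_algebra_def)

lemma T_closed [simp]: "x \<in> carrier T \<Longrightarrow> g \<in> carrier G \<Longrightarrow> x g \<in> carrier A"
  by (auto simp: carrier_T)

lemma T_eqI: "\<lbrakk>x \<in> carrier T; y \<in> carrier T; \<And>g. g \<in> carrier G \<Longrightarrow> x g = y g\<rbrakk> \<Longrightarrow> x = y"
  unfolding carrier_T by (rule PiE_eqI)

lemma T_add [simp]: "g \<in> carrier G \<Longrightarrow> (x \<oplus>\<^bsub>T\<^esub> y) g = x g \<oplus>\<^bsub>A\<^esub> y g"
  by (simp add: twisted_group_algebra_def)

lemma T_zero [simp]: "g \<in> carrier G \<Longrightarrow> \<zero>\<^bsub>T\<^esub> g = \<zero>\<^bsub>A\<^esub>"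
  by (simp add: twisted_group_algebra_def)

lemma pure_tensor_closed [simp]: "a \<in> carrier A \<Longrightarrow> pure_tensor A G a g \<in> carrier T"
  by (auto simp: carrier_T pure_tensor_def)

lemma pure_tensor_apply [simp]: "h \<in> carrier G \<Longrightarrow> pure_tensor A G a g h = (if h = g then a else \<zero>\<^bsub>A\<^esub>)"
  by (simp add: pure_tensor_def)

lemma T_one: "\<one>\<^bsub>T\<^esub> = pure_tensor A G \<one>\<^bsub>A\<^esub> \<one>\<^bsub>G\<^esub>"
  by (simp add: twisted_group_algebra_def)

lemma T_mult_filter:
  "l \<in> carrier G \<Longrightarrow> (x \<otimes>\<^bsub>T\<^esub> y) l =
    (\<Oplus>\<^bsub>A\<^esub>p\<in>{p \<in> carrier G \<times> carrier G. fst p \<otimes>\<^bsub>G\<^esub> snd p = l}.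
      \<mu> (fst p) (snd p) \<odot>\<^bsub>A\<^esub> (x (fst p) \<otimes>\<^bsub>A\<^esub> y (snd p)))"
  by (simp add: twisted_group_algebra_def)

text \<open>The pairs with product \<open>l\<close> are parametrised by their first component. A
  single sum over the whole group is easier to reindex and to exchange with others.\<close>

lemma T_mult:
  assumes x: "x \<in> carrier T" and y: "y \<in> carrier T" and l: "l \<in> carrier G"
  shows "(x \<otimes>\<^bsub>T\<^esub> y) l = (\<Oplus>\<^bsub>A\<^esub>g\<in>carrier G. \<mu> g (inv\<^bsub>G\<^esub> g \<otimes>\<^bsub>G\<^esub> l) \<odot>\<^bsub>A\<^esub> (x g \<otimes>\<^bsub>A\<^esub> y (inv\<^bsub>G\<^esub> g \<otimes>\<^bsub>G\<^esub> l)))"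
proof -
  have S: "{p \<in> carrier G \<times> carrier G. fst p \<otimes>\<^bsub>G\<^esub> snd p = l} = (\<lambda>g. (g, inv\<^bsub>G\<^esub> g \<otimes>\<^bsub>G\<^esub> l)) ` carrier G"
    using l by (auto simp: image_iff G.m_assoc[symmetric])
  show ?thesis unfolding T_mult_filter[OF l] S
    using x y l by (subst AR.finsum_reindex) (auto simp: inj_on_def)
qed

lemma T_mult_closed: "\<lbrakk>x \<in> carrier T; y \<in> carrier T\<rbrakk> \<Longrightarrow> x \<otimes>\<^bsub>T\<^esub> y \<in> carrier T"
  unfolding carrier_T
  by (auto simp: twisted_group_algebra_def intro!: AR.finsum_closed A.smult_closed AR.m_closed)

text \<open>In the convolution at \<open>l\<close> only the component of \<open>x\<close> of degree
  \<open>l g\<^sup>-\<^sup>1\<close> meets the pure tensor.\<close>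

lemma mult_pure_tensor:
  assumes x: "x \<in> carrier T" and a: "a \<in> carrier A" and g: "g \<in> carrier G" and l: "l \<in> carrier G"
  shows "(x \<otimes>\<^bsub>T\<^esub> pure_tensor A G a g) l =
    \<mu> (l \<otimes>\<^bsub>G\<^esub> inv\<^bsub>G\<^esub> g) g \<odot>\<^bsub>A\<^esub> (x (l \<otimes>\<^bsub>G\<^esub> inv\<^bsub>G\<^esub> g) \<otimes>\<^bsub>A\<^esub> a)"
proof -
  let ?k = "l \<otimes>\<^bsub>G\<^esub> inv\<^bsub>G\<^esub> g"
  have k: "?k \<in> carrier G" using g l by simp
  have eq: "inv\<^bsub>G\<^esub> h \<otimes>\<^bsub>G\<^esub> l = g \<longleftrightarrow> ?k = h" if "h \<in> carrier G" for h
    using that g l by (metis G.inv_solve_left G.inv_solve_right)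
  have "(x \<otimes>\<^bsub>T\<^esub> pure_tensor A G a g) l =
      (\<Oplus>\<^bsub>A\<^esub>h\<in>carrier G. if ?k = h then \<mu> h g \<odot>\<^bsub>A\<^esub> (x h \<otimes>\<^bsub>A\<^esub> a) else \<zero>\<^bsub>A\<^esub>)"
    unfolding T_mult[OF x pure_tensor_closed[OF a] l]
  proof (intro AR.finsum_cong' refl)
    fix h assume h: "h \<in> carrier G"
    show "\<mu> h (inv\<^bsub>G\<^esub> h \<otimes>\<^bsub>G\<^esub> l) \<odot>\<^bsub>A\<^esub> (x h \<otimes>\<^bsub>A\<^esub> pure_tensor A G a g (inv\<^bsub>G\<^esub> h \<otimes>\<^bsub>G\<^esub> l)) =
        (if ?k = h then \<mu> h g \<odot>\<^bsub>A\<^esub> (x h \<otimes>\<^bsub>A\<^esub> a) else \<zero>\<^bsub>A\<^esub>)"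
      unfolding eq[OF h, symmetric] using x a l h by auto
  qed (use x a g in auto)
  also have "\<dots> = \<mu> ?k g \<odot>\<^bsub>A\<^esub> (x ?k \<otimes>\<^bsub>A\<^esub> a)"
    using AR.finsum_singleton[OF k finite_G, of "\<lambda>h. \<mu> h g \<odot>\<^bsub>A\<^esub> (x h \<otimes>\<^bsub>A\<^esub> a)"] x a g by auto
  finally show ?thesis .
qed

lemma pure_tensor_mult:
  assumes x: "x \<in> carrier T" and a: "a \<in> carrier A" and g: "g \<in> carrier G" and l: "l \<in> carrier G"
  shows "(pure_tensor A G a g \<otimes>\<^bsub>T\<^esub> x) l =
    \<mu> g (inv\<^bsub>G\<^esub> g \<otimes>\<^bsub>G\<^esub> l) \<odot>\<^bsub>A\<^esub> (a \<otimes>\<^bsub>A\<^esub> x (inv\<^bsub>G\<^esub> g \<otimes>\<^bsub>G\<^esub> l))"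
proof -
  let ?f = "\<lambda>h. \<mu> h (inv\<^bsub>G\<^esub> h \<otimes>\<^bsub>G\<^esub> l) \<odot>\<^bsub>A\<^esub> (a \<otimes>\<^bsub>A\<^esub> x (inv\<^bsub>G\<^esub> h \<otimes>\<^bsub>G\<^esub> l))"
  have "(pure_tensor A G a g \<otimes>\<^bsub>T\<^esub> x) l = (\<Oplus>\<^bsub>A\<^esub>h\<in>carrier G. if g = h then ?f h else \<zero>\<^bsub>A\<^esub>)"
    unfolding T_mult[OF pure_tensor_closed[OF a] x l]
    using x a g l by (intro AR.finsum_cong') auto
  also have "\<dots> = ?f g"
    using x a l by (intro AR.finsum_singleton g finite_G) auto
  finally show ?thesis .
qed

lemma T_mult_assoc:
  assumes x: "x \<in> carrier T" and y: "y \<in> carrier T" and z: "z \<in> carrier T"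
  shows "(x \<otimes>\<^bsub>T\<^esub> y) \<otimes>\<^bsub>T\<^esub> z = x \<otimes>\<^bsub>T\<^esub> (y \<otimes>\<^bsub>T\<^esub> z)"
proof (rule T_eqI)
  fix l assume l: "l \<in> carrier G"
  let ?i = "\<lambda>g. inv\<^bsub>G\<^esub> g"
  \<comment> \<open>The term with degree \<open>g\<close> taken from \<open>x\<close> and degree
    \<open>p\<close> from the product of \<open>x\<close> and \<open>y\<close>. Both bracketings
    become the double sum of these terms.\<close>
  let ?t = "\<lambda>g p. (\<mu> g (?i g \<otimes>\<^bsub>G\<^esub> p) \<otimes>\<^bsub>K\<^esub> \<mu> p (?i p \<otimes>\<^bsub>G\<^esub> l)) \<odot>\<^bsub>A\<^esub>
    (x g \<otimes>\<^bsub>A\<^esub> y (?i g \<otimes>\<^bsub>G\<^esub> p) \<otimes>\<^bsub>A\<^esub> z (?i p \<otimes>\<^bsub>G\<^esub> l))"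
  have tc: "?t g p \<in> carrier A" if "g \<in> carrier G" "p \<in> carrier G" for g p
    using that x y z l by simp
  have "((x \<otimes>\<^bsub>T\<^esub> y) \<otimes>\<^bsub>T\<^esub> z) l = (\<Oplus>\<^bsub>A\<^esub>p\<in>carrier G. \<Oplus>\<^bsub>A\<^esub>g\<in>carrier G. ?t g p)"
    unfolding T_mult[OF T_mult_closed[OF x y] z l]
  proof (intro AR.finsum_cong' refl)
    fix p assume p: "p \<in> carrier G"
    show "\<mu> p (?i p \<otimes>\<^bsub>G\<^esub> l) \<odot>\<^bsub>A\<^esub> ((x \<otimes>\<^bsub>T\<^esub> y) p \<otimes>\<^bsub>A\<^esub> z (?i p \<otimes>\<^bsub>G\<^esub> l)) = (\<Oplus>\<^bsub>A\<^esub>g\<in>carrier G. ?t g p)"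
      unfolding T_mult[OF x y p]
      using x y z p l finite_G
      by (subst AR.finsum_ldistr; (subst A.finsum_smult_ldistr)?)
        (auto intro!: AR.finsum_cong' simp: A.smult_mult_left A.smult_assoc1[symmetric] K.m_comm)
  qed (use tc in \<open>auto intro!: AR.finsum_closed\<close>)
  also have "\<dots> = (\<Oplus>\<^bsub>A\<^esub>g\<in>carrier G. \<Oplus>\<^bsub>A\<^esub>p\<in>carrier G. ?t g p)"
    using tc by (intro AR.finsum_swap finite_G)
  also have "\<dots> = (x \<otimes>\<^bsub>T\<^esub> (y \<otimes>\<^bsub>T\<^esub> z)) l"
    unfolding T_mult[OF x T_mult_closed[OF y z] l]
  proof (intro AR.finsum_cong' refl)
    fix g assume g: "g \<in> carrier G"
    let ?s = "\<lambda>h. \<mu> h (?i h \<otimes>\<^bsub>G\<^esub> (?i g \<otimes>\<^bsub>G\<^esub> l)) \<odot>\<^bsub>A\<^esub> (y h \<otimes>\<^bsub>A\<^esub> z (?i h \<otimes>\<^bsub>G\<^esub> (?i g \<otimes>\<^bsub>G\<^esub> l)))"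
    have sc: "?s \<in> carrier G \<rightarrow> carrier A" using g l y z by auto
    have gl: "?i g \<otimes>\<^bsub>G\<^esub> l \<in> carrier G" using g l by simp
    \<comment> \<open>The inner sum runs over the degree \<open>h\<close> taken from
      \<open>y\<close>; the substitution \<open>h = g\<^sup>-\<^sup>1 p\<close> produces the
      summation variables of the other bracketing.\<close>
    have "(y \<otimes>\<^bsub>T\<^esub> z) (?i g \<otimes>\<^bsub>G\<^esub> l) = (\<Oplus>\<^bsub>A\<^esub>h\<in>(\<lambda>p. ?i g \<otimes>\<^bsub>G\<^esub> p) ` carrier G. ?s h)"
      unfolding T_mult[OF y z gl] using G.surj_const_mult[of "?i g"] g by simp
    also have "\<dots> = (\<Oplus>\<^bsub>A\<^esub>p\<in>carrier G. ?s (?i g \<otimes>\<^bsub>G\<^esub> p))"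
      using g sc G.inj_on_cmult[of "?i g"] G.surj_const_mult[of "?i g"] by (intro AR.finsum_reindex) auto
    also have "\<dots> = (\<Oplus>\<^bsub>A\<^esub>p\<in>carrier G. \<mu> (?i g \<otimes>\<^bsub>G\<^esub> p) (?i p \<otimes>\<^bsub>G\<^esub> l) \<odot>\<^bsub>A\<^esub>
        (y (?i g \<otimes>\<^bsub>G\<^esub> p) \<otimes>\<^bsub>A\<^esub> z (?i p \<otimes>\<^bsub>G\<^esub> l)))"
    proof (intro AR.finsum_cong' refl)
      fix p assume p: "p \<in> carrier G"
      have "?i (?i g \<otimes>\<^bsub>G\<^esub> p) \<otimes>\<^bsub>G\<^esub> (?i g \<otimes>\<^bsub>G\<^esub> l) = ?i p \<otimes>\<^bsub>G\<^esub> (g \<otimes>\<^bsub>G\<^esub> (?i g \<otimes>\<^bsub>G\<^esub> l))"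
        using g p l by (simp add: G.inv_mult_group G.m_assoc)
      also have "\<dots> = ?i p \<otimes>\<^bsub>G\<^esub> l" using g p l by (simp add: G.m_assoc[symmetric])
      finally show "?s (?i g \<otimes>\<^bsub>G\<^esub> p) = \<mu> (?i g \<otimes>\<^bsub>G\<^esub> p) (?i p \<otimes>\<^bsub>G\<^esub> l) \<odot>\<^bsub>A\<^esub>
          (y (?i g \<otimes>\<^bsub>G\<^esub> p) \<otimes>\<^bsub>A\<^esub> z (?i p \<otimes>\<^bsub>G\<^esub> l))" by simp
    qed (use g l y z in auto)
    finally have yz: "(y \<otimes>\<^bsub>T\<^esub> z) (?i g \<otimes>\<^bsub>G\<^esub> l) = \<dots>" .
    \<comment> \<open>The cocycle identity for the degrees taken from \<open>x\<close>,
      \<open>y\<close> and \<open>z\<close>, namely \<open>g\<close>,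
      \<open>g\<^sup>-\<^sup>1 p\<close> and \<open>p\<^sup>-\<^sup>1 l\<close>.\<close>
    have coc: "\<mu> g (?i g \<otimes>\<^bsub>G\<^esub> p) \<otimes>\<^bsub>K\<^esub> \<mu> p (?i p \<otimes>\<^bsub>G\<^esub> l) = \<mu> g (?i g \<otimes>\<^bsub>G\<^esub> l) \<otimes>\<^bsub>K\<^esub> \<mu> (?i g \<otimes>\<^bsub>G\<^esub> p) (?i p \<otimes>\<^bsub>G\<^esub> l)"
      if p: "p \<in> carrier G" for p
    proof -
      have "g \<otimes>\<^bsub>G\<^esub> (?i g \<otimes>\<^bsub>G\<^esub> p) = p" using g p by (simp add: G.m_assoc[symmetric])
      moreover have "(?i g \<otimes>\<^bsub>G\<^esub> p) \<otimes>\<^bsub>G\<^esub> (?i p \<otimes>\<^bsub>G\<^esub> l) = ?i g \<otimes>\<^bsub>G\<^esub> l"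
        using g p l by (metis G.inv_closed G.inv_solve_left G.m_assoc G.m_closed)
      ultimately show ?thesis using \<mu>_assoc[of g "?i g \<otimes>\<^bsub>G\<^esub> p" "?i p \<otimes>\<^bsub>G\<^esub> l"] g p l by simp
    qed
    show "(\<Oplus>\<^bsub>A\<^esub>p\<in>carrier G. ?t g p) =
        \<mu> g (?i g \<otimes>\<^bsub>G\<^esub> l) \<odot>\<^bsub>A\<^esub> (x g \<otimes>\<^bsub>A\<^esub> (y \<otimes>\<^bsub>T\<^esub> z) (?i g \<otimes>\<^bsub>G\<^esub> l))"
      unfolding yz
      using x y z g l finite_G
      by (subst AR.finsum_rdistr; (subst A.finsum_smult_ldistr)?)
        (auto intro!: AR.finsum_cong' simp: A.smult_mult_right A.smult_assoc1[symmetric] coc AR.m_assoc)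
  qed (use x y z l in \<open>auto simp: T_mult_closed\<close>)
  finally show "((x \<otimes>\<^bsub>T\<^esub> y) \<otimes>\<^bsub>T\<^esub> z) l = (x \<otimes>\<^bsub>T\<^esub> (y \<otimes>\<^bsub>T\<^esub> z)) l" .
qed (use x y z in \<open>auto intro!: T_mult_closed\<close>)

lemma T_add_closed: "\<lbrakk>x \<in> carrier T; y \<in> carrier T\<rbrakk> \<Longrightarrow> x \<oplus>\<^bsub>T\<^esub> y \<in> carrier T"
  by (auto simp: twisted_group_algebra_def)

lemma T_zero_closed: "\<zero>\<^bsub>T\<^esub> \<in> carrier T"
  by (auto simp: twisted_group_algebra_def)

lemma abelian_group_T: "abelian_group T"
proof (rule abelian_groupI)
  fix x assume x: "x \<in> carrier T"
  show "\<exists>y\<in>carrier T. y \<oplus>\<^bsub>T\<^esub> x = \<zero>\<^bsub>T\<^esub>"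
  proof (rule bexI)
    show y: "(\<lambda>g\<in>carrier G. \<ominus>\<^bsub>A\<^esub> x g) \<in> carrier T" using x by (auto simp: carrier_T)
    show "(\<lambda>g\<in>carrier G. \<ominus>\<^bsub>A\<^esub> x g) \<oplus>\<^bsub>T\<^esub> x = \<zero>\<^bsub>T\<^esub>"
      using x y by (intro T_eqI T_add_closed T_zero_closed) (auto simp: AR.l_neg)
  qed
qed (auto intro!: T_eqI simp: T_add_closed T_zero_closed AR.a_ac)

text \<open>Normalisation of the cocycle removes the scalar from products with the identity;
  distributivity holds term by term in the convolution.\<close>

lemma ring_T: "ring T"
proof (intro ringI abelian_group_T)
  show "monoid T"
  proof (rule monoidI)
    show "\<one>\<^bsub>T\<^esub> \<in> carrier T" by (simp add: T_one)
    show "\<one>\<^bsub>T\<^esub> \<otimes>\<^bsub>T\<^esub> x = x" if x: "x \<in> carrier T" for x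
      unfolding T_one using x
      by (intro T_eqI T_mult_closed) (auto simp: pure_tensor_mult)
    show "x \<otimes>\<^bsub>T\<^esub> \<one>\<^bsub>T\<^esub> = x" if x: "x \<in> carrier T" for x
      unfolding T_one using x
      by (intro T_eqI T_mult_closed) (auto simp: mult_pure_tensor)
  qed (auto simp: T_mult_closed T_mult_assoc)
next
  fix x y z assume xyz: "x \<in> carrier T" "y \<in> carrier T" "z \<in> carrier T"
  show "(x \<oplus>\<^bsub>T\<^esub> y) \<otimes>\<^bsub>T\<^esub> z = x \<otimes>\<^bsub>T\<^esub> z \<oplus>\<^bsub>T\<^esub> y \<otimes>\<^bsub>T\<^esub> z"
  proof (rule T_eqI)
    fix l assume l: "l \<in> carrier G"
    have "((x \<oplus>\<^bsub>T\<^esub> y) \<otimes>\<^bsub>T\<^esub> z) l = (\<Oplus>\<^bsub>A\<^esub>g\<in>carrier G. \<mu> g (inv\<^bsub>G\<^esub> g \<otimes>\<^bsub>G\<^esub> l) \<odot>\<^bsub>A\<^esub> (x g \<otimes>\<^bsub>A\<^esub> z (inv\<^bsub>G\<^esub> g \<otimes>\<^bsub>G\<^esub> l)) \<oplus>\<^bsub>A\<^esub> \<mu> g (inv\<^bsub>G\<^esub> g \<otimes>\<^bsub>G\<^esub> l) \<odot>\<^bsub>A\<^esub> (y g \<otimes>\<^bsub>A\<^esub> z (inv\<^bsub>G\<^esub> g \<otimes>\<^bsub>G\<^esub> l)))"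
      unfolding T_mult[OF T_add_closed[OF xyz(1,2)] xyz(3) l] using xyz l
      by (intro AR.finsum_cong') (auto simp: AR.l_distr A.smult_r_distr)
    also have "\<dots> = (\<Oplus>\<^bsub>A\<^esub>g\<in>carrier G. \<mu> g (inv\<^bsub>G\<^esub> g \<otimes>\<^bsub>G\<^esub> l) \<odot>\<^bsub>A\<^esub> (x g \<otimes>\<^bsub>A\<^esub> z (inv\<^bsub>G\<^esub> g \<otimes>\<^bsub>G\<^esub> l))) \<oplus>\<^bsub>A\<^esub> (\<Oplus>\<^bsub>A\<^esub>g\<in>carrier G. \<mu> g (inv\<^bsub>G\<^esub> g \<otimes>\<^bsub>G\<^esub> l) \<odot>\<^bsub>A\<^esub> (y g \<otimes>\<^bsub>A\<^esub> z (inv\<^bsub>G\<^esub> g \<otimes>\<^bsub>G\<^esub> l)))"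
      using xyz l by (intro AR.finsum_addf) auto
    finally show "((x \<oplus>\<^bsub>T\<^esub> y) \<otimes>\<^bsub>T\<^esub> z) l = (x \<otimes>\<^bsub>T\<^esub> z \<oplus>\<^bsub>T\<^esub> y \<otimes>\<^bsub>T\<^esub> z) l"
      using xyz l by (simp add: T_mult)
  qed (use xyz in \<open>auto intro!: T_mult_closed T_add_closed\<close>)
  show "z \<otimes>\<^bsub>T\<^esub> (x \<oplus>\<^bsub>T\<^esub> y) = z \<otimes>\<^bsub>T\<^esub> x \<oplus>\<^bsub>T\<^esub> z \<otimes>\<^bsub>T\<^esub> y"
  proof (rule T_eqI)
    fix l assume l: "l \<in> carrier G"
    have "(z \<otimes>\<^bsub>T\<^esub> (x \<oplus>\<^bsub>T\<^esub> y)) l = (\<Oplus>\<^bsub>A\<^esub>g\<in>carrier G. \<mu> g (inv\<^bsub>G\<^esub> g \<otimes>\<^bsub>G\<^esub> l) \<odot>\<^bsub>A\<^esub> (z g \<otimes>\<^bsub>A\<^esub> x (inv\<^bsub>G\<^esub> g \<otimes>\<^bsub>G\<^esub> l)) \<oplus>\<^bsub>A\<^esub> \<mu> g (inv\<^bsub>G\<^esub> g \<otimes>\<^bsub>G\<^esub> l) \<odot>\<^bsub>A\<^esub> (z g \<otimes>\<^bsub>A\<^esub> y (inv\<^bsub>G\<^esub> g \<otimes>\<^bsub>G\<^esub> l)))"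
      unfolding T_mult[OF xyz(3) T_add_closed[OF xyz(1,2)] l] using xyz l
      by (intro AR.finsum_cong') (auto simp: AR.r_distr A.smult_r_distr)
    also have "\<dots> = (\<Oplus>\<^bsub>A\<^esub>g\<in>carrier G. \<mu> g (inv\<^bsub>G\<^esub> g \<otimes>\<^bsub>G\<^esub> l) \<odot>\<^bsub>A\<^esub> (z g \<otimes>\<^bsub>A\<^esub> x (inv\<^bsub>G\<^esub> g \<otimes>\<^bsub>G\<^esub> l))) \<oplus>\<^bsub>A\<^esub> (\<Oplus>\<^bsub>A\<^esub>g\<in>carrier G. \<mu> g (inv\<^bsub>G\<^esub> g \<otimes>\<^bsub>G\<^esub> l) \<odot>\<^bsub>A\<^esub> (z g \<otimes>\<^bsub>A\<^esub> y (inv\<^bsub>G\<^esub> g \<otimes>\<^bsub>G\<^esub> l)))"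
      using xyz l by (intro AR.finsum_addf) auto
    finally show "(z \<otimes>\<^bsub>T\<^esub> (x \<oplus>\<^bsub>T\<^esub> y)) l = (z \<otimes>\<^bsub>T\<^esub> x \<oplus>\<^bsub>T\<^esub> z \<otimes>\<^bsub>T\<^esub> y) l"
      using xyz l by (simp add: T_mult)
  qed (use xyz in \<open>auto intro!: T_mult_closed T_add_closed\<close>)
qed

sublocale T: ring T by (rule ring_T)

lemma T_finsum:
  assumes "finite I" "f \<in> I \<rightarrow> carrier T" "g \<in> carrier G"
  shows "(\<Oplus>\<^bsub>T\<^esub>i\<in>I. f i) g = (\<Oplus>\<^bsub>A\<^esub>i\<in>I. f i g)"
  using assms(1,2)
proof induction
  case empty then show ?case using assms(3) by simp
next
  case (insert i I)
  then have "(\<Oplus>\<^bsub>T\<^esub>i\<in>insert i I. f i) = f i \<oplus>\<^bsub>T\<^esub> (\<Oplus>\<^bsub>T\<^esub>i\<in>I. f i)" by (intro T.finsum_insert) auto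
  moreover have "(\<Oplus>\<^bsub>A\<^esub>i\<in>insert i I. f i g) = f i g \<oplus>\<^bsub>A\<^esub> (\<Oplus>\<^bsub>A\<^esub>i\<in>I. f i g)"
    using insert assms(3) by (intro AR.finsum_insert) (auto simp: Pi_iff)
  ultimately show ?case using insert assms(3) by auto
qed

section \<open>The basis of the \<open>u g\<close> over \<open>A\<close>\<close>

abbreviation u :: "'g \<Rightarrow> 'g \<Rightarrow> 'a" where "u g \<equiv> pure_tensor A G \<one>\<^bsub>A\<^esub> g"

lemma base_embedding_mult_u: "\<lbrakk>a \<in> carrier A; g \<in> carrier G\<rbrakk> \<Longrightarrow>
    base_embedding A G a \<otimes>\<^bsub>T\<^esub> u g = pure_tensor A G a g"
  unfolding base_embedding_def
  by (intro T_eqI T.m_closed) (auto simp: pure_tensor_mult)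

lemma u_mult_base_embedding: "\<lbrakk>a \<in> carrier A; g \<in> carrier G\<rbrakk> \<Longrightarrow>
    u g \<otimes>\<^bsub>T\<^esub> base_embedding A G a = pure_tensor A G a g"
  unfolding base_embedding_def
  by (intro T_eqI T.m_closed) (auto simp: mult_pure_tensor)

lemma sum_pure_tensor:
  assumes x: "x \<in> carrier T"
  shows "(\<Oplus>\<^bsub>T\<^esub>g\<in>carrier G. pure_tensor A G (x g) g) = x"
proof (rule T_eqI)
  fix h assume h: "h \<in> carrier G"
  have "(\<Oplus>\<^bsub>T\<^esub>g\<in>carrier G. pure_tensor A G (x g) g) h = (\<Oplus>\<^bsub>A\<^esub>g\<in>carrier G. if h = g then x g else \<zero>\<^bsub>A\<^esub>)"
    using x h finite_G by (subst T_finsum) (auto intro!: AR.finsum_cong')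
  then show "(\<Oplus>\<^bsub>T\<^esub>g\<in>carrier G. pure_tensor A G (x g) g) h = x h"
    using AR.finsum_singleton[OF h finite_G, of x] x by auto
qed (use x in \<open>auto intro!: T.finsum_closed\<close>)

text \<open>Evaluation at \<open>g\<close> is linear over \<open>A\<close> on the left, and on the
  right by the next lemma. It is therefore the coefficient of \<open>u g\<close> for both
  actions.\<close>

lemma base_embedding_mult_apply:
  "\<lbrakk>a \<in> carrier A; x \<in> carrier T; g \<in> carrier G\<rbrakk> \<Longrightarrow> (base_embedding A G a \<otimes>\<^bsub>T\<^esub> x) g = a \<otimes>\<^bsub>A\<^esub> x g"
  unfolding base_embedding_def by (simp add: pure_tensor_mult)

lemma mult_base_embedding_apply:
  "\<lbrakk>a \<in> carrier A; x \<in> carrier T; g \<in> carrier G\<rbrakk> \<Longrightarrow> (x \<otimes>\<^bsub>T\<^esub> base_embedding A G a) g = x g \<otimes>\<^bsub>A\<^esub> a"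
  unfolding base_embedding_def by (simp add: mult_pure_tensor)

lemma base_embedding_closed [simp]: "a \<in> carrier A \<Longrightarrow> base_embedding A G a \<in> carrier T"
  by (simp add: base_embedding_def)

lemma ring_extension_base: "ring_extension A T (base_embedding A G)"
  unfolding ring_extension_def
proof (intro conjI AR.ring_axioms ring_T ring_hom_memI inj_onI)
  fix a b assume ab: "a \<in> carrier A" "b \<in> carrier A"
  show "base_embedding A G (a \<otimes>\<^bsub>A\<^esub> b) = base_embedding A G a \<otimes>\<^bsub>T\<^esub> base_embedding A G b"
    using ab by (intro T_eqI T.m_closed) (auto simp: pure_tensor_mult base_embedding_def)
  show "base_embedding A G (a \<oplus>\<^bsub>A\<^esub> b) = base_embedding A G a \<oplus>\<^bsub>T\<^esub> base_embedding A G b"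
    using ab by (intro T_eqI T.a_closed) (auto simp: base_embedding_def)
  show "a = b" if "base_embedding A G a = base_embedding A G b"
    using fun_cong[OF that, of "\<one>\<^bsub>G\<^esub>"] by (simp add: base_embedding_def)
qed (auto simp: base_embedding_def T_one)

end

section \<open>Ring extensions as modules\<close>

lemma left_module_extension:
  assumes "ring_extension R S \<iota>"
  shows "left_module R S (\<lambda>r x. \<iota> r \<otimes>\<^bsub>S\<^esub> x)"
proof -
  interpret R: ring R using assms by (simp add: ring_extension_def)
  interpret S: ring S using assms by (simp add: ring_extension_def)
  have h: "\<iota> \<in> ring_hom R S" using assms by (simp add: ring_extension_def)
  show ?thesis
    by (intro left_module.intro left_module_axioms.intro R.ring_axioms S.abelian_group_axioms)
      (auto simp: ring_hom_closed[OF h] ring_hom_add[OF h] ring_hom_mult[OF h] ring_hom_one[OF h]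
        S.l_distr S.r_distr S.m_assoc)
qed

lemma right_module_extension:
  assumes "ring_extension R S \<iota>"
  shows "right_module R S (\<lambda>x r. x \<otimes>\<^bsub>S\<^esub> \<iota> r)"
proof -
  interpret R: ring R using assms by (simp add: ring_extension_def)
  interpret S: ring S using assms by (simp add: ring_extension_def)
  have h: "\<iota> \<in> ring_hom R S" using assms by (simp add: ring_extension_def)
  show ?thesis
    by (intro right_module.intro right_module_axioms.intro R.ring_axioms S.abelian_group_axioms)
      (auto simp: ring_hom_closed[OF h] ring_hom_add[OF h] ring_hom_mult[OF h] ring_hom_one[OF h]
        S.l_distr S.r_distr S.m_assoc)
qed

context twisted_algebra
begin

lemma faithfully_flat_base: "faithfully_flat_extension TYPE('t) A T (base_embedding A G)"
  unfolding faithfully_flat_extension_def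
proof (intro conjI ring_extension_base)
  have ne: "carrier G \<noteq> {}" using G.one_closed by blast
  have "faithfully_flat_left TYPE('t) A T (\<lambda>r x. base_embedding A G r \<otimes>\<^bsub>T\<^esub> x)"
    by (rule faithfully_flat_leftI[OF left_module_extension[OF ring_extension_base] finite_G ne,
          where e = u and \<kappa> = "\<lambda>g x. x g"])
      (auto simp: base_embedding_mult_u base_embedding_mult_apply sum_pure_tensor Pi_iff cong: T.finsum_cong)
  then show "faithfully_flat_left TYPE('t) A T (\<lambda>r. (\<otimes>\<^bsub>T\<^esub>) (base_embedding A G r))" .
  show "faithfully_flat_right TYPE('t) A T (\<lambda>x r. x \<otimes>\<^bsub>T\<^esub> base_embedding A G r)"
    by (rule faithfully_flat_rightI[OF right_module_extension[OF ring_extension_base] finite_G ne,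
          where e = u and \<kappa> = "\<lambda>g x. x g"])
      (auto simp: u_mult_base_embedding mult_base_embedding_apply sum_pure_tensor Pi_iff cong: T.finsum_cong)
qed

end

section \<open>The grading and the cocycle twist\<close>

locale cocycle_twist_data = self_dual_group K G \<chi> + twisted_algebra K G A \<mu>
  for K :: "('k, 'x) ring_scheme" and G :: "('g, 'z) monoid_scheme" and \<chi>
    and A :: "('k, 'a, 'y) module_scheme" and \<mu> +
  fixes act :: "'g \<Rightarrow> 'a \<Rightarrow> 'a"
  assumes act: "acts_by_alg_auts K A G act"
begin

lemma act_hom:
  assumes "g \<in> carrier G"
  shows "act g \<in> ring_hom A A" and "\<lbrakk>c \<in> carrier K; a \<in> carrier A\<rbrakk> \<Longrightarrow> act g (c \<odot>\<^bsub>A\<^esub> a) = c \<odot>\<^bsub>A\<^esub> act g a"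
  using act assms by (auto simp: acts_by_alg_auts_def alg_auts_def ring_iso_def)

lemma act_closed [simp]: "\<lbrakk>g \<in> carrier G; a \<in> carrier A\<rbrakk> \<Longrightarrow> act g a \<in> carrier A"
  using ring_hom_closed[OF act_hom(1)] .

lemma act_add: "\<lbrakk>g \<in> carrier G; a \<in> carrier A; b \<in> carrier A\<rbrakk> \<Longrightarrow> act g (a \<oplus>\<^bsub>A\<^esub> b) = act g a \<oplus>\<^bsub>A\<^esub> act g b"
  using ring_hom_add[OF act_hom(1)] .

lemma act_mult: "\<lbrakk>g \<in> carrier G; a \<in> carrier A; b \<in> carrier A\<rbrakk> \<Longrightarrow> act g (a \<otimes>\<^bsub>A\<^esub> b) = act g a \<otimes>\<^bsub>A\<^esub> act g b"
  using ring_hom_mult[OF act_hom(1)] .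

lemma act_one: "g \<in> carrier G \<Longrightarrow> act g \<one>\<^bsub>A\<^esub> = \<one>\<^bsub>A\<^esub>"
  using ring_hom_one[OF act_hom(1)] .

lemma act_group_action: "group_action G (carrier A) act"
  using act by (simp add: acts_by_alg_auts_def)

lemma act_act: "\<lbrakk>g \<in> carrier G; h \<in> carrier G; a \<in> carrier A\<rbrakk> \<Longrightarrow> act g (act h a) = act (g \<otimes>\<^bsub>G\<^esub> h) a"
  using group_action.composition_rule[OF act_group_action] by simp

lemma act_id: "a \<in> carrier A \<Longrightarrow> act \<one>\<^bsub>G\<^esub> a = a"
  using fun_cong[OF group_action.id_eq_one[OF act_group_action], of a] by simp

lemma act_finsum:
  assumes "g \<in> carrier G" "finite I" "f \<in> I \<rightarrow> carrier A"
  shows "act g (\<Oplus>\<^bsub>A\<^esub>i\<in>I. f i) = (\<Oplus>\<^bsub>A\<^esub>i\<in>I. act g (f i))"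
  using assms(2,3)
proof induction
  case empty
  have "act g \<zero>\<^bsub>A\<^esub> \<oplus>\<^bsub>A\<^esub> act g \<zero>\<^bsub>A\<^esub> = act g \<zero>\<^bsub>A\<^esub>"
    using act_add[of g "\<zero>\<^bsub>A\<^esub>" "\<zero>\<^bsub>A\<^esub>"] assms(1) by simp
  then show ?case using assms(1) by simp
next
  case (insert i I)
  then show ?case using assms(1)
    by (simp add: AR.finsum_insert act_add AR.finsum_closed Pi_iff)
qed

section \<open>Projections to the homogeneous parts\<close>

definition proj :: "'g \<Rightarrow> 'a \<Rightarrow> 'a" where
  "proj g a = inv\<^bsub>K\<^esub> ord_G \<odot>\<^bsub>A\<^esub> (\<Oplus>\<^bsub>A\<^esub>h\<in>carrier G. \<chi> g h \<odot>\<^bsub>A\<^esub> act h a)"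

abbreviation part :: "'g \<Rightarrow> 'a set" where "part \<equiv> graded_part A G act \<chi>"

lemma part_closed: "a \<in> part g \<Longrightarrow> a \<in> carrier A"
  by (simp add: graded_part_def)

lemma ord_G_closed: "ord_G \<in> carrier K" "inv\<^bsub>K\<^esub> ord_G \<in> carrier K"
  using ord_G_unit by auto

lemma proj_closed [simp]: "\<lbrakk>g \<in> carrier G; a \<in> carrier A\<rbrakk> \<Longrightarrow> proj g a \<in> carrier A"
  unfolding proj_def using ord_G_closed by (auto intro!: A.smult_closed AR.finsum_closed)

lemma proj_add:
  assumes "g \<in> carrier G" "a \<in> carrier A" "b \<in> carrier A"
  shows "proj g (a \<oplus>\<^bsub>A\<^esub> b) = proj g a \<oplus>\<^bsub>A\<^esub> proj g b"
proof -
  have "(\<Oplus>\<^bsub>A\<^esub>h\<in>carrier G. \<chi> g h \<odot>\<^bsub>A\<^esub> act h (a \<oplus>\<^bsub>A\<^esub> b)) =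
      (\<Oplus>\<^bsub>A\<^esub>h\<in>carrier G. \<chi> g h \<odot>\<^bsub>A\<^esub> act h a \<oplus>\<^bsub>A\<^esub> \<chi> g h \<odot>\<^bsub>A\<^esub> act h b)"
    using assms by (intro AR.finsum_cong') (auto simp: act_add A.smult_r_distr)
  also have "\<dots> = (\<Oplus>\<^bsub>A\<^esub>h\<in>carrier G. \<chi> g h \<odot>\<^bsub>A\<^esub> act h a) \<oplus>\<^bsub>A\<^esub> (\<Oplus>\<^bsub>A\<^esub>h\<in>carrier G. \<chi> g h \<odot>\<^bsub>A\<^esub> act h b)"
    using assms by (intro AR.finsum_addf) auto
  finally show ?thesis unfolding proj_def
    using assms ord_G_closed by (simp add: A.smult_r_distr AR.finsum_closed)
qed

lemma proj_smult:
  assumes g: "g \<in> carrier G" and c: "c \<in> carrier K" and a: "a \<in> carrier A"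
  shows "proj g (c \<odot>\<^bsub>A\<^esub> a) = c \<odot>\<^bsub>A\<^esub> proj g a"
proof -
  have "(\<Oplus>\<^bsub>A\<^esub>h\<in>carrier G. \<chi> g h \<odot>\<^bsub>A\<^esub> act h (c \<odot>\<^bsub>A\<^esub> a)) = (\<Oplus>\<^bsub>A\<^esub>h\<in>carrier G. c \<odot>\<^bsub>A\<^esub> (\<chi> g h \<odot>\<^bsub>A\<^esub> act h a))"
    using assms by (intro AR.finsum_cong') (auto simp: act_hom(2) A.smult_assoc1[symmetric] K.m_comm)
  also have "\<dots> = c \<odot>\<^bsub>A\<^esub> (\<Oplus>\<^bsub>A\<^esub>h\<in>carrier G. \<chi> g h \<odot>\<^bsub>A\<^esub> act h a)"
    using assms finite_G by (intro A.finsum_smult_ldistr[symmetric]) auto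
  finally show ?thesis unfolding proj_def
    using assms ord_G_closed by (simp add: AR.finsum_closed A.smult_assoc1[symmetric] K.m_comm)
qed

lemma proj_zero [simp]: "g \<in> carrier G \<Longrightarrow> proj g \<zero>\<^bsub>A\<^esub> = \<zero>\<^bsub>A\<^esub>"
  using proj_add[of g "\<zero>\<^bsub>A\<^esub>" "\<zero>\<^bsub>A\<^esub>"] proj_closed[of g "\<zero>\<^bsub>A\<^esub>"] by simp

lemma proj_finsum:
  assumes "g \<in> carrier G" "finite I" "f \<in> I \<rightarrow> carrier A"
  shows "proj g (\<Oplus>\<^bsub>A\<^esub>i\<in>I. f i) = (\<Oplus>\<^bsub>A\<^esub>i\<in>I. proj g (f i))"
  using assms(2,3)
  by induction (auto simp: assms(1) proj_add AR.finsum_insert AR.finsum_closed Pi_iff)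

lemma finsum_scalars_smult:
  assumes "finite I" "f \<in> I \<rightarrow> carrier K" "a \<in> carrier A"
  shows "(\<Oplus>\<^bsub>K\<^esub>i\<in>I. f i) \<odot>\<^bsub>A\<^esub> a = (\<Oplus>\<^bsub>A\<^esub>i\<in>I. f i \<odot>\<^bsub>A\<^esub> a)"
  using assms(1,2)
  by induction (auto simp: assms(3) A.smult_l_distr K.finsum_insert AR.finsum_insert K.finsum_closed Pi_iff)

text \<open>Acting by \<open>x\<close> translates the average. Substituting
  \<open>x\<^sup>-\<^sup>1 h\<close> for \<open>h\<close> brings out the value of
  \<open>\<chi> g\<close> at \<open>x\<^sup>-\<^sup>1\<close>, which by \<open>\<chi>_inv\<close> is
  the eigenvalue that \<open>graded_part\<close> asks for.\<close>

lemma proj_part: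
  assumes g: "g \<in> carrier G" and a: "a \<in> carrier A"
  shows "proj g a \<in> part g"
proof -
  have "act x (proj g a) = \<chi> (inv\<^bsub>G\<^esub> g) x \<odot>\<^bsub>A\<^esub> proj g a" if x: "x \<in> carrier G" for x
  proof -
    let ?f = "\<lambda>h. \<chi> g (inv\<^bsub>G\<^esub> x \<otimes>\<^bsub>G\<^esub> h) \<odot>\<^bsub>A\<^esub> act h a"
    have "act x (\<Oplus>\<^bsub>A\<^esub>h\<in>carrier G. \<chi> g h \<odot>\<^bsub>A\<^esub> act h a) = (\<Oplus>\<^bsub>A\<^esub>h\<in>carrier G. ?f (x \<otimes>\<^bsub>G\<^esub> h))"
      using g a x finite_G
      by (subst act_finsum) (auto intro!: AR.finsum_cong' simp: act_hom(2) act_act G.m_assoc[symmetric])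
    also have "\<dots> = (\<Oplus>\<^bsub>A\<^esub>h\<in>(\<lambda>h. x \<otimes>\<^bsub>G\<^esub> h) ` carrier G. ?f h)"
      using g a x G.inj_on_cmult[OF x] by (intro AR.finsum_reindex[symmetric]) auto
    also have "\<dots> = (\<Oplus>\<^bsub>A\<^esub>h\<in>carrier G. \<chi> (inv\<^bsub>G\<^esub> g) x \<odot>\<^bsub>A\<^esub> (\<chi> g h \<odot>\<^bsub>A\<^esub> act h a))"
      unfolding G.surj_const_mult[OF x] using g a x
      by (intro AR.finsum_cong') (auto simp: \<chi>_mult_right \<chi>_inv A.smult_assoc1)
    also have "\<dots> = \<chi> (inv\<^bsub>G\<^esub> g) x \<odot>\<^bsub>A\<^esub> (\<Oplus>\<^bsub>A\<^esub>h\<in>carrier G. \<chi> g h \<odot>\<^bsub>A\<^esub> act h a)"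
      using g a x finite_G by (intro A.finsum_smult_ldistr[symmetric]) auto
    finally show ?thesis unfolding proj_def
      using g a x ord_G_closed by (simp add: act_hom(2) AR.finsum_closed A.smult_assoc1[symmetric] K.m_comm)
  qed
  then show ?thesis using assms by (simp add: graded_part_def)
qed

text \<open>On an element of degree \<open>h\<close> the average reduces to a scalar, the sum of the
  values of the character of \<open>g h\<^sup>-\<^sup>1\<close>, and row orthogonality
  applies.\<close>

lemma proj_of_part:
  assumes g: "g \<in> carrier G" and h: "h \<in> carrier G" and a: "a \<in> part h"
  shows "proj g a = (if g = h then a else \<zero>\<^bsub>A\<^esub>)"
proof -
  have aA: "a \<in> carrier A" using a part_closed by blast
  have "(\<Oplus>\<^bsub>A\<^esub>x\<in>carrier G. \<chi> g x \<odot>\<^bsub>A\<^esub> act x a) = (\<Oplus>\<^bsub>A\<^esub>x\<in>carrier G. \<chi> (g \<otimes>\<^bsub>G\<^esub> inv\<^bsub>G\<^esub> h) x \<odot>\<^bsub>A\<^esub> a)"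
    using a aA g h
    by (intro AR.finsum_cong') (auto simp: graded_part_def \<chi>_mult_left A.smult_assoc1)
  also have "\<dots> = (\<Oplus>\<^bsub>K\<^esub>x\<in>carrier G. \<chi> (g \<otimes>\<^bsub>G\<^esub> inv\<^bsub>G\<^esub> h) x) \<odot>\<^bsub>A\<^esub> a"
    using g h aA finite_G by (intro finsum_scalars_smult[symmetric]) auto
  also have "\<dots> = (if g = h then ord_G else \<zero>\<^bsub>K\<^esub>) \<odot>\<^bsub>A\<^esub> a"
  proof -
    have "g \<otimes>\<^bsub>G\<^esub> inv\<^bsub>G\<^esub> h = \<one>\<^bsub>G\<^esub> \<longleftrightarrow> g = h"
      using g h by (metis G.inv_solve_right G.l_one G.one_closed)
    then show ?thesis using row_orthogonality[of "g \<otimes>\<^bsub>G\<^esub> inv\<^bsub>G\<^esub> h"] g h by simp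
  qed
  finally show ?thesis unfolding proj_def
    using aA ord_G_unit ord_G_closed by (simp add: A.smult_assoc1[symmetric])
qed

lemma proj_proj: "\<lbrakk>g \<in> carrier G; h \<in> carrier G; a \<in> carrier A\<rbrakk> \<Longrightarrow>
    proj g (proj h a) = (if g = h then proj h a else \<zero>\<^bsub>A\<^esub>)"
  using proj_of_part proj_part by blast

text \<open>After the two sums are exchanged, column orthogonality leaves only the term of the
  identity, where the order of the group cancels.\<close>

lemma sum_proj:
  assumes a: "a \<in> carrier A"
  shows "(\<Oplus>\<^bsub>A\<^esub>g\<in>carrier G. proj g a) = a"
proof -
  have "(\<Oplus>\<^bsub>A\<^esub>g\<in>carrier G. proj g a) =
      inv\<^bsub>K\<^esub> ord_G \<odot>\<^bsub>A\<^esub> (\<Oplus>\<^bsub>A\<^esub>g\<in>carrier G. \<Oplus>\<^bsub>A\<^esub>h\<in>carrier G. \<chi> g h \<odot>\<^bsub>A\<^esub> act h a)"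
    unfolding proj_def using a ord_G_closed finite_G
    by (intro A.finsum_smult_ldistr[symmetric]) (auto intro!: AR.finsum_closed)
  also have "(\<Oplus>\<^bsub>A\<^esub>g\<in>carrier G. \<Oplus>\<^bsub>A\<^esub>h\<in>carrier G. \<chi> g h \<odot>\<^bsub>A\<^esub> act h a) =
      (\<Oplus>\<^bsub>A\<^esub>h\<in>carrier G. \<Oplus>\<^bsub>A\<^esub>g\<in>carrier G. \<chi> g h \<odot>\<^bsub>A\<^esub> act h a)"
    using a by (intro AR.finsum_swap finite_G) auto
  also have "\<dots> = (\<Oplus>\<^bsub>A\<^esub>h\<in>carrier G. if \<one>\<^bsub>G\<^esub> = h then ord_G \<odot>\<^bsub>A\<^esub> act h a else \<zero>\<^bsub>A\<^esub>)"
  proof (intro AR.finsum_cong' refl)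
    fix h assume h: "h \<in> carrier G"
    have "(\<Oplus>\<^bsub>A\<^esub>g\<in>carrier G. \<chi> g h \<odot>\<^bsub>A\<^esub> act h a) = (\<Oplus>\<^bsub>K\<^esub>g\<in>carrier G. \<chi> g h) \<odot>\<^bsub>A\<^esub> act h a"
      using h a finite_G by (intro finsum_scalars_smult[symmetric]) auto
    then show "(\<Oplus>\<^bsub>A\<^esub>g\<in>carrier G. \<chi> g h \<odot>\<^bsub>A\<^esub> act h a) = (if \<one>\<^bsub>G\<^esub> = h then ord_G \<odot>\<^bsub>A\<^esub> act h a else \<zero>\<^bsub>A\<^esub>)"
      using column_orthogonality[OF h] h a by auto
  qed (use a ord_G_closed in auto)
  also have "\<dots> = ord_G \<odot>\<^bsub>A\<^esub> act \<one>\<^bsub>G\<^esub> a"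
    using a ord_G_closed by (intro AR.finsum_singleton finite_G) auto
  finally show ?thesis
    using a ord_G_closed ord_G_unit by (simp add: act_id A.smult_assoc1[symmetric])
qed

text \<open>An element is the sum of its projections, so later identities in \<open>A\<close> can be
  checked degree by degree.\<close>

lemma proj_eqI:
  assumes "a \<in> carrier A" "b \<in> carrier A" "\<And>g. g \<in> carrier G \<Longrightarrow> proj g a = proj g b"
  shows "a = b"
proof -
  have "(\<Oplus>\<^bsub>A\<^esub>g\<in>carrier G. proj g a) = (\<Oplus>\<^bsub>A\<^esub>g\<in>carrier G. proj g b)"
    using assms by (intro AR.finsum_cong') auto
  then show ?thesis using assms sum_proj by simp
qed

text \<open>The maps \<open>\<phi>\<close>, \<open>\<psi>\<close> and \<open>\<kappa>\<close> below
  are sums of rescaled homogeneous parts; this reads off one of the parts.\<close>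

lemma proj_sum_parts:
  assumes f: "\<And>k. k \<in> carrier G \<Longrightarrow> f k \<in> carrier A" and c: "\<And>k. k \<in> carrier G \<Longrightarrow> c k \<in> carrier K"
    and g: "g \<in> carrier G"
  shows "proj g (\<Oplus>\<^bsub>A\<^esub>k\<in>carrier G. c k \<odot>\<^bsub>A\<^esub> proj k (f k)) = c g \<odot>\<^bsub>A\<^esub> proj g (f g)"
proof -
  have "proj g (\<Oplus>\<^bsub>A\<^esub>k\<in>carrier G. c k \<odot>\<^bsub>A\<^esub> proj k (f k)) = (\<Oplus>\<^bsub>A\<^esub>k\<in>carrier G. proj g (c k \<odot>\<^bsub>A\<^esub> proj k (f k)))"
    using f c g by (intro proj_finsum finite_G) auto
  also have "\<dots> = (\<Oplus>\<^bsub>A\<^esub>k\<in>carrier G. if g = k then c k \<odot>\<^bsub>A\<^esub> proj k (f k) else \<zero>\<^bsub>A\<^esub>)"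
    using f c g by (intro AR.finsum_cong') (auto simp: proj_smult proj_proj)
  also have "\<dots> = c g \<odot>\<^bsub>A\<^esub> proj g (f g)" using f c by (intro AR.finsum_singleton g finite_G) auto
  finally show ?thesis .
qed

text \<open>The definite description in \<open>graded_comp\<close> denotes: \<open>sum_proj\<close>
  gives a decomposition, and applying \<open>proj g\<close> to the sum of any homogeneous
  decomposition returns its member at \<open>g\<close>.\<close>

lemma graded_comp_eq:
  assumes a: "a \<in> carrier A"
  shows "graded_comp A G act \<chi> a = (\<lambda>g\<in>carrier G. proj g a)"
  unfolding graded_comp_def
proof (rule the_equality)
  have "(\<Oplus>\<^bsub>A\<^esub>g\<in>carrier G. (\<lambda>g\<in>carrier G. proj g a) g) = (\<Oplus>\<^bsub>A\<^esub>g\<in>carrier G. proj g a)"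
    using a by (intro AR.finsum_cong') auto
  moreover have "(\<lambda>g\<in>carrier G. proj g a) \<in> (\<Pi>\<^sub>E g\<in>carrier G. part g)" using a proj_part by auto
  ultimately show "(\<lambda>g\<in>carrier G. proj g a) \<in> (\<Pi>\<^sub>E g\<in>carrier G. part g) \<and>
      (\<Oplus>\<^bsub>A\<^esub>g\<in>carrier G. (\<lambda>g\<in>carrier G. proj g a) g) = a"
    unfolding sum_proj[OF a] by (intro conjI)
next
  fix f assume f: "f \<in> (\<Pi>\<^sub>E g\<in>carrier G. part g) \<and> (\<Oplus>\<^bsub>A\<^esub>g\<in>carrier G. f g) = a"
  then have fp: "f g \<in> part g" if "g \<in> carrier G" for g using that by auto
  have fc: "f g \<in> carrier A" if "g \<in> carrier G" for g using fp[OF that] part_closed by blast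
  show "f = (\<lambda>g\<in>carrier G. proj g a)"
  proof (rule extensionalityI[of _ "carrier G"])
    fix g assume g: "g \<in> carrier G"
    have "proj g (\<Oplus>\<^bsub>A\<^esub>h\<in>carrier G. f h) = (\<Oplus>\<^bsub>A\<^esub>h\<in>carrier G. proj g (f h))"
      using fc g by (intro proj_finsum finite_G) auto
    also have "\<dots> = (\<Oplus>\<^bsub>A\<^esub>h\<in>carrier G. if g = h then f h else \<zero>\<^bsub>A\<^esub>)"
      using fp fc g by (intro AR.finsum_cong') (auto simp: proj_of_part)
    also have "\<dots> = f g" using fc by (intro AR.finsum_singleton g finite_G) auto
    finally show "f g = (\<lambda>g\<in>carrier G. proj g a) g" using f g by simp
  qed (use f in \<open>auto simp: PiE_def\<close>)
qed

text \<open>Automorphisms send a product of eigenvectors to the product of the eigenvalues times it,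
  and \<open>\<chi>\<close> takes products of degrees to products of eigenvalues.\<close>

lemma part_mult:
  assumes g: "g \<in> carrier G" and h: "h \<in> carrier G" and a: "a \<in> part g" and b: "b \<in> part h"
  shows "a \<otimes>\<^bsub>A\<^esub> b \<in> part (g \<otimes>\<^bsub>G\<^esub> h)"
proof -
  have "act x (a \<otimes>\<^bsub>A\<^esub> b) = \<chi> (inv\<^bsub>G\<^esub> (g \<otimes>\<^bsub>G\<^esub> h)) x \<odot>\<^bsub>A\<^esub> (a \<otimes>\<^bsub>A\<^esub> b)" if x: "x \<in> carrier G" for x
    using g h a b x
    by (simp add: graded_part_def act_mult A.smult_mult_left A.smult_mult_right G.inv_mult \<chi>_mult_left A.smult_assoc1[symmetric] K.m_comm)
  then show ?thesis using a b by (simp add: graded_part_def)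
qed

lemma proj_mult:
  "\<lbrakk>g \<in> carrier G; h \<in> carrier G; l \<in> carrier G; a \<in> carrier A; b \<in> carrier A\<rbrakk> \<Longrightarrow>
    proj l (proj g a \<otimes>\<^bsub>A\<^esub> proj h b) = (if l = g \<otimes>\<^bsub>G\<^esub> h then proj g a \<otimes>\<^bsub>A\<^esub> proj h b else \<zero>\<^bsub>A\<^esub>)"
  using proj_of_part[of l "g \<otimes>\<^bsub>G\<^esub> h"] part_mult[of g h] proj_part by simp

lemma proj_one: "g \<in> carrier G \<Longrightarrow> proj g \<one>\<^bsub>A\<^esub> = (if g = \<one>\<^bsub>G\<^esub> then \<one>\<^bsub>A\<^esub> else \<zero>\<^bsub>A\<^esub>)"
  by (intro proj_of_part) (auto simp: graded_part_def act_one \<chi>_one_left)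

section \<open>The twist as a ring and its embedding\<close>

abbreviation B :: "('k, 'a) module" where "B \<equiv> cocycle_twist A G act \<chi> \<mu>"
abbreviation \<iota> :: "'a \<Rightarrow> 'g \<Rightarrow> 'a" where "\<iota> \<equiv> twist_embedding A G act \<chi>"

lemma B_simps [simp]:
  "carrier B = carrier A" "\<one>\<^bsub>B\<^esub> = \<one>\<^bsub>A\<^esub>" "\<zero>\<^bsub>B\<^esub> = \<zero>\<^bsub>A\<^esub>" "(\<oplus>\<^bsub>B\<^esub>) = (\<oplus>\<^bsub>A\<^esub>)" "(\<odot>\<^bsub>B\<^esub>) = (\<odot>\<^bsub>A\<^esub>)"
  by (simp_all add: cocycle_twist_def)

lemma B_mult:
  assumes "a \<in> carrier A" "b \<in> carrier A"
  shows "a \<otimes>\<^bsub>B\<^esub> b = (\<Oplus>\<^bsub>A\<^esub>p\<in>carrier G \<times> carrier G.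
      \<mu> (fst p) (snd p) \<odot>\<^bsub>A\<^esub> (proj (fst p) a \<otimes>\<^bsub>A\<^esub> proj (snd p) b))"
  using assms by (auto simp: cocycle_twist_def graded_comp_eq intro!: AR.finsum_cong')

lemma B_mult_closed: "\<lbrakk>a \<in> carrier A; b \<in> carrier A\<rbrakk> \<Longrightarrow> a \<otimes>\<^bsub>B\<^esub> b \<in> carrier A"
  by (auto simp: B_mult intro!: AR.finsum_closed)

lemma \<iota>_apply [simp]: "\<lbrakk>a \<in> carrier A; g \<in> carrier G\<rbrakk> \<Longrightarrow> \<iota> a g = proj g a"
  by (simp add: twist_embedding_def graded_comp_eq)

lemma \<iota>_closed [simp]: "a \<in> carrier A \<Longrightarrow> \<iota> a \<in> carrier T"
  by (auto simp: carrier_T twist_embedding_def graded_comp_eq)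

lemma \<iota>_inj: "\<lbrakk>\<iota> a = \<iota> b; a \<in> carrier A; b \<in> carrier A\<rbrakk> \<Longrightarrow> a = b"
  by (rule proj_eqI) (simp_all flip: \<iota>_apply)

lemma \<iota>_add: "\<lbrakk>a \<in> carrier A; b \<in> carrier A\<rbrakk> \<Longrightarrow> \<iota> (a \<oplus>\<^bsub>A\<^esub> b) = \<iota> a \<oplus>\<^bsub>T\<^esub> \<iota> b"
  by (intro T_eqI T.a_closed) (auto simp: proj_add)

lemma \<iota>_one: "\<iota> \<one>\<^bsub>A\<^esub> = \<one>\<^bsub>T\<^esub>"
  by (intro T_eqI) (auto simp: proj_one T_one)

text \<open>The term indexed by a pair of degrees is homogeneous of their product. Projecting to
  degree \<open>l\<close> thus keeps exactly the pairs over which the product of the twisted group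
  algebra sums at \<open>l\<close>.\<close>

lemma \<iota>_mult:
  assumes a: "a \<in> carrier A" and b: "b \<in> carrier A"
  shows "\<iota> (a \<otimes>\<^bsub>B\<^esub> b) = \<iota> a \<otimes>\<^bsub>T\<^esub> \<iota> b"
proof (rule T_eqI)
  fix l assume l: "l \<in> carrier G"
  let ?f = "\<lambda>p. \<mu> (fst p) (snd p) \<odot>\<^bsub>A\<^esub> (proj (fst p) a \<otimes>\<^bsub>A\<^esub> proj (snd p) b)"
  let ?S = "{p \<in> carrier G \<times> carrier G. fst p \<otimes>\<^bsub>G\<^esub> snd p = l}"
  have "\<iota> (a \<otimes>\<^bsub>B\<^esub> b) l = proj l (\<Oplus>\<^bsub>A\<^esub>p\<in>carrier G \<times> carrier G. ?f p)"
    using a b l by (simp add: B_mult_closed B_mult[symmetric])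
  also have "\<dots> = (\<Oplus>\<^bsub>A\<^esub>p\<in>carrier G \<times> carrier G. proj l (?f p))"
    using a b l finite_G by (intro proj_finsum) auto
  also have "\<dots> = (\<Oplus>\<^bsub>A\<^esub>p\<in>?S. ?f p)"
    using a b l finite_G
    by (intro AR.add.finprod_mono_neutral_cong_right) (auto simp: proj_smult proj_mult)
  also have "\<dots> = (\<iota> a \<otimes>\<^bsub>T\<^esub> \<iota> b) l"
    unfolding T_mult_filter[OF l] using a b by (intro AR.finsum_cong') auto
  finally show "\<iota> (a \<otimes>\<^bsub>B\<^esub> b) l = (\<iota> a \<otimes>\<^bsub>T\<^esub> \<iota> b) l" .
qed (use a b in \<open>auto simp: B_mult_closed\<close>)

text \<open>Each law holds for the images in the twisted group algebra, and \<open>\<iota>\<close>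
  is injective and compatible with the operations.\<close>

lemma ring_B: "ring B"
proof (rule ringI)
  show "abelian_group B"
    by (rule abelian_groupI) (auto simp: AR.a_ac intro!: bexI[of _ "\<ominus>\<^bsub>A\<^esub> _"] AR.l_neg)
  show "monoid B"
  proof (rule monoidI)
    fix a b c assume abc: "a \<in> carrier B" "b \<in> carrier B" "c \<in> carrier B"
    then show "(a \<otimes>\<^bsub>B\<^esub> b) \<otimes>\<^bsub>B\<^esub> c = a \<otimes>\<^bsub>B\<^esub> (b \<otimes>\<^bsub>B\<^esub> c)"
      by (intro \<iota>_inj) (simp_all add: \<iota>_mult B_mult_closed T.m_assoc)
  next
    fix a assume a: "a \<in> carrier B"
    then show "\<one>\<^bsub>B\<^esub> \<otimes>\<^bsub>B\<^esub> a = a" "a \<otimes>\<^bsub>B\<^esub> \<one>\<^bsub>B\<^esub> = a"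
      by (auto intro!: \<iota>_inj simp: \<iota>_mult B_mult_closed \<iota>_one)
  qed (auto simp: B_mult_closed)
next
  fix a b c assume abc: "a \<in> carrier B" "b \<in> carrier B" "c \<in> carrier B"
  then show "(a \<oplus>\<^bsub>B\<^esub> b) \<otimes>\<^bsub>B\<^esub> c = a \<otimes>\<^bsub>B\<^esub> c \<oplus>\<^bsub>B\<^esub> b \<otimes>\<^bsub>B\<^esub> c"
    by (intro \<iota>_inj) (simp_all add: \<iota>_mult \<iota>_add B_mult_closed T.l_distr)
  show "c \<otimes>\<^bsub>B\<^esub> (a \<oplus>\<^bsub>B\<^esub> b) = c \<otimes>\<^bsub>B\<^esub> a \<oplus>\<^bsub>B\<^esub> c \<otimes>\<^bsub>B\<^esub> b"
    using abc by (intro \<iota>_inj) (simp_all add: \<iota>_mult \<iota>_add B_mult_closed T.r_distr)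
qed

sublocale B: ring B by (rule ring_B)

lemma ring_extension_twist: "ring_extension B T \<iota>"
  unfolding ring_extension_def
  by (intro conjI ring_B ring_T ring_hom_memI inj_onI) (auto simp: \<iota>_mult \<iota>_add \<iota>_one intro: \<iota>_inj)

end

section \<open>Bimodules\<close>

text \<open>The bimodule records leave multiplication and one undefined. Module structures are
  therefore transported to them by agreement of carrier, zero and addition alone.\<close>

lemma abelian_group_cong:
  assumes "abelian_group M" "carrier N = carrier M" "\<zero>\<^bsub>N\<^esub> = \<zero>\<^bsub>M\<^esub>" "(\<oplus>\<^bsub>N\<^esub>) = (\<oplus>\<^bsub>M\<^esub>)"
  shows "abelian_group N"
proof -
  interpret M: abelian_group M by fact
  show ?thesis
    by (rule abelian_groupI) (auto simp: assms(2-4) M.a_ac intro!: bexI[of _ "\<ominus>\<^bsub>M\<^esub> _"] M.l_neg)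
qed

lemma left_module_cong:
  assumes "left_module R M l" "carrier N = carrier M" "\<zero>\<^bsub>N\<^esub> = \<zero>\<^bsub>M\<^esub>" "(\<oplus>\<^bsub>N\<^esub>) = (\<oplus>\<^bsub>M\<^esub>)"
  shows "left_module R N l"
  using assms abelian_group_cong[of M N]
  by (simp add: left_module_def left_module_axioms_def)

lemma right_module_cong:
  assumes "right_module R M r" "carrier N = carrier M" "\<zero>\<^bsub>N\<^esub> = \<zero>\<^bsub>M\<^esub>" "(\<oplus>\<^bsub>N\<^esub>) = (\<oplus>\<^bsub>M\<^esub>)"
  shows "right_module R N r"
  using assms abelian_group_cong[of M N]
  by (simp add: right_module_def right_module_axioms_def)

lemma bimodule_extension:
  assumes "ring_extension R S \<iota>"
  shows "bimodule R R (extension_bimod S \<iota>)"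
proof -
  interpret S: ring S using assms by (simp add: ring_extension_def)
  have h: "\<iota> \<in> ring_hom R S" using assms by (simp add: ring_extension_def)
  show ?thesis unfolding bimodule_def
    using left_module_cong[OF left_module_extension[OF assms], of "extension_bimod S \<iota>"]
      right_module_cong[OF right_module_extension[OF assms], of "extension_bimod S \<iota>"]
    by (simp add: extension_bimod_def S.m_assoc ring_hom_closed[OF h])
qed

lemma left_module_id_twist:
  assumes "ring R"
  shows "left_module R (id_twist_bimod R \<phi>) (lact (id_twist_bimod R \<phi>))"
proof -
  interpret R: ring R by fact
  have "left_module R R (\<lambda>r m. r \<otimes>\<^bsub>R\<^esub> m)"
    by (intro left_module.intro left_module_axioms.intro assms R.abelian_group_axioms)
      (auto simp: R.l_distr R.r_distr R.m_assoc)
  from left_module_cong[OF this, of "id_twist_bimod R \<phi>"] show ?thesis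
    by (simp add: id_twist_bimod_def)
qed

lemma right_module_id_twist:
  assumes "ring R" and \<phi>: "\<phi> \<in> ring_hom R R"
  shows "right_module R (id_twist_bimod R \<phi>) (ract (id_twist_bimod R \<phi>))"
proof -
  interpret R: ring R by fact
  have "right_module R R (\<lambda>m r. m \<otimes>\<^bsub>R\<^esub> \<phi> r)"
    by (intro right_module.intro right_module_axioms.intro assms R.abelian_group_axioms)
      (auto simp: R.l_distr R.r_distr R.m_assoc ring_hom_closed[OF \<phi>] ring_hom_add[OF \<phi>]
        ring_hom_mult[OF \<phi>] ring_hom_one[OF \<phi>])
  from right_module_cong[OF this, of "id_twist_bimod R \<phi>"] show ?thesis
    by (simp add: id_twist_bimod_def)
qed

lemma bimodule_id_twist:
  assumes "ring R" and \<phi>: "\<phi> \<in> ring_hom R R"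
  shows "bimodule R R (id_twist_bimod R \<phi>)"
proof -
  interpret R: ring R by fact
  show ?thesis
    unfolding bimodule_def using left_module_id_twist[OF assms(1), of \<phi>] right_module_id_twist[OF assms]
    by (simp add: id_twist_bimod_def R.m_assoc ring_hom_closed[OF \<phi>])
qed

text \<open>Freeness is defined by sums over the support of \<open>c\<close>, which is empty if the
  only coefficient is zero. The condition on \<open>f\<close> at zero lets both cases give the same
  value.\<close>

lemma finsum_nonzero_singleton:
  assumes "ring R" "abelian_group M" "c \<in> {b} \<rightarrow> carrier R" "f (c b) \<in> carrier M" "f \<zero>\<^bsub>R\<^esub> = \<zero>\<^bsub>M\<^esub>"
  shows "(\<Oplus>\<^bsub>M\<^esub>x\<in>{x \<in> {b}. c x \<noteq> \<zero>\<^bsub>R\<^esub>}. f (c x)) = f (c b)"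
proof -
  interpret M: abelian_group M by fact
  show ?thesis
  proof (cases "c b = \<zero>\<^bsub>R\<^esub>")
    case True
    then have "{x \<in> {b}. c x \<noteq> \<zero>\<^bsub>R\<^esub>} = {}" by auto
    then show ?thesis using True assms(5) by (simp only: M.finsum_empty)
  next
    case False
    then have "{x \<in> {b}. c x \<noteq> \<zero>\<^bsub>R\<^esub>} = {b}" by auto
    moreover have "(\<Oplus>\<^bsub>M\<^esub>x\<in>{b}. f (c x)) = f (c b)"
      using M.finsum_insert[of "{}" b "\<lambda>x. f (c x)"] assms(4) by simp
    ultimately show ?thesis by simp
  qed
qed

text \<open>The identity is a basis: the linear combination with coefficients \<open>c\<close> is
  the value of \<open>c\<close> there.\<close>

lemma free_left_module_id_twist:
  assumes "ring R"
  shows "free_left_module R (id_twist_bimod R \<phi>) (lact (id_twist_bimod R \<phi>))"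
  unfolding free_left_module_def
proof (intro conjI left_module_id_twist[OF assms] exI[of _ "{\<one>\<^bsub>R\<^esub>}"] ballI)
  interpret R: ring R by fact
  let ?M = "id_twist_bimod R \<phi>"
  have M: "abelian_group ?M" using left_moduleD(7)[OF left_module_id_twist[OF assms]] .
  show "{\<one>\<^bsub>R\<^esub>} \<subseteq> carrier ?M" by (simp add: id_twist_bimod_def)
  fix x assume "x \<in> carrier ?M"
  then have x: "x \<in> carrier R" by (simp add: id_twist_bimod_def)
  have sum: "(\<Oplus>\<^bsub>?M\<^esub>b\<in>{b \<in> {\<one>\<^bsub>R\<^esub>}. c b \<noteq> \<zero>\<^bsub>R\<^esub>}. lact ?M (c b) b) = c \<one>\<^bsub>R\<^esub>"
    if c: "c \<in> {\<one>\<^bsub>R\<^esub>} \<rightarrow>\<^sub>E carrier R" for c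
  proof -
    interpret M: abelian_group ?M by fact
    have "c \<one>\<^bsub>R\<^esub> \<in> carrier R" using c by auto
    note [simp] = this
    have "(\<Oplus>\<^bsub>?M\<^esub>b\<in>{b \<in> {\<one>\<^bsub>R\<^esub>}. c b \<noteq> \<zero>\<^bsub>R\<^esub>}. lact ?M (c b) b) =
        (\<Oplus>\<^bsub>?M\<^esub>b\<in>{b \<in> {\<one>\<^bsub>R\<^esub>}. c b \<noteq> \<zero>\<^bsub>R\<^esub>}. c b)"
      using c by (intro M.finsum_cong') (auto simp: id_twist_bimod_def)
    also have "\<dots> = c \<one>\<^bsub>R\<^esub>"
      using c by (intro finsum_nonzero_singleton[OF assms M]) (auto simp: id_twist_bimod_def)
    finally show ?thesis .
  qed
  show "\<exists>!c. c \<in> {\<one>\<^bsub>R\<^esub>} \<rightarrow>\<^sub>E carrier R \<and> finite {b \<in> {\<one>\<^bsub>R\<^esub>}. c b \<noteq> \<zero>\<^bsub>R\<^esub>} \<and>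
      x = (\<Oplus>\<^bsub>?M\<^esub>b\<in>{b \<in> {\<one>\<^bsub>R\<^esub>}. c b \<noteq> \<zero>\<^bsub>R\<^esub>}. lact ?M (c b) b)"
  proof (rule ex1I[of _ "\<lambda>b\<in>{\<one>\<^bsub>R\<^esub>}. x"])
    show "(\<lambda>b\<in>{\<one>\<^bsub>R\<^esub>}. x) \<in> {\<one>\<^bsub>R\<^esub>} \<rightarrow>\<^sub>E carrier R \<and> finite {b \<in> {\<one>\<^bsub>R\<^esub>}. (\<lambda>b\<in>{\<one>\<^bsub>R\<^esub>}. x) b \<noteq> \<zero>\<^bsub>R\<^esub>} \<and>
        x = (\<Oplus>\<^bsub>?M\<^esub>b\<in>{b \<in> {\<one>\<^bsub>R\<^esub>}. (\<lambda>b\<in>{\<one>\<^bsub>R\<^esub>}. x) b \<noteq> \<zero>\<^bsub>R\<^esub>}. lact ?M ((\<lambda>b\<in>{\<one>\<^bsub>R\<^esub>}. x) b) b)"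
      using x by (subst sum) auto
  next
    fix c assume "c \<in> {\<one>\<^bsub>R\<^esub>} \<rightarrow>\<^sub>E carrier R \<and> finite {b \<in> {\<one>\<^bsub>R\<^esub>}. c b \<noteq> \<zero>\<^bsub>R\<^esub>} \<and>
      x = (\<Oplus>\<^bsub>?M\<^esub>b\<in>{b \<in> {\<one>\<^bsub>R\<^esub>}. c b \<noteq> \<zero>\<^bsub>R\<^esub>}. lact ?M (c b) b)"
    then have "c \<in> {\<one>\<^bsub>R\<^esub>} \<rightarrow>\<^sub>E carrier R" "x = c \<one>\<^bsub>R\<^esub>" using sum by auto
    then show "c = (\<lambda>b\<in>{\<one>\<^bsub>R\<^esub>}. x)" by (intro extensionalityI[of _ "{\<one>\<^bsub>R\<^esub>}"]) (auto simp: PiE_def)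
  qed
qed

text \<open>The identity is again a basis, but the combination now evaluates to
  \<open>\<phi>\<close> of the coefficient. Surjectivity of \<open>\<phi>\<close> provides the
  coefficient of \<open>x\<close>, and injectivity its uniqueness.\<close>

lemma free_right_module_id_twist:
  assumes "ring R" and \<phi>: "\<phi> \<in> ring_iso R R"
  shows "free_right_module R (id_twist_bimod R \<phi>) (ract (id_twist_bimod R \<phi>))"
  unfolding free_right_module_def
proof (intro conjI exI[of _ "{\<one>\<^bsub>R\<^esub>}"] ballI)
  interpret R: ring R by fact
  let ?M = "id_twist_bimod R \<phi>"
  have hom: "\<phi> \<in> ring_hom R R" and bij: "bij_betw \<phi> (carrier R) (carrier R)"
    using \<phi> by (auto simp: ring_iso_def)
  show rm: "right_module R ?M (ract ?M)" using right_module_id_twist[OF assms(1) hom] .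
  have M: "abelian_group ?M" using right_moduleD(7)[OF rm] .
  show "{\<one>\<^bsub>R\<^esub>} \<subseteq> carrier ?M" by (simp add: id_twist_bimod_def)
  fix x assume "x \<in> carrier ?M"
  then have x: "x \<in> carrier R" by (simp add: id_twist_bimod_def)
  have zero: "\<phi> \<zero>\<^bsub>R\<^esub> = \<zero>\<^bsub>R\<^esub>" using ring_hom_zero[OF hom assms(1,1)] .
  have sum: "(\<Oplus>\<^bsub>?M\<^esub>b\<in>{b \<in> {\<one>\<^bsub>R\<^esub>}. c b \<noteq> \<zero>\<^bsub>R\<^esub>}. ract ?M b (c b)) = \<phi> (c \<one>\<^bsub>R\<^esub>)"
    if c: "c \<in> {\<one>\<^bsub>R\<^esub>} \<rightarrow>\<^sub>E carrier R" for c
  proof -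
    interpret M: abelian_group ?M by fact
    have "c \<one>\<^bsub>R\<^esub> \<in> carrier R" using c by auto
    note [simp] = this ring_hom_closed[OF hom this]
    have "(\<Oplus>\<^bsub>?M\<^esub>b\<in>{b \<in> {\<one>\<^bsub>R\<^esub>}. c b \<noteq> \<zero>\<^bsub>R\<^esub>}. ract ?M b (c b)) =
        (\<Oplus>\<^bsub>?M\<^esub>b\<in>{b \<in> {\<one>\<^bsub>R\<^esub>}. c b \<noteq> \<zero>\<^bsub>R\<^esub>}. \<phi> (c b))"
      using c by (intro M.finsum_cong') (auto simp: id_twist_bimod_def ring_hom_closed[OF hom])
    also have "\<dots> = \<phi> (c \<one>\<^bsub>R\<^esub>)"
      using c zero by (intro finsum_nonzero_singleton[OF assms(1) M])
        (auto simp: id_twist_bimod_def ring_hom_closed[OF hom])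
    finally show ?thesis .
  qed
  obtain y where y: "y \<in> carrier R" "\<phi> y = x" using bij x unfolding bij_betw_def by (metis imageE)
  show "\<exists>!c. c \<in> {\<one>\<^bsub>R\<^esub>} \<rightarrow>\<^sub>E carrier R \<and> finite {b \<in> {\<one>\<^bsub>R\<^esub>}. c b \<noteq> \<zero>\<^bsub>R\<^esub>} \<and>
      x = (\<Oplus>\<^bsub>?M\<^esub>b\<in>{b \<in> {\<one>\<^bsub>R\<^esub>}. c b \<noteq> \<zero>\<^bsub>R\<^esub>}. ract ?M b (c b))"
  proof (rule ex1I[of _ "\<lambda>b\<in>{\<one>\<^bsub>R\<^esub>}. y"])
    show "(\<lambda>b\<in>{\<one>\<^bsub>R\<^esub>}. y) \<in> {\<one>\<^bsub>R\<^esub>} \<rightarrow>\<^sub>E carrier R \<and> finite {b \<in> {\<one>\<^bsub>R\<^esub>}. (\<lambda>b\<in>{\<one>\<^bsub>R\<^esub>}. y) b \<noteq> \<zero>\<^bsub>R\<^esub>} \<and>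
        x = (\<Oplus>\<^bsub>?M\<^esub>b\<in>{b \<in> {\<one>\<^bsub>R\<^esub>}. (\<lambda>b\<in>{\<one>\<^bsub>R\<^esub>}. y) b \<noteq> \<zero>\<^bsub>R\<^esub>}. ract ?M b ((\<lambda>b\<in>{\<one>\<^bsub>R\<^esub>}. y) b))"
      using y by (subst sum) auto
  next
    fix c assume "c \<in> {\<one>\<^bsub>R\<^esub>} \<rightarrow>\<^sub>E carrier R \<and> finite {b \<in> {\<one>\<^bsub>R\<^esub>}. c b \<noteq> \<zero>\<^bsub>R\<^esub>} \<and>
      x = (\<Oplus>\<^bsub>?M\<^esub>b\<in>{b \<in> {\<one>\<^bsub>R\<^esub>}. c b \<noteq> \<zero>\<^bsub>R\<^esub>}. ract ?M b (c b))"
    then have c: "c \<in> {\<one>\<^bsub>R\<^esub>} \<rightarrow>\<^sub>E carrier R" "\<phi> (c \<one>\<^bsub>R\<^esub>) = \<phi> y" using sum y by auto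
    then have "c \<one>\<^bsub>R\<^esub> = y" using bij y by (auto simp: bij_betw_def inj_on_def)
    then show "c = (\<lambda>b\<in>{\<one>\<^bsub>R\<^esub>}. y)" using c(1) by (intro extensionalityI[of _ "{\<one>\<^bsub>R\<^esub>}"]) (auto simp: PiE_def)
  qed
qed

text \<open>For finite \<open>I\<close> the finite support condition in \<open>sum_group\<close> is
  void, so the carrier is the full product and the axioms hold componentwise.\<close>

lemma bimodule_direct_sum:
  assumes fin: "finite I" and M: "\<And>i. i \<in> I \<Longrightarrow> bimodule R S (M i)" and R: "ring R" and S: "ring S"
  shows "bimodule R S (direct_sum_bimod I M)"
    and "carrier (direct_sum_bimod I M) = (\<Pi>\<^sub>E i\<in>I. carrier (M i))"
proof -
  let ?D = "direct_sum_bimod I M"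
  have lm: "left_module R (M i) (lact (M i))" and rm: "right_module S (M i) (ract (M i))"
    and comm: "\<And>r s x. \<lbrakk>r \<in> carrier R; s \<in> carrier S; x \<in> carrier (M i)\<rbrakk> \<Longrightarrow>
      ract (M i) (lact (M i) r x) s = lact (M i) r (ract (M i) x s)" if "i \<in> I" for i
    using M[OF that] by (auto simp: bimodule_def)
  note L = left_moduleD[OF lm] and Rt = right_moduleD[OF rm]
  have grp: "group (add_monoid (M i))" if "i \<in> I" for i
    using abelian_group.a_group[OF L(7)[OF that]] .
  show carrier: "carrier ?D = (\<Pi>\<^sub>E i\<in>I. carrier (M i))"
    using fin grp by (auto simp: direct_sum_bimod_def carrier_sum_group)
  have add: "(\<oplus>\<^bsub>?D\<^esub>) = (\<lambda>x y. \<lambda>i\<in>I. x i \<oplus>\<^bsub>M i\<^esub> y i)" and zero: "\<zero>\<^bsub>?D\<^esub> = (\<lambda>i\<in>I. \<zero>\<^bsub>M i\<^esub>)"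
    and lact: "lact ?D = (\<lambda>r x. \<lambda>i\<in>I. lact (M i) r (x i))" and ract: "ract ?D = (\<lambda>x s. \<lambda>i\<in>I. ract (M i) (x i) s)"
    by (simp_all add: direct_sum_bimod_def)
  have mem [simp]: "x i \<in> carrier (M i)" if "x \<in> (\<Pi>\<^sub>E i\<in>I. carrier (M i))" "i \<in> I" for x i
    using that by auto
  have D_eqI: "x = y" if "x \<in> (\<Pi>\<^sub>E i\<in>I. carrier (M i))" "y \<in> (\<Pi>\<^sub>E i\<in>I. carrier (M i))"
    "\<And>i. i \<in> I \<Longrightarrow> x i = y i" for x y
    using that by (rule PiE_eqI)
  note ag = L(7)
  \<comment> \<open>The group laws of all summands are collected with \<open>i\<close> as a
    variable, since an interpretation fixes one \<open>i\<close>.\<close>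
  have closed [simp]: "x \<oplus>\<^bsub>M i\<^esub> y \<in> carrier (M i)" "\<zero>\<^bsub>M i\<^esub> \<in> carrier (M i)" "\<ominus>\<^bsub>M i\<^esub> x \<in> carrier (M i)"
    and laws: "(x \<oplus>\<^bsub>M i\<^esub> y) \<oplus>\<^bsub>M i\<^esub> z = x \<oplus>\<^bsub>M i\<^esub> (y \<oplus>\<^bsub>M i\<^esub> z)" "\<zero>\<^bsub>M i\<^esub> \<oplus>\<^bsub>M i\<^esub> x = x" "\<ominus>\<^bsub>M i\<^esub> x \<oplus>\<^bsub>M i\<^esub> x = \<zero>\<^bsub>M i\<^esub>"
    and comm_add: "x \<oplus>\<^bsub>M i\<^esub> y = y \<oplus>\<^bsub>M i\<^esub> x"
    if "i \<in> I" "x \<in> carrier (M i)" "y \<in> carrier (M i)" "z \<in> carrier (M i)" for i x y z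
  proof -
    interpret Mi: abelian_group "M i" using ag[OF that(1)] .
    show "x \<oplus>\<^bsub>M i\<^esub> y \<in> carrier (M i)" "\<zero>\<^bsub>M i\<^esub> \<in> carrier (M i)" "\<ominus>\<^bsub>M i\<^esub> x \<in> carrier (M i)"
      "(x \<oplus>\<^bsub>M i\<^esub> y) \<oplus>\<^bsub>M i\<^esub> z = x \<oplus>\<^bsub>M i\<^esub> (y \<oplus>\<^bsub>M i\<^esub> z)" "\<zero>\<^bsub>M i\<^esub> \<oplus>\<^bsub>M i\<^esub> x = x" "\<ominus>\<^bsub>M i\<^esub> x \<oplus>\<^bsub>M i\<^esub> x = \<zero>\<^bsub>M i\<^esub>"
      "x \<oplus>\<^bsub>M i\<^esub> y = y \<oplus>\<^bsub>M i\<^esub> x"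
      using that(2-4) by (blast intro: Mi.a_assoc Mi.l_neg Mi.a_comm Mi.l_zero Mi.a_closed Mi.zero_closed Mi.a_inv_closed)+
  qed
  have D: "abelian_group ?D"
  proof (rule abelian_groupI, unfold carrier add zero)
    fix x y z assume xyz: "x \<in> (\<Pi>\<^sub>E i\<in>I. carrier (M i))" "y \<in> (\<Pi>\<^sub>E i\<in>I. carrier (M i))" "z \<in> (\<Pi>\<^sub>E i\<in>I. carrier (M i))"
    show "(\<lambda>i\<in>I. x i \<oplus>\<^bsub>M i\<^esub> y i) \<in> (\<Pi>\<^sub>E i\<in>I. carrier (M i))"
      using xyz by (auto intro!: closed(1))
    show "(\<lambda>i\<in>I. (\<lambda>i\<in>I. x i \<oplus>\<^bsub>M i\<^esub> y i) i \<oplus>\<^bsub>M i\<^esub> z i) = (\<lambda>i\<in>I. x i \<oplus>\<^bsub>M i\<^esub> (\<lambda>i\<in>I. y i \<oplus>\<^bsub>M i\<^esub> z i) i)"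
      using xyz by (intro restrict_ext) (simp add: laws(1))
    show "(\<lambda>i\<in>I. x i \<oplus>\<^bsub>M i\<^esub> y i) = (\<lambda>i\<in>I. y i \<oplus>\<^bsub>M i\<^esub> x i)"
      using xyz by (intro restrict_ext comm_add) auto
  next
    fix x assume x: "x \<in> (\<Pi>\<^sub>E i\<in>I. carrier (M i))"
    have zero_closed: "\<zero>\<^bsub>M i\<^esub> \<in> carrier (M i)" if "i \<in> I" for i using closed(2)[OF that] mem[OF x that] by blast
    have neg_closed: "\<ominus>\<^bsub>M i\<^esub> x i \<in> carrier (M i)" if "i \<in> I" for i using closed(3)[OF that] mem[OF x that] by blast
    show "(\<lambda>i\<in>I. (\<lambda>i\<in>I. \<zero>\<^bsub>M i\<^esub>) i \<oplus>\<^bsub>M i\<^esub> x i) = x"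
      using x zero_closed by (intro D_eqI) (auto intro!: laws(2) closed(1))
    show "\<exists>y\<in>(\<Pi>\<^sub>E i\<in>I. carrier (M i)). (\<lambda>i\<in>I. y i \<oplus>\<^bsub>M i\<^esub> x i) = (\<lambda>i\<in>I. \<zero>\<^bsub>M i\<^esub>)"
      using x neg_closed by (intro bexI[of _ "\<lambda>i\<in>I. \<ominus>\<^bsub>M i\<^esub> x i"] restrict_ext) (auto intro!: laws(3))
  next
    show "(\<lambda>i\<in>I. \<zero>\<^bsub>M i\<^esub>) \<in> (\<Pi>\<^sub>E i\<in>I. carrier (M i))"
      using abelian_group.axioms(1)[OF ag] abelian_monoid.zero_closed by auto
  qed
  show "bimodule R S ?D" unfolding bimodule_def
  proof (intro conjI ballI)
    show "left_module R ?D (lact ?D)"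
      by (intro left_module.intro left_module_axioms.intro R D; unfold carrier add lact)
        (auto intro!: restrict_ext D_eqI L(1) simp: L(2-5) ring.ring_simprules[OF R])
    show "right_module S ?D (ract ?D)"
      by (intro right_module.intro right_module_axioms.intro S D; unfold carrier add ract)
        (auto intro!: restrict_ext D_eqI Rt(1) simp: Rt(2-5) ring.ring_simprules[OF S])
    fix r s x assume "r \<in> carrier R" "s \<in> carrier S" "x \<in> carrier ?D"
    then show "ract ?D (lact ?D r x) s = lact ?D r (ract ?D x s)"
      by (auto simp: carrier lact ract comm intro!: restrict_ext)
  qed
qed

section \<open>Decomposition over the twist\<close>

context cocycle_twist_data
begin

lemma \<mu>_inv_closed [simp]: "\<lbrakk>g \<in> carrier G; h \<in> carrier G\<rbrakk> \<Longrightarrow> inv\<^bsub>K\<^esub> \<mu> g h \<in> carrier K"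
  using \<mu>_Units K.Units_inv_closed by blast

lemma \<mu>_inv [simp]:
  "\<lbrakk>g \<in> carrier G; h \<in> carrier G\<rbrakk> \<Longrightarrow> \<mu> g h \<otimes>\<^bsub>K\<^esub> inv\<^bsub>K\<^esub> \<mu> g h = \<one>\<^bsub>K\<^esub>"
  "\<lbrakk>g \<in> carrier G; h \<in> carrier G\<rbrakk> \<Longrightarrow> inv\<^bsub>K\<^esub> \<mu> g h \<otimes>\<^bsub>K\<^esub> \<mu> g h = \<one>\<^bsub>K\<^esub>"
  using \<mu>_Units by auto

definition \<phi> :: "'g \<Rightarrow> 'a \<Rightarrow> 'a" where
  "\<phi> g b = (\<Oplus>\<^bsub>A\<^esub>l\<in>carrier G. (\<mu> g l \<otimes>\<^bsub>K\<^esub> inv\<^bsub>K\<^esub> \<mu> l g) \<odot>\<^bsub>A\<^esub> proj l b)"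

text \<open>The scalars are inverse to those of \<open>\<phi> g\<close>, so this is conjugation by
  the inverse of \<open>u g\<close>.\<close>

definition \<psi> :: "'g \<Rightarrow> 'a \<Rightarrow> 'a" where
  "\<psi> g b = (\<Oplus>\<^bsub>A\<^esub>l\<in>carrier G. (\<mu> l g \<otimes>\<^bsub>K\<^esub> inv\<^bsub>K\<^esub> \<mu> g l) \<odot>\<^bsub>A\<^esub> proj l b)"

text \<open>\<open>\<kappa> g x\<close> is the coefficient of \<open>u g\<close> in \<open>x\<close>: its part of degree \<open>l\<close> is that of \<open>x\<close> at \<open>l g\<close>, up to
  the scalar from \<open>(a \<otimes> l) u\<^sub>g = \<mu>(l,g) a \<otimes> lg\<close>.\<close>

definition \<kappa> :: "'g \<Rightarrow> ('g \<Rightarrow> 'a) \<Rightarrow> 'a" where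
  "\<kappa> g x = (\<Oplus>\<^bsub>A\<^esub>l\<in>carrier G. inv\<^bsub>K\<^esub> \<mu> l g \<odot>\<^bsub>A\<^esub> proj l (x (l \<otimes>\<^bsub>G\<^esub> g)))"

lemma \<phi>_closed [simp]: "\<lbrakk>g \<in> carrier G; b \<in> carrier A\<rbrakk> \<Longrightarrow> \<phi> g b \<in> carrier A"
  unfolding \<phi>_def by (auto intro!: AR.finsum_closed)

lemma \<psi>_closed [simp]: "\<lbrakk>g \<in> carrier G; b \<in> carrier A\<rbrakk> \<Longrightarrow> \<psi> g b \<in> carrier A"
  unfolding \<psi>_def by (auto intro!: AR.finsum_closed)

lemma \<kappa>_closed [simp]: "\<lbrakk>g \<in> carrier G; x \<in> carrier T\<rbrakk> \<Longrightarrow> \<kappa> g x \<in> carrier A"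
  unfolding \<kappa>_def by (auto intro!: AR.finsum_closed)

lemma proj_\<phi>: "\<lbrakk>l \<in> carrier G; g \<in> carrier G; b \<in> carrier A\<rbrakk> \<Longrightarrow>
    proj l (\<phi> g b) = (\<mu> g l \<otimes>\<^bsub>K\<^esub> inv\<^bsub>K\<^esub> \<mu> l g) \<odot>\<^bsub>A\<^esub> proj l b"
  unfolding \<phi>_def by (rule proj_sum_parts) auto

lemma proj_\<psi>: "\<lbrakk>l \<in> carrier G; g \<in> carrier G; b \<in> carrier A\<rbrakk> \<Longrightarrow>
    proj l (\<psi> g b) = (\<mu> l g \<otimes>\<^bsub>K\<^esub> inv\<^bsub>K\<^esub> \<mu> g l) \<odot>\<^bsub>A\<^esub> proj l b"
  unfolding \<psi>_def by (rule proj_sum_parts) auto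

lemma proj_\<kappa>: "\<lbrakk>l \<in> carrier G; g \<in> carrier G; x \<in> carrier T\<rbrakk> \<Longrightarrow>
    proj l (\<kappa> g x) = inv\<^bsub>K\<^esub> \<mu> l g \<odot>\<^bsub>A\<^esub> proj l (x (l \<otimes>\<^bsub>G\<^esub> g))"
  unfolding \<kappa>_def by (rule proj_sum_parts[where f = "\<lambda>l. x (l \<otimes>\<^bsub>G\<^esub> g)"]) auto

lemma scalar_cancel:
  assumes "g \<in> carrier G" "l \<in> carrier G"
  shows "(\<mu> g l \<otimes>\<^bsub>K\<^esub> inv\<^bsub>K\<^esub> \<mu> l g) \<otimes>\<^bsub>K\<^esub> (\<mu> l g \<otimes>\<^bsub>K\<^esub> inv\<^bsub>K\<^esub> \<mu> g l) = \<one>\<^bsub>K\<^esub>"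
proof -
  have "(\<mu> g l \<otimes>\<^bsub>K\<^esub> inv\<^bsub>K\<^esub> \<mu> l g) \<otimes>\<^bsub>K\<^esub> (\<mu> l g \<otimes>\<^bsub>K\<^esub> inv\<^bsub>K\<^esub> \<mu> g l) =
      (\<mu> g l \<otimes>\<^bsub>K\<^esub> inv\<^bsub>K\<^esub> \<mu> g l) \<otimes>\<^bsub>K\<^esub> (\<mu> l g \<otimes>\<^bsub>K\<^esub> inv\<^bsub>K\<^esub> \<mu> l g)"
    using assms by (simp add: K.m_ac del: \<mu>_inv)
  then show ?thesis using assms by simp
qed

lemma \<phi>_\<psi>: "\<lbrakk>g \<in> carrier G; b \<in> carrier A\<rbrakk> \<Longrightarrow> \<phi> g (\<psi> g b) = b"
  by (rule proj_eqI) (simp_all add: proj_\<phi> proj_\<psi> A.smult_assoc1[symmetric] scalar_cancel)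

lemma \<psi>_\<phi>: "\<lbrakk>g \<in> carrier G; b \<in> carrier A\<rbrakk> \<Longrightarrow> \<psi> g (\<phi> g b) = b"
  by (rule proj_eqI) (simp_all add: proj_\<phi> proj_\<psi> A.smult_assoc1[symmetric] scalar_cancel)

lemma \<phi>_one: "b \<in> carrier A \<Longrightarrow> \<phi> \<one>\<^bsub>G\<^esub> b = b"
  by (rule proj_eqI) (simp_all add: proj_\<phi>)

lemma mult_u: "\<lbrakk>x \<in> carrier T; g \<in> carrier G; l \<in> carrier G\<rbrakk> \<Longrightarrow>
    (x \<otimes>\<^bsub>T\<^esub> u g) l = \<mu> (l \<otimes>\<^bsub>G\<^esub> inv\<^bsub>G\<^esub> g) g \<odot>\<^bsub>A\<^esub> x (l \<otimes>\<^bsub>G\<^esub> inv\<^bsub>G\<^esub> g)"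
  by (simp add: mult_pure_tensor)

text \<open>Conjugation by the unit \<open>1 \<otimes> g\<close> preserves the image of the twist and induces \<open>\<phi> g\<close> on it.\<close>

lemma u_mult_\<iota>:
  assumes g: "g \<in> carrier G" and b: "b \<in> carrier A"
  shows "u g \<otimes>\<^bsub>T\<^esub> \<iota> b = \<iota> (\<phi> g b) \<otimes>\<^bsub>T\<^esub> u g"
proof (rule T_eqI)
  fix m assume m: "m \<in> carrier G"
  have "inv\<^bsub>G\<^esub> g \<otimes>\<^bsub>G\<^esub> m = m \<otimes>\<^bsub>G\<^esub> inv\<^bsub>G\<^esub> g" using g m by (intro G.m_comm) auto
  moreover define l where "l = m \<otimes>\<^bsub>G\<^esub> inv\<^bsub>G\<^esub> g"
  moreover have l: "l \<in> carrier G" using g m by (simp add: l_def)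
  moreover have "\<mu> l g \<otimes>\<^bsub>K\<^esub> (\<mu> g l \<otimes>\<^bsub>K\<^esub> inv\<^bsub>K\<^esub> \<mu> l g) = \<mu> g l \<otimes>\<^bsub>K\<^esub> (\<mu> l g \<otimes>\<^bsub>K\<^esub> inv\<^bsub>K\<^esub> \<mu> l g)"
    using g l by (intro K.m_lcomm) auto
  ultimately show "(u g \<otimes>\<^bsub>T\<^esub> \<iota> b) m = (\<iota> (\<phi> g b) \<otimes>\<^bsub>T\<^esub> u g) m"
    using g b m by (simp add: pure_tensor_mult mult_u proj_\<phi> A.smult_assoc1[symmetric])
qed (use g b in auto)

text \<open>Right multiplication by \<open>u g\<close> moves the component at \<open>l\<close> to
  \<open>l g\<close> and rescales it by the unit \<open>\<mu> l g\<close>.\<close>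

lemma u_cancel:
  assumes g: "g \<in> carrier G" and x: "x \<in> carrier T" and y: "y \<in> carrier T" and eq: "x \<otimes>\<^bsub>T\<^esub> u g = y \<otimes>\<^bsub>T\<^esub> u g"
  shows "x = y"
proof (rule T_eqI[OF x y])
  fix l assume l: "l \<in> carrier G"
  have "l \<otimes>\<^bsub>G\<^esub> g \<otimes>\<^bsub>G\<^esub> inv\<^bsub>G\<^esub> g = l" using g l by (simp add: G.m_assoc)
  then have "\<mu> l g \<odot>\<^bsub>A\<^esub> x l = \<mu> l g \<odot>\<^bsub>A\<^esub> y l"
    using fun_cong[OF eq, of "l \<otimes>\<^bsub>G\<^esub> g"] mult_u[OF x g, of "l \<otimes>\<^bsub>G\<^esub> g"] mult_u[OF y g, of "l \<otimes>\<^bsub>G\<^esub> g"] g l by simp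
  then have "inv\<^bsub>K\<^esub> \<mu> l g \<odot>\<^bsub>A\<^esub> (\<mu> l g \<odot>\<^bsub>A\<^esub> x l) = inv\<^bsub>K\<^esub> \<mu> l g \<odot>\<^bsub>A\<^esub> (\<mu> l g \<odot>\<^bsub>A\<^esub> y l)" by simp
  then show "x l = y l" using g l x y by (simp add: A.smult_assoc1[symmetric])
qed

text \<open>Moving \<open>u g\<close> past the image of a product, either at once or one factor at a
  time, and cancelling it gives multiplicativity. Associativity in the twisted group algebra takes
  the place of an identity between the scalars.\<close>

lemma \<phi>_ring_hom:
  assumes g: "g \<in> carrier G"
  shows "\<phi> g \<in> ring_hom B B"
proof (rule ring_hom_memI)
  fix a b assume ab: "a \<in> carrier B" "b \<in> carrier B"
  have ab': "a \<in> carrier A" "b \<in> carrier A" using ab by auto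
  have ug: "u g \<in> carrier T" by simp
  have c: "\<iota> a \<in> carrier T" "\<iota> b \<in> carrier T" "\<iota> (\<phi> g a) \<in> carrier T" "\<iota> (\<phi> g b) \<in> carrier T"
    using g ab' by auto
  have "\<iota> (\<phi> g (a \<otimes>\<^bsub>B\<^esub> b)) \<otimes>\<^bsub>T\<^esub> u g = u g \<otimes>\<^bsub>T\<^esub> (\<iota> a \<otimes>\<^bsub>T\<^esub> \<iota> b)"
    using u_mult_\<iota>[OF g B_mult_closed[OF ab'], symmetric] \<iota>_mult[OF ab'] by (simp only:)
  also have "\<dots> = \<iota> (\<phi> g a) \<otimes>\<^bsub>T\<^esub> u g \<otimes>\<^bsub>T\<^esub> \<iota> b"
    by (simp only: T.m_assoc[OF ug c(1,2), symmetric] u_mult_\<iota>[OF g ab'(1)])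
  also have "\<dots> = \<iota> (\<phi> g a) \<otimes>\<^bsub>T\<^esub> (\<iota> (\<phi> g b) \<otimes>\<^bsub>T\<^esub> u g)"
    by (simp only: T.m_assoc[OF c(3) ug c(2)] u_mult_\<iota>[OF g ab'(2)])
  also have "\<dots> = \<iota> (\<phi> g a \<otimes>\<^bsub>B\<^esub> \<phi> g b) \<otimes>\<^bsub>T\<^esub> u g"
    using g ab' by (simp only: T.m_assoc[OF c(3,4) ug, symmetric] \<iota>_mult \<phi>_closed)
  finally have "\<iota> (\<phi> g (a \<otimes>\<^bsub>B\<^esub> b)) = \<iota> (\<phi> g a \<otimes>\<^bsub>B\<^esub> \<phi> g b)"
    by (rule u_cancel[OF g, rotated 2]) (use g ab' in \<open>simp_all add: B_mult_closed\<close>)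
  then show "\<phi> g (a \<otimes>\<^bsub>B\<^esub> b) = \<phi> g a \<otimes>\<^bsub>B\<^esub> \<phi> g b"
    using g ab' by (intro \<iota>_inj) (simp_all add: B_mult_closed)
  show "\<phi> g (a \<oplus>\<^bsub>B\<^esub> b) = \<phi> g a \<oplus>\<^bsub>B\<^esub> \<phi> g b"
    unfolding B_simps by (rule proj_eqI) (use g ab' in \<open>simp_all add: proj_\<phi> proj_add A.smult_r_distr\<close>)
next
  show "\<phi> g \<one>\<^bsub>B\<^esub> = \<one>\<^bsub>B\<^esub>"
    unfolding B_simps by (rule proj_eqI) (use g in \<open>simp_all add: proj_\<phi> proj_one\<close>)
qed (use g in auto)

lemma \<phi>_bij: "g \<in> carrier G \<Longrightarrow> bij_betw (\<phi> g) (carrier A) (carrier A)"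
  by (rule bij_betw_byWitness[where f' = "\<psi> g"]) (auto simp: \<phi>_\<psi> \<psi>_\<phi>)

lemma \<phi>_smult: "\<lbrakk>g \<in> carrier G; c \<in> carrier K; b \<in> carrier A\<rbrakk> \<Longrightarrow> \<phi> g (c \<odot>\<^bsub>A\<^esub> b) = c \<odot>\<^bsub>A\<^esub> \<phi> g b"
  by (rule proj_eqI) (auto simp: proj_\<phi> proj_smult A.smult_assoc1[symmetric] K.m_comm)

lemma \<phi>_alg_auts: "g \<in> carrier G \<Longrightarrow> \<phi> g \<in> alg_auts K B"
  by (simp add: alg_auts_def ring_iso_def \<phi>_ring_hom \<phi>_bij \<phi>_smult)

lemma sum_\<iota>_mult_u_apply:
  assumes b: "b \<in> carrier G \<rightarrow> carrier A" and m: "m \<in> carrier G"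
  shows "(\<Oplus>\<^bsub>T\<^esub>g\<in>carrier G. \<iota> (b g) \<otimes>\<^bsub>T\<^esub> u g) m =
    (\<Oplus>\<^bsub>A\<^esub>g\<in>carrier G. \<mu> (m \<otimes>\<^bsub>G\<^esub> inv\<^bsub>G\<^esub> g) g \<odot>\<^bsub>A\<^esub> proj (m \<otimes>\<^bsub>G\<^esub> inv\<^bsub>G\<^esub> g) (b g))"
proof -
  have bc: "b g \<in> carrier A" if "g \<in> carrier G" for g using b that by auto
  show ?thesis using bc m finite_G
    by (subst T_finsum) (auto intro!: AR.finsum_cong' simp: mult_u)
qed

text \<open>Coefficients of an expansion are unique: at \<open>l h\<close> the summand of
  \<open>u g\<close> has degree \<open>l h g\<^sup>-\<^sup>1\<close>, which equals \<open>l\<close>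
  only for \<open>g = h\<close>. So the part of degree \<open>l\<close> at \<open>l h\<close>
  isolates one coefficient.\<close>

lemma \<kappa>_sum:
  assumes b: "b \<in> carrier G \<rightarrow> carrier A" and h: "h \<in> carrier G"
  shows "\<kappa> h (\<Oplus>\<^bsub>T\<^esub>g\<in>carrier G. \<iota> (b g) \<otimes>\<^bsub>T\<^esub> u g) = b h"
proof (rule proj_eqI)
  let ?x = "\<Oplus>\<^bsub>T\<^esub>g\<in>carrier G. \<iota> (b g) \<otimes>\<^bsub>T\<^esub> u g"
  have bc: "b g \<in> carrier A" if "g \<in> carrier G" for g using b that by auto
  have x: "?x \<in> carrier T" using bc by (intro T.finsum_closed) auto
  show "b h \<in> carrier A" "\<kappa> h ?x \<in> carrier A" using bc h x by auto
  fix l assume l: "l \<in> carrier G"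
  have lh: "l \<otimes>\<^bsub>G\<^esub> h \<in> carrier G" using l h by simp
  have eq: "l \<otimes>\<^bsub>G\<^esub> h \<otimes>\<^bsub>G\<^esub> inv\<^bsub>G\<^esub> g = l \<longleftrightarrow> h = g" if g: "g \<in> carrier G" for g
    using g l h by (metis G.inv_solve_right G.l_cancel G.m_closed)
  have "proj l (?x (l \<otimes>\<^bsub>G\<^esub> h)) = (\<Oplus>\<^bsub>A\<^esub>g\<in>carrier G. if h = g then \<mu> l g \<odot>\<^bsub>A\<^esub> proj l (b g) else \<zero>\<^bsub>A\<^esub>)"
    unfolding sum_\<iota>_mult_u_apply[OF b lh]
  proof (subst proj_finsum[OF l finite_G], use bc l h in force, intro AR.finsum_cong' refl)
    fix g assume g: "g \<in> carrier G"
    show "proj l (\<mu> (l \<otimes>\<^bsub>G\<^esub> h \<otimes>\<^bsub>G\<^esub> inv\<^bsub>G\<^esub> g) g \<odot>\<^bsub>A\<^esub> proj (l \<otimes>\<^bsub>G\<^esub> h \<otimes>\<^bsub>G\<^esub> inv\<^bsub>G\<^esub> g) (b g)) =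
        (if h = g then \<mu> l g \<odot>\<^bsub>A\<^esub> proj l (b g) else \<zero>\<^bsub>A\<^esub>)"
      unfolding eq[OF g, symmetric] using g l h bc[OF g] by (auto simp: proj_smult proj_proj)
  qed (use bc l in auto)
  also have "\<dots> = \<mu> l h \<odot>\<^bsub>A\<^esub> proj l (b h)" using bc l by (intro AR.finsum_singleton h finite_G) auto
  finally show "proj l (\<kappa> h ?x) = proj l (b h)"
    using l h x bc by (simp add: proj_\<kappa> A.smult_assoc1[symmetric])
qed

text \<open>At \<open>m\<close> the scalar in \<open>\<kappa> g\<close> cancels the one from
  multiplying by \<open>u g\<close>, leaving the part of \<open>x m\<close> of degree
  \<open>m g\<^sup>-\<^sup>1\<close>. These degrees run once through the group, so the parts add up
  to \<open>x m\<close>.\<close>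

lemma sum_\<kappa>:
  assumes x: "x \<in> carrier T"
  shows "(\<Oplus>\<^bsub>T\<^esub>g\<in>carrier G. \<iota> (\<kappa> g x) \<otimes>\<^bsub>T\<^esub> u g) = x"
proof (rule T_eqI)
  show "(\<Oplus>\<^bsub>T\<^esub>g\<in>carrier G. \<iota> (\<kappa> g x) \<otimes>\<^bsub>T\<^esub> u g) \<in> carrier T"
    using x by (intro T.finsum_closed) auto
  fix m assume m: "m \<in> carrier G"
  let ?f = "\<lambda>g. m \<otimes>\<^bsub>G\<^esub> inv\<^bsub>G\<^esub> g"
  have f: "?f ` carrier G = carrier G" "inj_on ?f (carrier G)"
  proof -
    show "inj_on ?f (carrier G)" using m by (auto simp: inj_on_def)
    show "?f ` carrier G = carrier G"
    proof (intro equalityI subsetI)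
      fix l assume l: "l \<in> carrier G"
      then have "l = ?f (inv\<^bsub>G\<^esub> l \<otimes>\<^bsub>G\<^esub> m)" using m by (simp add: G.inv_mult_group G.m_assoc[symmetric])
      then show "l \<in> ?f ` carrier G" using l m by blast
    qed (use m in auto)
  qed
  have "(\<Oplus>\<^bsub>T\<^esub>g\<in>carrier G. \<iota> (\<kappa> g x) \<otimes>\<^bsub>T\<^esub> u g) m =
      (\<Oplus>\<^bsub>A\<^esub>g\<in>carrier G. \<mu> (?f g) g \<odot>\<^bsub>A\<^esub> proj (?f g) (\<kappa> g x))"
    using x m by (intro sum_\<iota>_mult_u_apply) auto
  also have "\<dots> = (\<Oplus>\<^bsub>A\<^esub>g\<in>carrier G. proj (?f g) (x m))"
    using x m by (intro AR.finsum_cong')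
      (auto simp: proj_\<kappa> A.smult_assoc1[symmetric] G.m_assoc)
  also have "\<dots> = (\<Oplus>\<^bsub>A\<^esub>l\<in>?f ` carrier G. proj l (x m))"
    using x m f by (intro AR.finsum_reindex[symmetric]) auto
  also have "\<dots> = x m" unfolding f(1) using sum_proj x m by simp
  finally show "(\<Oplus>\<^bsub>T\<^esub>g\<in>carrier G. \<iota> (\<kappa> g x) \<otimes>\<^bsub>T\<^esub> u g) m = x m" .
qed (use x in auto)

text \<open>Uniqueness as a rule: coefficients are computed by exhibiting an expansion.\<close>

lemma \<kappa>_eqI:
  assumes "b \<in> carrier G \<rightarrow> carrier A" "(\<Oplus>\<^bsub>T\<^esub>g\<in>carrier G. \<iota> (b g) \<otimes>\<^bsub>T\<^esub> u g) = x" "h \<in> carrier G"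
  shows "\<kappa> h x = b h"
  using \<kappa>_sum assms by blast

lemma \<kappa>_add: "\<lbrakk>g \<in> carrier G; x \<in> carrier T; y \<in> carrier T\<rbrakk> \<Longrightarrow> \<kappa> g (x \<oplus>\<^bsub>T\<^esub> y) = \<kappa> g x \<oplus>\<^bsub>A\<^esub> \<kappa> g y"
  by (rule proj_eqI) (auto simp: proj_\<kappa> proj_add A.smult_r_distr)

lemma \<kappa>_left:
  assumes g: "g \<in> carrier G" and b: "b \<in> carrier A" and x: "x \<in> carrier T"
  shows "\<kappa> g (\<iota> b \<otimes>\<^bsub>T\<^esub> x) = b \<otimes>\<^bsub>B\<^esub> \<kappa> g x"
proof (rule \<kappa>_eqI[OF _ _ g])
  have "(\<Oplus>\<^bsub>T\<^esub>g\<in>carrier G. \<iota> (b \<otimes>\<^bsub>B\<^esub> \<kappa> g x) \<otimes>\<^bsub>T\<^esub> u g) = (\<Oplus>\<^bsub>T\<^esub>g\<in>carrier G. \<iota> b \<otimes>\<^bsub>T\<^esub> (\<iota> (\<kappa> g x) \<otimes>\<^bsub>T\<^esub> u g))"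
    using b x by (intro T.finsum_cong') (auto simp: \<iota>_mult T.m_assoc)
  also have "\<dots> = \<iota> b \<otimes>\<^bsub>T\<^esub> (\<Oplus>\<^bsub>T\<^esub>g\<in>carrier G. \<iota> (\<kappa> g x) \<otimes>\<^bsub>T\<^esub> u g)"
    using b x finite_G by (intro T.finsum_rdistr[symmetric]) auto
  finally show "(\<Oplus>\<^bsub>T\<^esub>g\<in>carrier G. \<iota> (b \<otimes>\<^bsub>B\<^esub> \<kappa> g x) \<otimes>\<^bsub>T\<^esub> u g) = \<iota> b \<otimes>\<^bsub>T\<^esub> x" by (simp add: sum_\<kappa> x)
qed (use b x in \<open>auto simp: B_mult_closed\<close>)

text \<open>Moving \<open>\<iota> b\<close> leftwards past \<open>u g\<close> turns it into the
  image of \<open>\<phi> g b\<close>; this is where the twisted right action comes from.\<close>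

lemma \<kappa>_right:
  assumes g: "g \<in> carrier G" and b: "b \<in> carrier A" and x: "x \<in> carrier T"
  shows "\<kappa> g (x \<otimes>\<^bsub>T\<^esub> \<iota> b) = \<kappa> g x \<otimes>\<^bsub>B\<^esub> \<phi> g b"
proof (rule \<kappa>_eqI[OF _ _ g])
  have "(\<Oplus>\<^bsub>T\<^esub>g\<in>carrier G. \<iota> (\<kappa> g x \<otimes>\<^bsub>B\<^esub> \<phi> g b) \<otimes>\<^bsub>T\<^esub> u g) = (\<Oplus>\<^bsub>T\<^esub>g\<in>carrier G. \<iota> (\<kappa> g x) \<otimes>\<^bsub>T\<^esub> u g \<otimes>\<^bsub>T\<^esub> \<iota> b)"
    using b x by (intro T.finsum_cong') (auto simp: \<iota>_mult T.m_assoc u_mult_\<iota>)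
  also have "\<dots> = (\<Oplus>\<^bsub>T\<^esub>g\<in>carrier G. \<iota> (\<kappa> g x) \<otimes>\<^bsub>T\<^esub> u g) \<otimes>\<^bsub>T\<^esub> \<iota> b"
    using b x finite_G by (intro T.finsum_ldistr[symmetric]) auto
  finally show "(\<Oplus>\<^bsub>T\<^esub>g\<in>carrier G. \<iota> (\<kappa> g x \<otimes>\<^bsub>B\<^esub> \<phi> g b) \<otimes>\<^bsub>T\<^esub> u g) = x \<otimes>\<^bsub>T\<^esub> \<iota> b" by (simp add: sum_\<kappa> x)
qed (use b x in \<open>auto simp: B_mult_closed\<close>)

lemma \<kappa>_u:
  assumes "g \<in> carrier G" "h \<in> carrier G"
  shows "\<kappa> g (u h) = (if g = h then \<one>\<^bsub>A\<^esub> else \<zero>\<^bsub>A\<^esub>)"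
proof (rule proj_eqI)
  fix l assume l: "l \<in> carrier G"
  \<comment> \<open>One is homogeneous of identity degree, so only the identity \<open>l\<close> can
    contribute, and there the component of \<open>u h\<close> in question is the one at
    \<open>g\<close>.\<close>
  have eq: "l \<otimes>\<^bsub>G\<^esub> g = h \<longleftrightarrow> g = h" if "l = \<one>\<^bsub>G\<^esub>" using that assms by simp
  show "proj l (\<kappa> g (u h)) = proj l (if g = h then \<one>\<^bsub>A\<^esub> else \<zero>\<^bsub>A\<^esub>)"
    using assms l eq by (cases "l = \<one>\<^bsub>G\<^esub>") (auto simp: proj_\<kappa> proj_one)
qed (use assms in auto)

section \<open>Coefficients on the right and the decomposition\<close>

lemma \<psi>_add: "\<lbrakk>g \<in> carrier G; a \<in> carrier A; b \<in> carrier A\<rbrakk> \<Longrightarrow> \<psi> g (a \<oplus>\<^bsub>A\<^esub> b) = \<psi> g a \<oplus>\<^bsub>A\<^esub> \<psi> g b"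
  by (rule proj_eqI) (auto simp: proj_\<psi> proj_add A.smult_r_distr)

lemma \<psi>_one_zero: "g \<in> carrier G \<Longrightarrow> \<psi> g \<one>\<^bsub>A\<^esub> = \<one>\<^bsub>A\<^esub>" "g \<in> carrier G \<Longrightarrow> \<psi> g \<zero>\<^bsub>A\<^esub> = \<zero>\<^bsub>A\<^esub>"
  by (rule proj_eqI; auto simp: proj_\<psi> proj_one)+

text \<open>As the inverse of an automorphism, \<open>\<psi> g\<close> undoes the twist in
  \<open>\<kappa>_right\<close>: it makes \<open>\<psi> g (\<kappa> g x)\<close> linear for plain
  right multiplication.\<close>

lemma \<psi>_mult_\<phi>:
  assumes g: "g \<in> carrier G" and a: "a \<in> carrier A" and b: "b \<in> carrier A"
  shows "\<psi> g (a \<otimes>\<^bsub>B\<^esub> \<phi> g b) = \<psi> g a \<otimes>\<^bsub>B\<^esub> b"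
proof -
  have "\<phi> g (\<psi> g a \<otimes>\<^bsub>B\<^esub> b) = a \<otimes>\<^bsub>B\<^esub> \<phi> g b"
    using ring_hom_mult[OF \<phi>_ring_hom[OF g], of "\<psi> g a" b] g a b by (simp add: \<phi>_\<psi>)
  then show ?thesis using \<psi>_\<phi>[OF g, of "\<psi> g a \<otimes>\<^bsub>B\<^esub> b"] g a b by (simp add: B_mult_closed)
qed

lemma faithfully_flat_twist: "faithfully_flat_extension TYPE('t) B T \<iota>"
  unfolding faithfully_flat_extension_def
proof (intro conjI ring_extension_twist)
  have ne: "carrier G \<noteq> {}" using G.one_closed by blast
  have "faithfully_flat_left TYPE('t) B T (\<lambda>r x. \<iota> r \<otimes>\<^bsub>T\<^esub> x)"
    by (rule faithfully_flat_leftI[OF left_module_extension[OF ring_extension_twist] finite_G ne,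
          where e = u and \<kappa> = \<kappa>])
      (simp_all add: sum_\<kappa> \<kappa>_add \<kappa>_left \<kappa>_u)
  then show "faithfully_flat_left TYPE('t) B T (\<lambda>r. (\<otimes>\<^bsub>T\<^esub>) (\<iota> r))" .
  \<comment> \<open>Passing \<open>u g\<close> to the front by \<open>u_mult_\<iota>\<close>
    replaces the left coefficient by its image under \<open>\<psi> g\<close>, since
    \<open>\<phi> g\<close> undoes \<open>\<psi> g\<close>.\<close>
  have expand: "x = (\<Oplus>\<^bsub>T\<^esub>g\<in>carrier G. u g \<otimes>\<^bsub>T\<^esub> \<iota> (\<psi> g (\<kappa> g x)))" if x: "x \<in> carrier T" for x
  proof -
    have "(\<Oplus>\<^bsub>T\<^esub>g\<in>carrier G. u g \<otimes>\<^bsub>T\<^esub> \<iota> (\<psi> g (\<kappa> g x))) = (\<Oplus>\<^bsub>T\<^esub>g\<in>carrier G. \<iota> (\<kappa> g x) \<otimes>\<^bsub>T\<^esub> u g)"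
      using x by (intro T.finsum_cong') (auto simp: u_mult_\<iota> \<phi>_\<psi>)
    then show ?thesis by (simp add: sum_\<kappa> x)
  qed
  show "faithfully_flat_right TYPE('t) B T (\<lambda>x r. x \<otimes>\<^bsub>T\<^esub> \<iota> r)"
    by (rule faithfully_flat_rightI[OF right_module_extension[OF ring_extension_twist] finite_G ne,
          where e = u and \<kappa> = "\<lambda>g x. \<psi> g (\<kappa> g x)", OF _ _ expand])
      (simp_all add: \<kappa>_add \<psi>_add \<kappa>_right \<psi>_mult_\<phi> \<kappa>_u \<psi>_one_zero)
qed

text \<open>An element goes to the family of its left coefficients. The rules
  \<open>\<kappa>_left\<close> and \<open>\<kappa>_right\<close> match the two actions, and summing
  expansions is the inverse by \<open>sum_\<kappa>\<close> and \<open>\<kappa>_sum\<close>.\<close>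

lemma bimodule_decomposition:
  "bimodule_isomorphic B B (extension_bimod T \<iota>) (direct_sum_bimod (carrier G) (\<lambda>g. id_twist_bimod B (\<phi> g)))"
  unfolding bimodule_isomorphic_def
proof (intro conjI exI[of _ "\<lambda>x. \<lambda>g\<in>carrier G. \<kappa> g x"])
  let ?E = "extension_bimod T \<iota>" and ?M = "\<lambda>g. id_twist_bimod B (\<phi> g)"
  let ?D = "direct_sum_bimod (carrier G) ?M"
  have M: "bimodule B B (?M g)" if "g \<in> carrier G" for g
    using bimodule_id_twist[OF ring_B \<phi>_ring_hom[OF that]] .
  note D = bimodule_direct_sum[OF finite_G M ring_B ring_B]
  have carrier_D: "carrier ?D = (\<Pi>\<^sub>E g\<in>carrier G. carrier A)"
    using D(2) by (simp add: id_twist_bimod_def)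
  have carrier_E: "carrier ?E = carrier T" by (simp add: extension_bimod_def)
  show "bimodule B B ?E" by (rule bimodule_extension[OF ring_extension_twist])
  show "bimodule B B ?D" by (rule D(1)) auto
  have hom: "(\<lambda>x. \<lambda>g\<in>carrier G. \<kappa> g x) \<in> hom (add_monoid ?E) (add_monoid ?D)"
    by (rule homI) (auto simp: carrier_D carrier_E, auto simp: extension_bimod_def direct_sum_bimod_def id_twist_bimod_def \<kappa>_add
        intro!: restrict_ext)
  show "(\<lambda>x. \<lambda>g\<in>carrier G. \<kappa> g x) \<in> left_module_hom B ?E (lact ?E) ?D (lact ?D)"
    unfolding left_module_hom_def using hom
    by (auto simp: carrier_E) (auto simp: extension_bimod_def direct_sum_bimod_def id_twist_bimod_def \<kappa>_left intro!: restrict_ext)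
  show "(\<lambda>x. \<lambda>g\<in>carrier G. \<kappa> g x) \<in> right_module_hom B ?E (ract ?E) ?D (ract ?D)"
    unfolding right_module_hom_def using hom
    by (auto simp: carrier_E) (auto simp: extension_bimod_def direct_sum_bimod_def id_twist_bimod_def \<kappa>_right intro!: restrict_ext)
  show "bij_betw (\<lambda>x. \<lambda>g\<in>carrier G. \<kappa> g x) (carrier ?E) (carrier ?D)"
    unfolding carrier_D carrier_E
  proof (rule bij_betw_byWitness[where f' = "\<lambda>b. \<Oplus>\<^bsub>T\<^esub>g\<in>carrier G. \<iota> (b g) \<otimes>\<^bsub>T\<^esub> u g"])
    show "\<forall>x\<in>carrier T. (\<Oplus>\<^bsub>T\<^esub>g\<in>carrier G. \<iota> ((\<lambda>g\<in>carrier G. \<kappa> g x) g) \<otimes>\<^bsub>T\<^esub> u g) = x"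
    proof
      fix x assume x: "x \<in> carrier T"
      have "(\<Oplus>\<^bsub>T\<^esub>g\<in>carrier G. \<iota> ((\<lambda>g\<in>carrier G. \<kappa> g x) g) \<otimes>\<^bsub>T\<^esub> u g) = (\<Oplus>\<^bsub>T\<^esub>g\<in>carrier G. \<iota> (\<kappa> g x) \<otimes>\<^bsub>T\<^esub> u g)"
        using x by (intro T.finsum_cong') auto
      then show "(\<Oplus>\<^bsub>T\<^esub>g\<in>carrier G. \<iota> ((\<lambda>g\<in>carrier G. \<kappa> g x) g) \<otimes>\<^bsub>T\<^esub> u g) = x" using sum_\<kappa>[OF x] by simp
    qed
    show "\<forall>b\<in>\<Pi>\<^sub>E g\<in>carrier G. carrier A.
        (\<lambda>h\<in>carrier G. \<kappa> h (\<Oplus>\<^bsub>T\<^esub>g\<in>carrier G. \<iota> (b g) \<otimes>\<^bsub>T\<^esub> u g)) = b"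
    proof
      fix b assume b: "b \<in> (\<Pi>\<^sub>E g\<in>carrier G. carrier A)"
      then have "b \<in> carrier G \<rightarrow> carrier A" by auto
      then show "(\<lambda>h\<in>carrier G. \<kappa> h (\<Oplus>\<^bsub>T\<^esub>g\<in>carrier G. \<iota> (b g) \<otimes>\<^bsub>T\<^esub> u g)) = b"
        using b by (intro extensionalityI[of _ "carrier G"]) (auto simp: \<kappa>_sum PiE_def)
    qed
    show "(\<lambda>b. \<Oplus>\<^bsub>T\<^esub>g\<in>carrier G. \<iota> (b g) \<otimes>\<^bsub>T\<^esub> u g) ` (\<Pi>\<^sub>E g\<in>carrier G. carrier A) \<subseteq> carrier T"
      by (auto intro!: T.finsum_closed T.m_closed \<iota>_closed simp: PiE_mem)
  qed auto
qed

end

theorem proposition1p1p12: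
  fixes K :: "('k, 'x) ring_scheme"
    and A :: "('k, 'a, 'y) module_scheme"
    and G :: "('g, 'z) monoid_scheme"
    and act :: "'g \<Rightarrow> 'a \<Rightarrow> 'a"
    and \<chi> :: "'g \<Rightarrow> 'g \<Rightarrow> 'k"
    and \<mu> :: "'g \<Rightarrow> 'g \<Rightarrow> 'k"
  defines "AGmu \<equiv> twisted_group_algebra A G \<mu>"
    and "B \<equiv> cocycle_twist A G act \<chi> \<mu>"
    and "\<iota> \<equiv> twist_embedding A G act \<chi>"
  assumes "algebraically_closed K"
    and "assoc_algebra K A"
    and "comm_group G" and "finite (carrier G)"
    and "\<not> ring_characteristic K dvd order G"
    and "acts_by_alg_auts K A G act"
    and "\<chi> \<in> iso G (dual_group G K)"
    and "normalised_2cocycle G K \<mu>"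
  shows "(\<exists>\<phi>. (\<forall>g\<in>carrier G. \<phi> g \<in> alg_auts K B) \<and>
              (\<forall>b\<in>carrier B. \<phi> \<one>\<^bsub>G\<^esub> b = b) \<and>
              bimodule_isomorphic B B (extension_bimod AGmu \<iota>)
                (direct_sum_bimod (carrier G) (\<lambda>g. id_twist_bimod B (\<phi> g))) \<and>
              (\<forall>g\<in>carrier G.
                 free_left_module B (id_twist_bimod B (\<phi> g)) (lact (id_twist_bimod B (\<phi> g))) \<and>
                 free_right_module B (id_twist_bimod B (\<phi> g)) (ract (id_twist_bimod B (\<phi> g))))) \<and>
         faithfully_flat_extension TYPE('t) B AGmu \<iota> \<and>
         faithfully_flat_extension TYPE('t) A AGmu (base_embedding A G)"
proof -
  interpret K: algebraically_closed K by fact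
  interpret G: comm_group G by fact
  interpret A: assoc_algebra K A by fact
  have data: "cocycle_twist_data K G \<chi> A \<mu> act"
    using assms(7-11)
    by (intro cocycle_twist_data.intro self_dual_group.intro self_dual_group_axioms.intro
        twisted_algebra.intro twisted_algebra_axioms.intro cocycle_twist_data_axioms.intro
        K.field_axioms K.cring_axioms G.comm_group_axioms G.group_axioms A.ring_axioms A.assoc_algebra_axioms)
  let ?\<phi> = "cocycle_twist_data.\<phi> K G \<chi> A \<mu> act"
  note ring = cocycle_twist_data.ring_B[OF data]
  note auts = cocycle_twist_data.\<phi>_alg_auts[OF data]
  have iso: "?\<phi> g \<in> ring_iso (cocycle_twist A G act \<chi> \<mu>) (cocycle_twist A G act \<chi> \<mu>)" if "g \<in> carrier G" for g
    using auts[OF that] by (simp add: alg_auts_def)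
  show ?thesis
    unfolding AGmu_def B_def \<iota>_def
    using auts cocycle_twist_data.\<phi>_one[OF data] cocycle_twist_data.bimodule_decomposition[OF data]
      free_left_module_id_twist[OF ring] free_right_module_id_twist[OF ring iso]
      cocycle_twist_data.faithfully_flat_twist[OF data]
      twisted_algebra.faithfully_flat_base[OF cocycle_twist_data.axioms(2)[OF data]]
    by (intro conjI exI[of _ ?\<phi>] ballI) (simp_all add: cocycle_twist_data.B_simps[OF data])
qed

end
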